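(* Let $\mathcal{H}$ be a normalized complete Pick space and let $b$ belong to the closed unit ball of $\operatorname{Mult}(\mathcal{H})$. Then $b$ is an extreme point of the closed unit ball of $\operatorname{Mult}(\mathcal{H})$ if and only if $b$ is column extreme.
   Context: All reproducing kernel Hilbert spaces (RKHS) consist of complex-valued functions on a set $X$ and are assumed separable. For an RKHS $\mathcal{H}$, $\operatorname{Mult}(\mathcal{H})$ is the algebra of functions $\varphi:X\to\mathbb{C}$ with $\varphi f\in\mathcal{H}$ for all $f\in\mathcal{H}$, equipped with the operator norm of the multiplication operator $M_\varphi$ on $\mathcal{H}$. Normalized complete Pick space: an RKHS $\mathcal{H}$ on $X$ with kernel $K$ such that there is $z_0\in X$ with $K(z,z_0)=1$ for all $z\in X$, and $\mathcal{H}$ has the complete Pick property: for every finite $Y\subset X$ and all $M,N\in\mathbb{N}$, the restriction map from $N\times M$ matrices of multipliers of $\mathcal{H}$ to $N\times M$ matrices of multipliers of $\mathcal{H}|_Y$ (the RKHS on $Y$ with kernel $K|_{Y\times Y}$) maps the closed unit ball onto the closed unit ball, where matrices carry the operator norm of the induced multiplication operator. Equivalently (Agler--McCarthy, McCullough, Quiggin), there are $d\in\mathbb{N}\cup\{\infty\}$ and $\beta:X\to\mathbb{B}_d$ with $\beta(z_0)=0$ and $K(z,w)=\frac{1}{1-\langle \beta(z),\beta(w)\rangle}$ for all $z,w \in X$, where $\mathbb{B}_d$ is the open unit ball of $\mathbb{C}^d$ (of $\ell^2$ if $d=\infty$). Either description may be taken as the definition. A multiplier $b$ of $\mathcal{H}$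 with $\|M_b\|\le 1$ is column extreme if there does not exist $a\in\operatorname{Mult}(\mathcal{H})\setminus\{0\}$ such that the column operator $\begin{bmatrix} M_b\\ M_a\end{bmatrix}:\mathcal{H}\to\mathcal{H}\oplus\mathcal{H}$ has norm at most $1$. *)

theory Defs
  imports "HOL-Analysis.Analysis" "HOL-Library.Function_Algebras" "HOL-Library.Extended_Nat"
begin

(* Pointwise real scalar multiplication, so that extreme_point_of applies to sets of functions.
   Addition and multiplication of functions are the pointwise ones of Function_Algebras. *)
instantiation "fun" :: (type, real_vector) real_vector
begin

definition scaleR_fun :: "real \<Rightarrow> ('a \<Rightarrow> 'b) \<Rightarrow> 'a \<Rightarrow> 'b"
  where "scaleR_fun r f = (\<lambda>x. r *\<^sub>R f x)"

instance
  by standard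
    (auto simp: scaleR_fun_def fun_eq_iff scaleR_add_right scaleR_add_left)

end

definition ip_norm :: "(('x \<Rightarrow> complex) \<Rightarrow> ('x \<Rightarrow> complex) \<Rightarrow> complex) \<Rightarrow> ('x \<Rightarrow> complex) \<Rightarrow> real"
  where "ip_norm ip f = sqrt (Re (ip f f))"

(* The set X is the type 'x.  The inner product ip is linear in its first argument; only its values
   on H matter.  The kernel function at w is (\<lambda>z. K z w). *)
locale rkhs =
  fixes H :: "('x \<Rightarrow> complex) set"
    and ip :: "('x \<Rightarrow> complex) \<Rightarrow> ('x \<Rightarrow> complex) \<Rightarrow> complex"
    and K :: "'x \<Rightarrow> 'x \<Rightarrow> complex"
  assumes zero_mem: "0 \<in> H"
    and add_mem: "\<And>f g. f \<in> H \<Longrightarrow> g \<in> H \<Longrightarrow> f + g \<in> H"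
    and scale_mem: "\<And>c f. f \<in> H \<Longrightarrow> (\<lambda>x. c * f x) \<in> H"
    and ip_add: "\<And>f g h. f \<in> H \<Longrightarrow> g \<in> H \<Longrightarrow> h \<in> H \<Longrightarrow> ip (f + g) h = ip f h + ip g h"
    and ip_scale: "\<And>c f g. f \<in> H \<Longrightarrow> g \<in> H \<Longrightarrow> ip (\<lambda>x. c * f x) g = c * ip f g"
    and ip_cnj: "\<And>f g. f \<in> H \<Longrightarrow> g \<in> H \<Longrightarrow> ip g f = cnj (ip f g)"
    and ip_nonneg: "\<And>f. f \<in> H \<Longrightarrow> 0 \<le> Re (ip f f)"
    and ip_definite: "\<And>f. f \<in> H \<Longrightarrow> ip f f = 0 \<Longrightarrow> f = 0"
    and complete:
      "\<And>s :: nat \<Rightarrow> 'x \<Rightarrow> complex. (\<forall>n. s n \<in> H) \<Longrightarrow>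
         (\<forall>e>0. \<exists>N. \<forall>m\<ge>N. \<forall>n\<ge>N. ip_norm ip (s m - s n) < e) \<Longrightarrow>
         \<exists>f\<in>H. (\<lambda>n. ip_norm ip (s n - f)) \<longlonglongrightarrow> 0"
    and separable:
      "\<exists>D\<subseteq>H. countable D \<and> (\<forall>f\<in>H. \<forall>e>0. \<exists>g\<in>D. ip_norm ip (f - g) < e)"
    and kernel_mem: "\<And>w. (\<lambda>z. K z w) \<in> H"
    and reproducing: "\<And>f w. f \<in> H \<Longrightarrow> f w = ip f (\<lambda>z. K z w)"

(* The open unit ball of C^d, or of l^2 if d = \<infinity>; C^d consists of the sequences
   supported on the indices below d. *)
definition ell2_ball :: "enat \<Rightarrow> (nat \<Rightarrow> complex) set"
  where "ell2_ball d = {v. (\<forall>i. d \<le> enat i \<longrightarrow> v i = 0) \<and>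
           summable (\<lambda>i. (cmod (v i))\<^sup>2) \<and> (\<Sum>i. (cmod (v i))\<^sup>2) < 1}"

definition ell2_inner :: "(nat \<Rightarrow> complex) \<Rightarrow> (nat \<Rightarrow> complex) \<Rightarrow> complex"
  where "ell2_inner v w = (\<Sum>i. v i * cnj (w i))"

(* The complete Pick property in the form given by the theorem of Agler-McCarthy, McCullough
   and Quiggin. *)
locale normalized_complete_pick = rkhs +
  assumes normalized_pick:
    "\<exists>z0. (\<forall>z. K z z0 = 1) \<and>
       (\<exists>d \<beta>. (\<forall>z. \<beta> z \<in> ell2_ball d) \<and> \<beta> z0 = 0 \<and>
          (\<forall>z w. K z w = 1 / (1 - ell2_inner (\<beta> z) (\<beta> w))))"

(* N is the norm on the target space.  Extended reals, because a supremum over an unbounded set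
   of reals would be unspecified. *)
definition op_norm ::
  "('x \<Rightarrow> complex) set \<Rightarrow> (('x \<Rightarrow> complex) \<Rightarrow> ('x \<Rightarrow> complex) \<Rightarrow> complex) \<Rightarrow>
   ('b \<Rightarrow> real) \<Rightarrow> (('x \<Rightarrow> complex) \<Rightarrow> 'b) \<Rightarrow> ereal"
  where "op_norm H ip N T = (SUP f\<in>{f\<in>H. ip_norm ip f \<le> 1}. ereal (N (T f)))"

definition Mult :: "('x \<Rightarrow> complex) set \<Rightarrow> ('x \<Rightarrow> complex) set"
  where "Mult H = {\<phi>. \<forall>f\<in>H. \<phi> * f \<in> H}"

definition mult_norm ::
  "('x \<Rightarrow> complex) set \<Rightarrow> (('x \<Rightarrow> complex) \<Rightarrow> ('x \<Rightarrow> complex) \<Rightarrow> complex) \<Rightarrow> ('x \<Rightarrow> complex) \<Rightarrow> ereal"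
  where "mult_norm H ip \<phi> = op_norm H ip (ip_norm ip) (\<lambda>f. \<phi> * f)"

definition mult_ball ::
  "('x \<Rightarrow> complex) set \<Rightarrow> (('x \<Rightarrow> complex) \<Rightarrow> ('x \<Rightarrow> complex) \<Rightarrow> complex) \<Rightarrow> ('x \<Rightarrow> complex) set"
  where "mult_ball H ip = {\<phi> \<in> Mult H. mult_norm H ip \<phi> \<le> 1}"

definition sum_norm ::
  "(('x \<Rightarrow> complex) \<Rightarrow> ('x \<Rightarrow> complex) \<Rightarrow> complex) \<Rightarrow> ('x \<Rightarrow> complex) \<times> ('x \<Rightarrow> complex) \<Rightarrow> real"
  where "sum_norm ip p = sqrt ((ip_norm ip (fst p))\<^sup>2 + (ip_norm ip (snd p))\<^sup>2)"

definition column_norm ::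
  "('x \<Rightarrow> complex) set \<Rightarrow> (('x \<Rightarrow> complex) \<Rightarrow> ('x \<Rightarrow> complex) \<Rightarrow> complex) \<Rightarrow>
   ('x \<Rightarrow> complex) \<Rightarrow> ('x \<Rightarrow> complex) \<Rightarrow> ereal"
  where "column_norm H ip b a = op_norm H ip (sum_norm ip) (\<lambda>f. (b * f, a * f))"

definition column_extreme ::
  "('x \<Rightarrow> complex) set \<Rightarrow> (('x \<Rightarrow> complex) \<Rightarrow> ('x \<Rightarrow> complex) \<Rightarrow> complex) \<Rightarrow> ('x \<Rightarrow> complex) \<Rightarrow> bool"
  where "column_extreme H ip b \<longleftrightarrow>
           b \<in> mult_ball H ip \<and> \<not> (\<exists>a \<in> Mult H - {0}. column_norm H ip b a \<le> 1)"

end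

theory Submission
  imports Defs
begin

text \<open>
  If \<open>b\<close> is a proper convex combination of \<open>u\<close> and \<open>v\<close> with weights \<open>1 - t\<close> and \<open>t\<close>, the
  parallelogram law gives a contractive column with entries \<open>b\<close> and \<open>a = sqrt (t (1 - t)) (u - v)\<close>.

  Conversely, if the column with entries \<open>b\<close> and \<open>a\<close> is contractive, then \<open>b + a\<^sup>2 / 2\<close> and
  \<open>b - a\<^sup>2 / 2\<close> lie in the unit ball.  This follows from Young's inequality for the pairings of
  \<open>b f\<close> and \<open>a f\<close> with kernel sums, because in a complete Pick space a contractive column of
  multipliers is also a contractive row.

  The passage from columns to rows is proved on finite sets of points, by induction on their
  number.  With \<open>L\<close> the inverse matrix of the kernel \<open>K\<close>, a column \<open>\<phi>\<close> with Gram kernel \<open>Q\<close> is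
  contractive iff \<open>L z w (1 - Q w z)\<close> is positive semidefinite, a row iff \<open>K z w (1 - Q z w)\<close> is.
  A Moebius transformation makes \<open>Q\<close> vanish at one point \<open>x\<close>.  Leech's theorem then
  writes \<open>\<phi> = \<Sum>\<^sub>j \<beta>\<^sub>j q\<^sub>j\<close> with a contractive column \<open>q\<close>, where \<open>\<beta>\<close> is the row with
  \<open>K z w (1 - \<Sum>\<^sub>j \<beta>\<^sub>j z cnj (\<beta>\<^sub>j w)) = s z cnj (s w)\<close>.  For each \<open>j\<close> the entries of \<open>q\<^sub>j\<close>
  have a common outer factor \<open>\<tau>\<^sub>j\<close>, found by maximising a trace, and dividing by it yields columns
  to which the induction hypothesis applies on the remaining points.
\<close>

section \<open>Positive semidefinite matrices\<close>

text \<open>Adjoints of multipliers are diagonal on kernel functions, so contractivity of a row is a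
  condition on the entries of \<open>K\<close>. Contractivity of a column concerns M* M, which is
  not entrywise in \<open>K\<close>. On finitely many points it is entrywise in the inverse matrix
  \<open>L\<close>, because \<open>qf X L g\<close> is the squared norm of \<open>g\<close> in the
  space with kernel \<open>K\<close> on \<open>X\<close>. Comparing the two conditions is the whole
  difficulty.

  Once \<open>Q\<close> vanishes at \<open>x\<close>, write K (1 - Q) as K (1 - F) + K (F - Q) with
  \<open>F\<close> the Gram kernel of \<beta>. The first summand has rank one, and the second
  vanishes in the row and column of \<open>x\<close>, so only the remaining points matter. There K
  (F - Q) splits into two kinds of terms. One kind is K (1 - \<eta> j) between factors \<beta> j,
  where \<eta> j comes from q j divided by \<tau> j; this is a row condition, supplied by the
  induction hypothesis.

  Working with r Q for r < 1 and letting r tend to 1 keeps the Moebius map defined and leaves room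
  to make every \<tau> j nonzero.\<close>

definition qf :: "'a set \<Rightarrow> ('a \<Rightarrow> 'a \<Rightarrow> complex) \<Rightarrow> ('a \<Rightarrow> complex) \<Rightarrow> complex"
  where "qf S A c = (\<Sum>s\<in>S. \<Sum>t\<in>S. cnj (c s) * A s t * c t)"

text \<open>Nonnegativity is required of the real part only, which does not force symmetry; hence
  the separate Hermitian condition.\<close>

definition psd :: "'a set \<Rightarrow> ('a \<Rightarrow> 'a \<Rightarrow> complex) \<Rightarrow> bool"
  where "psd S A \<longleftrightarrow> (\<forall>s\<in>S. \<forall>t\<in>S. A t s = cnj (A s t)) \<and> (\<forall>c. 0 \<le> Re (qf S A c))"

lemma psd_herm: "psd S A \<Longrightarrow> s \<in> S \<Longrightarrow> t \<in> S \<Longrightarrow> A t s = cnj (A s t)"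
  unfolding psd_def by blast

lemma psd_nonneg: "psd S A \<Longrightarrow> 0 \<le> Re (qf S A c)"
  unfolding psd_def by blast

lemma psdI:
  assumes "\<And>s t. s \<in> S \<Longrightarrow> t \<in> S \<Longrightarrow> A t s = cnj (A s t)" "\<And>c. 0 \<le> Re (qf S A c)"
  shows "psd S A"
  unfolding psd_def using assms by blast

lemma qf_cong:
  assumes "\<And>s t. s \<in> S \<Longrightarrow> t \<in> S \<Longrightarrow> A s t = B s t" "\<And>s. s \<in> S \<Longrightarrow> c s = d s"
  shows "qf S A c = qf S B d"
  unfolding qf_def using assms by (intro sum.cong) auto

lemma psd_cong:
  assumes "psd S A" "\<And>s t. s \<in> S \<Longrightarrow> t \<in> S \<Longrightarrow> A s t = B s t"
  shows "psd S B"
proof -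
  have "qf S B c = qf S A c" for c
    by (rule qf_cong) (use assms(2) in auto)
  then have "0 \<le> Re (qf S B c)" for c
    using psd_nonneg[OF assms(1)] by simp
  moreover have "B t s = cnj (B s t)" if "s \<in> S" "t \<in> S" for s t
    using psd_herm[OF assms(1) that] assms(2)[OF that] assms(2)[OF that(2,1)] by simp
  ultimately show ?thesis by (rule psdI[rotated])
qed

lemma qf_add: "qf S (\<lambda>s t. A s t + B s t) c = qf S A c + qf S B c"
  by (simp add: qf_def algebra_simps sum.distrib)

lemma qf_diff: "qf S (\<lambda>s t. A s t - B s t) c = qf S A c - qf S B c"
  by (simp add: qf_def algebra_simps sum_subtractf)

lemma qf_scale: "qf S (\<lambda>s t. k * A s t) c = k * qf S A c"
  by (simp add: qf_def sum_distrib_left algebra_simps)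

lemma psd_add:
  assumes "psd S A" "psd S B"
  shows "psd S (\<lambda>s t. A s t + B s t)"
proof (rule psdI)
  fix s t assume "s \<in> S" "t \<in> S"
  then show "A t s + B t s = cnj (A s t + B s t)"
    using psd_herm[OF assms(1), of s t] psd_herm[OF assms(2), of s t] by simp
qed (use assms in \<open>simp add: qf_add psd_nonneg\<close>)

lemma psd_zero: "psd S (\<lambda>s t. 0)"
  by (rule psdI) (simp_all add: qf_def)

lemma psd_sum:
  assumes "finite I" "\<And>i. i \<in> I \<Longrightarrow> psd S (A i)"
  shows "psd S (\<lambda>s t. \<Sum>i\<in>I. A i s t)"
  using assms
proof (induction rule: finite_induct)
  case empty
  then show ?case using psd_zero by simp
next
  case (insert i I)
  have "psd S (\<lambda>s t. A i s t + (\<Sum>i\<in>I. A i s t))"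
    by (rule psd_add) (use insert in auto)
  then show ?case using insert.hyps by simp
qed

lemma psd_scale:
  assumes "psd S A" "0 \<le> r"
  shows "psd S (\<lambda>s t. complex_of_real r * A s t)"
proof (rule psdI)
  fix s t assume "s \<in> S" "t \<in> S"
  then show "complex_of_real r * A t s = cnj (complex_of_real r * A s t)"
    using psd_herm[OF assms(1), of s t] by simp
qed (use assms in \<open>simp add: qf_scale psd_nonneg\<close>)

lemma qf_mono_neutral:
  assumes "finite T" "S \<subseteq> T" "\<And>s. s \<in> T - S \<Longrightarrow> c s = 0"
  shows "qf T A c = qf S A c"
proof -
  have "qf T A c = (\<Sum>s\<in>S. \<Sum>t\<in>T. cnj (c s) * A s t * c t)"
    unfolding qf_def using assms by (intro sum.mono_neutral_right) auto
  also have "\<dots> = qf S A c"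
    unfolding qf_def using assms by (intro sum.cong refl sum.mono_neutral_right) auto
  finally show ?thesis .
qed

lemma psd_subset:
  assumes "psd T A" "S \<subseteq> T" "finite T"
  shows "psd S A"
proof -
  have "qf S A c = qf T A (\<lambda>s. if s \<in> S then c s else 0)" for c
  proof -
    have "qf T A (\<lambda>s. if s \<in> S then c s else 0) = qf S A (\<lambda>s. if s \<in> S then c s else 0)"
      using assms by (intro qf_mono_neutral) auto
    also have "\<dots> = qf S A c"
      by (rule qf_cong) auto
    finally show ?thesis by simp
  qed
  then have "0 \<le> Re (qf S A c)" for c
    using psd_nonneg[OF assms(1)] by simp
  moreover have "A t s = cnj (A s t)" if "s \<in> S" "t \<in> S" for s t
    using psd_herm[OF assms(1)] that assms(2) by blast
  ultimately show ?thesis by (rule psdI[rotated])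
qed

lemma qf_congruence: "qf S (\<lambda>s t. u s * A s t * cnj (u t)) c = qf S A (\<lambda>s. cnj (u s) * c s)"
  by (simp add: qf_def algebra_simps)

lemma psd_congruence:
  assumes "psd S A"
  shows "psd S (\<lambda>s t. u s * A s t * cnj (u t))"
proof (rule psdI)
  fix s t assume "s \<in> S" "t \<in> S"
  then show "u t * A t s * cnj (u s) = cnj (u s * A s t * cnj (u t))"
    using psd_herm[OF assms, of s t] by simp
qed (use assms in \<open>simp add: qf_congruence psd_nonneg\<close>)

lemma qf_rank_one: "qf S (\<lambda>s t. u s * cnj (u t)) c = of_real ((cmod (\<Sum>s\<in>S. cnj (u s) * c s))\<^sup>2)"
proof -
  have "qf S (\<lambda>s t. u s * cnj (u t)) c = (\<Sum>s\<in>S. \<Sum>t\<in>S. (cnj (c s) * u s) * (cnj (u t) * c t))"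
    by (simp add: qf_def algebra_simps)
  also have "\<dots> = (\<Sum>s\<in>S. cnj (c s) * u s) * (\<Sum>t\<in>S. cnj (u t) * c t)"
    by (simp add: sum_product)
  also have "(\<Sum>s\<in>S. cnj (c s) * u s) = cnj (\<Sum>t\<in>S. cnj (u t) * c t)"
    by (simp add: cnj_sum algebra_simps)
  finally show ?thesis
    using complex_norm_square[of "\<Sum>s\<in>S. cnj (u s) * c s"] by (simp add: mult.commute)
qed

lemma psd_rank_one: "psd S (\<lambda>s t. u s * cnj (u t))"
  by (rule psdI) (simp_all add: qf_rank_one)

lemma psd_gram: "finite M \<Longrightarrow> psd S (\<lambda>s t. \<Sum>m\<in>M. u s m * cnj (u t m))"
  by (intro psd_sum psd_rank_one)

section \<open>Diagonal entries, Schur complements and Gram vectors\<close>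

lemma qf_single:
  assumes "finite S" "x \<in> S"
  shows "qf S A (\<lambda>s. if s = x then k else 0) = cnj k * A x x * k"
proof -
  have "qf S A (\<lambda>s. if s = x then k else 0) = qf {x} A (\<lambda>s. if s = x then k else 0)"
    using assms by (intro qf_mono_neutral) auto
  then show ?thesis by (simp add: qf_def)
qed

lemma psd_diag:
  assumes "psd S A" "finite S" "x \<in> S"
  shows "A x x = of_real (Re (A x x))" "0 \<le> Re (A x x)"
proof -
  have "Im (A x x) = Im (cnj (A x x))"
    using arg_cong[OF psd_herm[OF assms(1,3,3)], of Im] .
  then show "A x x = of_real (Re (A x x))"
    by (simp add: complex_eq_iff)
  show "0 \<le> Re (A x x)"
    using psd_nonneg[OF assms(1), of "\<lambda>s. if s = x then 1 else 0"] qf_single[OF assms(2,3), of A 1]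
    by simp
qed

lemma qf_shift:
  assumes "psd S A" "finite S" "x \<in> S"
  shows "Re (qf S A (\<lambda>s. c s + (if s = x then k else 0)))
           = Re (qf S A c) + 2 * Re (cnj k * (\<Sum>t\<in>S. A x t * c t)) + (cmod k)\<^sup>2 * Re (A x x)"
proof -
  let ?e = "\<lambda>s. if s = x then k else 0"
  have "qf S A (\<lambda>s. c s + ?e s) =
      qf S A c + (\<Sum>s\<in>S. \<Sum>t\<in>S. cnj (?e s) * A s t * c t)
      + (\<Sum>s\<in>S. \<Sum>t\<in>S. cnj (c s) * A s t * ?e t) + qf S A ?e"
    by (simp add: qf_def algebra_simps sum.distrib)
  moreover have "(\<Sum>s\<in>S. \<Sum>t\<in>S. cnj (?e s) * A s t * c t) = cnj k * (\<Sum>t\<in>S. A x t * c t)"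
  proof -
    have "(\<Sum>s\<in>S. \<Sum>t\<in>S. cnj (?e s) * A s t * c t)
        = (\<Sum>s\<in>S. if s = x then cnj k * (\<Sum>t\<in>S. A x t * c t) else 0)"
      by (intro sum.cong) (auto simp: sum_distrib_left mult.assoc)
    then show ?thesis using assms by simp
  qed
  moreover have "(\<Sum>s\<in>S. \<Sum>t\<in>S. cnj (c s) * A s t * ?e t) = cnj (cnj k * (\<Sum>t\<in>S. A x t * c t))"
  proof -
    have "(\<Sum>s\<in>S. \<Sum>t\<in>S. cnj (c s) * A s t * ?e t) = (\<Sum>s\<in>S. cnj (c s) * A s x * k)"
    proof (intro sum.cong refl)
      fix s
      have "(\<Sum>t\<in>S. cnj (c s) * A s t * ?e t) = (\<Sum>t\<in>S. if t = x then cnj (c s) * A s x * k else 0)"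
        by (intro sum.cong) auto
      then show "(\<Sum>t\<in>S. cnj (c s) * A s t * ?e t) = cnj (c s) * A s x * k" using assms by simp
    qed
    also have "\<dots> = cnj (cnj k * (\<Sum>t\<in>S. A x t * c t))"
      by (simp add: cnj_sum sum_distrib_left, intro sum.cong refl)
        (simp add: psd_herm[OF assms(1) assms(3)] mult.commute)
    finally show ?thesis .
  qed
  moreover have "Re (qf S A ?e) = (cmod k)\<^sup>2 * Re (A x x)"
  proof -
    have "qf S A ?e = of_real ((cmod k)\<^sup>2) * A x x"
      using qf_single[OF assms(2,3), of A k] complex_norm_square[of k] by (simp add: algebra_simps)
    then show ?thesis by simp
  qed
  ultimately have "Re (qf S A (\<lambda>s. c s + ?e s)) = Re (qf S A c)
      + Re (cnj k * (\<Sum>t\<in>S. A x t * c t)) + Re (cnj (cnj k * (\<Sum>t\<in>S. A x t * c t)))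
      + (cmod k)\<^sup>2 * Re (A x x)"
    by (simp only: plus_complex.sel)
  then show ?thesis by (simp only: cnj.sel)
qed


lemma psd_zero_row:
  assumes "psd S A" "finite S" "x \<in> S" "y \<in> S" "Re (A x x) = 0"
  shows "A x y = 0"
proof (rule ccontr)
  assume nz: "A x y \<noteq> 0"
  define M where "M = Re (A y y)"
  \<comment> \<open>This \<open>k\<close> makes the cross term equal to \<open>- (M + 1)\<close>. As
    \<open>A x x\<close> contributes nothing, the form at the shifted vector is
    \<open>M - 2 * (M + 1)\<close>, which is negative.\<close>
  define k where "k = - of_real (M + 1) * A x y / of_real ((cmod (A x y))\<^sup>2)"
  let ?c = "\<lambda>s. if s = y then 1 else (0::complex)"
  have "(\<Sum>t\<in>S. A x t * ?c t) = A x y"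
  proof -
    have "(\<Sum>t\<in>S. A x t * ?c t) = (\<Sum>t\<in>S. if t = y then A x y else 0)"
      by (intro sum.cong) auto
    then show ?thesis using assms by simp
  qed
  moreover have "Re (qf S A ?c) = M"
    using qf_single[OF assms(2,4), of A 1] by (simp add: M_def)
  moreover have "cnj k * A x y = - of_real (M + 1)"
    using nz complex_norm_square[of "A x y"] by (simp add: k_def field_simps)
  ultimately have "Re (qf S A (\<lambda>s. ?c s + (if s = x then k else 0))) = M - 2 * (M + 1)"
    using qf_shift[OF assms(1-3), of ?c k] assms(5) by simp
  moreover have "0 \<le> M" using psd_diag(2)[OF assms(1,2,4)] by (simp add: M_def)
  ultimately show False using psd_nonneg[OF assms(1), of "\<lambda>s. ?c s + (if s = x then k else 0)"] by simp
qed

text \<open>Completing the square: among all shifts of the coordinate at \<open>x\<close>, the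
  displayed one minimises the form of \<open>A\<close>, and the minimum is the form of the Schur
  complement. The explicit minimiser is needed again for columns that vanish at
  \<open>x\<close>.\<close>

lemma qf_schur:
  assumes "psd S A" "finite S" "x \<in> S" "Re (A x x) > 0"
  shows "Re (qf S (\<lambda>s t. A s t - A s x * A x t / A x x) c)
     = Re (qf S A (\<lambda>s. c s + (if s = x then - (\<Sum>t\<in>S. A x t * c t) / A x x else 0)))"
proof -
  let ?y = "\<Sum>t\<in>S. A x t * c t"
  let ?r = "Re (A x x)"
  have r: "A x x = of_real ?r" using psd_diag(1)[OF assms(1-3)] .
  have "qf S (\<lambda>s t. A s x * A x t / A x x) c = (1 / A x x) * qf S (\<lambda>s t. A s x * cnj (A t x)) c"
  proof (subst qf_scale[symmetric], intro qf_cong refl)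
    fix s t assume "s \<in> S" "t \<in> S"
    show "A s x * A x t / A x x = 1 / A x x * (A s x * cnj (A t x))"
      using psd_herm[OF assms(1) \<open>t \<in> S\<close> assms(3)] by simp
  qed
  also have "\<dots> = of_real ((cmod ?y)\<^sup>2 / ?r)"
  proof -
    have "(\<Sum>s\<in>S. cnj (A s x) * c s) = ?y"
    proof (intro sum.cong refl)
      fix s assume "s \<in> S"
      then show "cnj (A s x) * c s = A x s * c s"
        using psd_herm[OF assms(1) \<open>s \<in> S\<close> assms(3)] by simp
    qed
    then show ?thesis using r by (simp add: qf_rank_one)
  qed
  finally have 1: "Re (qf S (\<lambda>s t. A s t - A s x * A x t / A x x) c) = Re (qf S A c) - (cmod ?y)\<^sup>2 / ?r"
    by (simp add: qf_diff)
  have "Re (cnj (- ?y / A x x) * ?y) = - (cmod ?y)\<^sup>2 / ?r"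
  proof -
    have "cnj (- ?y / A x x) * ?y = - (?y * cnj ?y) / A x x"
      by (subst r, subst (2) r) (simp add: field_simps)
    also have "\<dots> = of_real (- (cmod ?y)\<^sup>2 / ?r)"
      by (subst r, subst complex_norm_square[symmetric]) simp
    finally show ?thesis by simp
  qed
  moreover have "(cmod (- ?y / A x x))\<^sup>2 * ?r = (cmod ?y)\<^sup>2 / ?r"
    using assms(4) by (subst r) (simp add: norm_divide power_divide power2_eq_square)
  ultimately show ?thesis
    unfolding qf_shift[OF assms(1-3)] 1 by simp
qed

lemma psd_schur_complement:
  assumes "psd S A" "finite S" "x \<in> S" "Re (A x x) > 0"
  shows "psd S (\<lambda>s t. A s t - A s x * A x t / A x x)"
proof -
  have "A t s - A t x * A x s / A x x = cnj (A s t - A s x * A x t / A x x)" if "s \<in> S" "t \<in> S" for s t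
    using psd_herm[OF assms(1) that] psd_herm[OF assms(1) that(1) assms(3)]
      psd_herm[OF assms(1) that(2) assms(3)] psd_diag(1)[OF assms(1-3)]
    by (metis complex_cnj_cnj complex_cnj_complex_of_real complex_cnj_diff complex_cnj_divide
        complex_cnj_mult mult.commute)
  then show ?thesis
    by (rule psdI) (simp_all only: qf_schur[OF assms] psd_nonneg[OF assms(1)])
qed

text \<open>One step of a Cholesky factorisation: the rank-one part carries the whole column at
  \<open>x\<close>, so the remainder vanishes there. If the diagonal entry is zero, so is its row,
  and \<open>p = 0\<close> is the right choice.\<close>

lemma psd_split:
  assumes "psd S A" "finite S" "x \<in> S"
  obtains p where "psd S (\<lambda>s t. A s t - p s * cnj (p t))" "\<And>s. s \<in> S \<Longrightarrow> A s x = p s * cnj (p x)"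
proof -
  define r where "r = Re (A x x)"
  have r: "A x x = of_real r" "0 \<le> r"
    using psd_diag[OF assms] by (simp_all add: r_def)
  define p where "p s = (if r = 0 then 0 else A s x / of_real (sqrt r))" for s
  have Ap: "A s x = p s * cnj (p x)" "A x s = p x * cnj (p s)" if "s \<in> S" for s
  proof -
    show "A s x = p s * cnj (p x)"
    proof (cases "r = 0")
      case True
      then have "A x s = 0" using psd_zero_row[OF assms that] by (simp add: r_def)
      then show ?thesis using True psd_herm[OF assms(1) assms(3) that] by (simp add: p_def)
    next
      case False
      have "complex_of_real r = of_real (sqrt r) * of_real (sqrt r)"
        by (metis of_real_mult r(2) real_sqrt_mult_self abs_of_nonneg)
      then show ?thesis using False r by (simp add: p_def)
    qed
    then show "A x s = p x * cnj (p s)"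
      using psd_herm[OF assms(1) that assms(3)] by simp
  qed
  have "psd S (\<lambda>s t. A s t - p s * cnj (p t))"
  proof (cases "r = 0")
    case True
    then show ?thesis using assms(1) by (simp add: p_def)
  next
    case False
    have "p s * cnj (p t) = A s x * A x t / A x x" if "s \<in> S" "t \<in> S" for s t
    proof -
      have "A s x * A x t / A x x = p s * cnj (p x) * (p x * cnj (p t)) / (p x * cnj (p x))"
        using Ap that assms(3) by simp
      moreover have "p x \<noteq> 0" using Ap(1)[OF assms(3)] r False by auto
      ultimately show ?thesis by simp
    qed
    moreover have "psd S (\<lambda>s t. A s t - A s x * A x t / A x x)"
      by (rule psd_schur_complement[OF assms]) (use False r in auto)
    ultimately show ?thesis by (elim psd_cong) simp
  qed
  then show thesis using Ap(1) that by blast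
qed

lemma psd_imp_gram:
  assumes "finite S" "psd S A"
  shows "\<exists>P. \<forall>s\<in>S. \<forall>t\<in>S. A s t = (\<Sum>m\<in>S. P s m * cnj (P t m))"
  using assms
proof (induction S arbitrary: A rule: finite_induct)
  case empty
  then show ?case by simp
next
  case (insert x S)
  let ?T = "insert x S"
  have fin: "finite ?T" and x: "x \<in> ?T" using insert by auto
  obtain p where p: "psd ?T (\<lambda>s t. A s t - p s * cnj (p t))" "\<And>s. s \<in> ?T \<Longrightarrow> A s x = p s * cnj (p x)"
    by (rule psd_split[OF insert.prems fin x]) (rule that)
  define B where "B s t = A s t - p s * cnj (p t)" for s t
  have Ap: "A s x = p s * cnj (p x)" "A x s = p x * cnj (p s)" if "s \<in> ?T" for s
    using p(2)[OF that] psd_herm[OF insert.prems that x] by simp_all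
  have "psd ?T B" using p(1) unfolding B_def .
  then have "psd S B" using psd_subset[OF _ _ fin] by blast
  then obtain P where P: "\<And>s t. s \<in> S \<Longrightarrow> t \<in> S \<Longrightarrow> B s t = (\<Sum>m\<in>S. P s m * cnj (P t m))"
    using insert.IH by blast
  \<comment> \<open>The points themselves index the Gram coordinates. Coordinate \<open>x\<close>
    holds the column just split off. The other coordinates of the vector at \<open>x\<close> are
    zero because \<open>B\<close> vanishes in the row and column of \<open>x\<close>.\<close>
  define P' where "P' s m = (if m = x then p s else if s = x then 0 else P s m)" for s m
  have "A s t = (\<Sum>m\<in>?T. P' s m * cnj (P' t m))" if st: "s \<in> ?T" "t \<in> ?T" for s t
  proof -
    have sum: "(\<Sum>m\<in>?T. P' s m * cnj (P' t m)) = p s * cnj (p t) + (\<Sum>m\<in>S. P' s m * cnj (P' t m))"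
      using insert.hyps by (simp add: P'_def)
    show ?thesis
    proof (cases "s = x \<or> t = x")
      case True
      then have "(\<Sum>m\<in>S. P' s m * cnj (P' t m)) = 0"
        using insert.hyps by (intro sum.neutral) (auto simp: P'_def)
      then show ?thesis using sum True Ap st by auto
    next
      case False
      then have "(\<Sum>m\<in>S. P' s m * cnj (P' t m)) = B s t"
        using P[of s t] st insert.hyps by (auto simp: P'_def intro!: sum.cong)
      then show ?thesis using sum by (simp add: B_def)
    qed
  qed
  then show ?case by blast
qed

text \<open>A Gram expansion of one factor turns the entrywise product into a sum of diagonal
  congruences of the other.\<close>

lemma psd_schur_product:
  assumes "finite S" "psd S A" "psd S B"
  shows "psd S (\<lambda>s t. A s t * B s t)"
proof -
  obtain P where P: "\<And>s t. s \<in> S \<Longrightarrow> t \<in> S \<Longrightarrow> A s t = (\<Sum>m\<in>S. P s m * cnj (P t m))"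
    using psd_imp_gram[OF assms(1,2)] by blast
  have "psd S (\<lambda>s t. \<Sum>m\<in>S. P s m * B s t * cnj (P t m))"
    by (intro psd_sum psd_congruence assms)
  then show ?thesis
    by (rule psd_cong) (simp add: P sum_distrib_right sum_distrib_left mult_ac)
qed

text \<open>Since \<open>f\<close> may identify points, this is more than restriction to a subset;
  Gram vectors pull back along any map.\<close>

lemma psd_pullback:
  assumes "finite S" "psd S A" "f ` T \<subseteq> S"
  shows "psd T (\<lambda>s t. A (f s) (f t))"
proof -
  obtain P where P: "\<And>s t. s \<in> S \<Longrightarrow> t \<in> S \<Longrightarrow> A s t = (\<Sum>m\<in>S. P s m * cnj (P t m))"
    using psd_imp_gram[OF assms(1,2)] by blast
  have "psd T (\<lambda>s t. \<Sum>m\<in>S. P (f s) m * cnj (P (f t) m))"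
    by (rule psd_gram[OF assms(1)])
  then show ?thesis
  proof (rule psd_cong)
    fix s t assume "s \<in> T" "t \<in> T"
    then have "f s \<in> S" "f t \<in> S" using assms(3) by auto
    then show "(\<Sum>m\<in>S. P (f s) m * cnj (P (f t) m)) = A (f s) (f t)"
      by (simp add: P)
  qed
qed

section \<open>Inverse kernels\<close>

definition ap :: "'a set \<Rightarrow> ('a \<Rightarrow> 'a \<Rightarrow> complex) \<Rightarrow> ('a \<Rightarrow> complex) \<Rightarrow> 'a \<Rightarrow> complex"
  where "ap S A c = (\<lambda>s. \<Sum>t\<in>S. A s t * c t)"

text \<open>Conjugate-linear in the first argument, opposite to the convention for
  \<open>ip\<close>.\<close>

definition ipr :: "'a set \<Rightarrow> ('a \<Rightarrow> complex) \<Rightarrow> ('a \<Rightarrow> complex) \<Rightarrow> complex"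
  where "ipr S a b = (\<Sum>s\<in>S. cnj (a s) * b s)"

definition pd :: "'a set \<Rightarrow> ('a \<Rightarrow> 'a \<Rightarrow> complex) \<Rightarrow> bool"
  where "pd S A \<longleftrightarrow> psd S A \<and> (\<forall>c. Re (qf S A c) = 0 \<longrightarrow> (\<forall>s\<in>S. c s = 0))"

definition inverse_kernel :: "'a set \<Rightarrow> ('a \<Rightarrow> 'a \<Rightarrow> complex) \<Rightarrow> ('a \<Rightarrow> 'a \<Rightarrow> complex) \<Rightarrow> bool"
  where "inverse_kernel S A L \<longleftrightarrow>
    psd S L \<and> (\<forall>s\<in>S. \<forall>t\<in>S. (\<Sum>u\<in>S. A s u * L u t) = (if s = t then 1 else 0))"

lemma qf_eq_ipr: "qf S A c = ipr S c (ap S A c)"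
  by (simp add: qf_def ipr_def ap_def sum_distrib_left mult.assoc)

lemma ipr_cnj: "ipr S b a = cnj (ipr S a b)"
  by (simp add: ipr_def mult.commute)

lemma ipr_cong: "(\<And>s. s \<in> S \<Longrightarrow> a s = a' s) \<Longrightarrow> (\<And>s. s \<in> S \<Longrightarrow> b s = b' s) \<Longrightarrow> ipr S a b = ipr S a' b'"
  by (simp add: ipr_def)

lemma ipr_diff_left: "ipr S (\<lambda>s. a s - b s) c = ipr S a c - ipr S b c"
  by (simp add: ipr_def algebra_simps sum_subtractf)

lemma ipr_diff_right: "ipr S c (\<lambda>s. a s - b s) = ipr S c a - ipr S c b"
  by (simp add: ipr_def algebra_simps sum_subtractf)

lemma ap_diff: "ap S A (\<lambda>s. c s - d s) = (\<lambda>s. ap S A c s - ap S A d s)"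
  by (simp add: ap_def algebra_simps sum_subtractf)

lemma ap_sym:
  assumes "psd S A"
  shows "ipr S a (ap S A b) = cnj (ipr S b (ap S A a))"
proof -
  have "cnj (ipr S b (ap S A a)) = (\<Sum>t\<in>S. \<Sum>s\<in>S. b t * (cnj (A t s) * cnj (a s)))"
    by (simp add: ipr_def ap_def cnj_sum sum_distrib_left)
  also have "\<dots> = (\<Sum>t\<in>S. \<Sum>s\<in>S. cnj (a s) * (A s t * b t))"
  proof (intro sum.cong refl)
    fix t s assume "t \<in> S" "s \<in> S"
    then show "b t * (cnj (A t s) * cnj (a s)) = cnj (a s) * (A s t * b t)"
      using psd_herm[OF assms, of t s] by simp
  qed
  also have "\<dots> = ipr S a (ap S A b)"
    by (subst sum.swap) (simp add: ipr_def ap_def sum_distrib_left)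
  finally show ?thesis by simp
qed

lemma pd_psd: "pd S A \<Longrightarrow> psd S A"
  by (simp add: pd_def)

lemma pd_zero: "pd S A \<Longrightarrow> Re (qf S A c) = 0 \<Longrightarrow> s \<in> S \<Longrightarrow> c s = 0"
  unfolding pd_def by blast

lemma pd_subset:
  assumes "pd T A" "S \<subseteq> T" "finite T"
  shows "pd S A"
  unfolding pd_def
proof (intro conjI allI impI ballI)
  show "psd S A" using psd_subset[OF pd_psd[OF assms(1)] assms(2,3)] .
  fix c s assume c: "Re (qf S A c) = 0" and s: "s \<in> S"
  let ?d = "\<lambda>s. if s \<in> S then c s else 0"
  have "qf T A ?d = qf S A ?d"
    using assms by (intro qf_mono_neutral) auto
  also have "\<dots> = qf S A c" by (rule qf_cong) auto
  finally have "Re (qf T A ?d) = 0" using c by simp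
  then have "?d s = 0" using pd_zero[OF assms(1)] assms(2) s by blast
  then show "c s = 0" using s by simp
qed

lemma pd_diag:
  assumes "pd S A" "finite S" "x \<in> S"
  shows "0 < Re (A x x)"
proof -
  have "Re (A x x) \<noteq> 0"
  proof
    assume "Re (A x x) = 0"
    then have "Re (qf S A (\<lambda>s. if s = x then 1 else 0)) = 0"
      using qf_single[OF assms(2,3), of A 1] by simp
    then show False using pd_zero[OF assms(1) _ assms(3)] by fastforce
  qed
  then show ?thesis using psd_diag(2)[OF pd_psd[OF assms(1)] assms(2,3)] by simp
qed

lemma pd_solve:
  assumes "finite S" "pd S A"
  shows "\<exists>c. \<forall>s\<in>S. ap S A c s = g s"
  using assms
proof (induction S arbitrary: g rule: finite_induct)
  case empty
  then show ?case by simp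
next
  case (insert x S)
  let ?T = "insert x S"
  have "pd S A" using pd_subset[OF insert.prems] insert.hyps by blast
  then obtain a b where a: "\<And>s. s \<in> S \<Longrightarrow> ap S A a s = A s x" and b: "\<And>s. s \<in> S \<Longrightarrow> ap S A b s = g s"
    using insert.IH[of "\<lambda>s. A s x"] insert.IH[of g] by blast
  define d where "d s = (if s = x then 1 else - a s)" for s
  have ap_insert: "ap ?T A c s = A s x * c x + ap S A c s" for c s
    using insert.hyps by (simp add: ap_def)
  have ap_cong: "ap S A c s = ap S A c' s" if "\<And>t. t \<in> S \<Longrightarrow> c t = c' t" for c c' s
    using that by (simp add: ap_def)
  have dS: "ap S A d s = - ap S A a s" for s
  proof -
    have "ap S A d s = ap S A (\<lambda>t. - a t) s"
      using insert.hyps by (intro ap_cong) (auto simp: d_def)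
    then show ?thesis by (simp add: ap_def sum_negf)
  qed
  define \<sigma> where "\<sigma> = ap ?T A d x"
  have dT: "ap ?T A d s = (if s = x then \<sigma> else 0)" if "s \<in> ?T" for s
    using that a dS by (auto simp: \<sigma>_def ap_insert d_def)
  have "qf ?T A d = \<sigma>"
  proof -
    have "qf ?T A d = (\<Sum>s\<in>?T. if s = x then \<sigma> else 0)"
      unfolding qf_eq_ipr ipr_def using dT by (intro sum.cong) (auto simp: d_def)
    then show ?thesis using insert.hyps by simp
  qed
  then have "\<sigma> \<noteq> 0"
    using pd_zero[OF insert.prems, of d x] by (auto simp: d_def)
  define k where "k = (g x - ap S A b x) / \<sigma>"
  define c where "c s = (if s = x then 0 else b s) + k * d s" for s
  have "ap ?T A c s = g s" if "s \<in> ?T" for s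
  proof -
    have "ap ?T A c s = ap ?T A (\<lambda>s. if s = x then 0 else b s) s + k * ap ?T A d s"
      by (simp add: ap_def c_def algebra_simps sum.distrib sum_distrib_left)
    also have "ap ?T A (\<lambda>s. if s = x then 0 else b s) s = ap S A b s"
      unfolding ap_insert using insert.hyps by (simp, intro ap_cong) auto
    finally show ?thesis
      using dT[OF that] that b \<open>\<sigma> \<noteq> 0\<close> by (auto simp: k_def)
  qed
  then show ?case by blast
qed

lemma inverse_kernel_exists:
  assumes "finite S" "pd S A"
  shows "\<exists>L. inverse_kernel S A L"
proof -
  have "\<exists>c. \<forall>s\<in>S. ap S A c s = (if s = v then 1 else 0)" for v
    using pd_solve[OF assms, of "\<lambda>s. if s = v then 1 else 0"] .
  then obtain C where C: "\<And>v s. s \<in> S \<Longrightarrow> ap S A (C v) s = (if s = v then 1 else 0)"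
    by metis
  define L where "L u v = C v u" for u v
  have AL: "(\<Sum>u\<in>S. A s u * L u t) = (if s = t then 1 else 0)" if "s \<in> S" for s t
    using C[OF that, of t] by (simp add: L_def ap_def)
  have LC: "ap S L g u = (\<Sum>v\<in>S. C v u * g v)" for g u
    by (simp add: ap_def L_def)
  have AAp: "ap S A (ap S L g) s = g s" if "s \<in> S" for g s
  proof -
    have "ap S A (ap S L g) s = (\<Sum>u\<in>S. \<Sum>v\<in>S. A s u * L u v * g v)"
      by (simp add: ap_def sum_distrib_left mult.assoc)
    also have "\<dots> = (\<Sum>v\<in>S. (\<Sum>u\<in>S. A s u * L u v) * g v)"
      by (subst sum.swap) (simp add: sum_distrib_right)
    also have "\<dots> = (\<Sum>v\<in>S. if s = v then g v else 0)"
      using AL[OF that] by (intro sum.cong) auto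
    finally show ?thesis using that assms(1) by simp
  qed
  have psdA: "psd S A" using assms(2) by (rule pd_psd)
  have herm: "L t s = cnj (L s t)" if st: "s \<in> S" "t \<in> S" for s t
  proof -
    have *: "ipr S (C u) (ap S A (C v)) = cnj (C u v)" if "v \<in> S" for u v
    proof -
      have "ipr S (C u) (ap S A (C v)) = (\<Sum>s\<in>S. if s = v then cnj (C u v) else 0)"
        unfolding ipr_def using C by (intro sum.cong) auto
      then show ?thesis using that assms(1) by simp
    qed
    have "cnj (C s t) = cnj (cnj (C t s))"
      using ap_sym[OF psdA, of "C s" "C t"] unfolding *[OF st(2), of s] *[OF st(1), of t] .
    then show ?thesis unfolding L_def by (simp only: complex_cnj_cancel_iff)
  qed
  have "0 \<le> Re (qf S L g)" for g
  proof -
    have "qf S A (ap S L g) = ipr S (ap S L g) g"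
      unfolding qf_eq_ipr by (rule ipr_cong) (simp_all add: AAp)
    also have "\<dots> = cnj (qf S L g)"
      unfolding qf_eq_ipr by (rule ipr_cnj)
    finally show ?thesis using psd_nonneg[OF psdA, of "ap S L g"] by simp
  qed
  then have "psd S L" using herm by (intro psdI)
  then show ?thesis using AL unfolding inverse_kernel_def by blast
qed

lemma inverse_kernel_psd: "inverse_kernel S A L \<Longrightarrow> psd S L"
  by (simp add: inverse_kernel_def)

lemma inverse_kernel_ap:
  assumes "finite S" "inverse_kernel S A L" "s \<in> S"
  shows "ap S A (ap S L g) s = g s"
proof -
  have "ap S A (ap S L g) s = (\<Sum>u\<in>S. \<Sum>v\<in>S. A s u * L u v * g v)"
    by (simp add: ap_def sum_distrib_left mult.assoc)
  also have "\<dots> = (\<Sum>v\<in>S. (\<Sum>u\<in>S. A s u * L u v) * g v)"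
    by (subst sum.swap) (simp add: sum_distrib_right)
  also have "\<dots> = (\<Sum>v\<in>S. if s = v then g v else 0)"
    using assms(2,3) by (intro sum.cong) (auto simp: inverse_kernel_def)
  finally show ?thesis using assms by simp
qed

text \<open>For Hermitian matrices a right inverse is also a left inverse: evaluate at
  \<open>s\<close> by pairing with a unit vector, and move both matrices across the pairing.\<close>

lemma inverse_kernel_ap':
  assumes "finite S" "psd S A" "inverse_kernel S A L" "s \<in> S"
  shows "ap S L (ap S A c) s = c s"
proof -
  have psdL: "psd S L" using assms(3) by (rule inverse_kernel_psd)
  let ?e = "\<lambda>t. if t = s then 1 else (0::complex)"
  have single: "ipr S ?e f = f s" for f
  proof -
    have "ipr S ?e f = (\<Sum>t\<in>S. if t = s then f s else 0)"
      unfolding ipr_def by (intro sum.cong) auto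
    then show ?thesis using assms by simp
  qed
  have "ap S L (ap S A c) s = ipr S ?e (ap S L (ap S A c))" by (simp add: single)
  also have "\<dots> = cnj (ipr S (ap S A c) (ap S L ?e))" by (rule ap_sym[OF psdL])
  also have "\<dots> = ipr S (ap S L ?e) (ap S A c)" by (simp add: ipr_cnj[symmetric])
  also have "\<dots> = cnj (ipr S c (ap S A (ap S L ?e)))" by (rule ap_sym[OF assms(2)])
  also have "\<dots> = ipr S (ap S A (ap S L ?e)) c" by (simp add: ipr_cnj[symmetric])
  also have "\<dots> = ipr S ?e c"
    using inverse_kernel_ap[OF assms(1,3)] by (intro ipr_cong) auto
  finally show ?thesis by (simp add: single)
qed

text \<open>The quadratic form of an inverse kernel is the square of the dual norm, whence Young's
  inequality.\<close>

lemma inverse_kernel_young: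
  assumes "finite S" "psd S A" "inverse_kernel S A L"
  shows "2 * Re (ipr S c g) \<le> Re (qf S A c) + Re (qf S L g)"
proof -
  let ?e = "ap S L g"
  have Ae: "ipr S h (ap S A ?e) = ipr S h g" for h
    using inverse_kernel_ap[OF assms(1,3)] by (intro ipr_cong) auto
  have "0 \<le> Re (qf S A (\<lambda>s. c s - ?e s))" by (rule psd_nonneg[OF assms(2)])
  also have "qf S A (\<lambda>s. c s - ?e s)
      = qf S A c - ipr S c (ap S A ?e) - ipr S ?e (ap S A c) + ipr S ?e (ap S A ?e)"
    by (simp add: qf_eq_ipr ap_diff ipr_diff_left ipr_diff_right)
  also have "ipr S ?e (ap S A c) = cnj (ipr S c g)"
    using ap_sym[OF assms(2), of ?e c] Ae by simp
  also have "ipr S ?e (ap S A ?e) = cnj (qf S L g)"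
    unfolding Ae qf_eq_ipr by (rule ipr_cnj)
  finally show ?thesis by (simp add: Ae)
qed

lemma qf_inverse_kernel:
  assumes "finite S" "psd S A" "inverse_kernel S A L"
  shows "Re (qf S A (ap S L g)) = Re (qf S L g)" "Re (ipr S (ap S L g) g) = Re (qf S L g)"
    "Re (qf S L (ap S A c)) = Re (qf S A c)"
proof -
  have "qf S A (ap S L g) = ipr S (ap S L g) g"
    unfolding qf_eq_ipr using inverse_kernel_ap[OF assms(1,3)] by (intro ipr_cong) auto
  moreover show "Re (ipr S (ap S L g) g) = Re (qf S L g)"
    unfolding qf_eq_ipr by (subst ipr_cnj) simp
  ultimately show "Re (qf S A (ap S L g)) = Re (qf S L g)" by simp
  have "qf S L (ap S A c) = ipr S (ap S A c) c"
    unfolding qf_eq_ipr using inverse_kernel_ap'[OF assms] by (intro ipr_cong) auto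
  then show "Re (qf S L (ap S A c)) = Re (qf S A c)"
    unfolding qf_eq_ipr by (subst (asm) ipr_cnj) simp
qed

text \<open>The matrix of I - M M* on kernel functions tensored with unit vectors, where M maps
  functions to tuples by multiplication with the entries of \<phi>. It is positive exactly when the
  column is contractive, and it restricts to fewer points.\<close>

definition column_kernel ::
  "('a \<Rightarrow> 'a \<Rightarrow> complex) \<Rightarrow> ('a \<Rightarrow> 'i \<Rightarrow> complex) \<Rightarrow> 'a \<times> 'i \<Rightarrow> 'a \<times> 'i \<Rightarrow> complex"
  where "column_kernel K \<phi> p q =
    K (fst p) (fst q) * ((if snd p = snd q then 1 else 0) - \<phi> (fst p) (snd p) * cnj (\<phi> (fst q) (snd q)))"

text \<open>The diagonal blocks may vary with the index: all equal to \<open>K\<close> they give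
  \<open>column_kernel\<close>, while the application of Leech's theorem multiplies some of them by
  a Gram kernel.\<close>

lemma qf_diagonal_minus_column:
  assumes "finite X" "finite I"
  shows "qf (X \<times> I) (\<lambda>p q. (if snd p = snd q then A (snd p) (fst p) (fst q) else 0)
        - K (fst p) (fst q) * (\<phi> (fst p) (snd p) * cnj (\<phi> (fst q) (snd q)))) c =
    (\<Sum>i\<in>I. qf X (A i) (\<lambda>z. c (z, i))) - qf X K (\<lambda>z. \<Sum>i\<in>I. cnj (\<phi> z i) * c (z, i))"
proof -
  let ?H = "\<lambda>p q. (if snd p = snd q then A (snd p) (fst p) (fst q) else 0)
        - K (fst p) (fst q) * (\<phi> (fst p) (snd p) * cnj (\<phi> (fst q) (snd q)))"
  have "qf (X \<times> I) ?H c =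
     (\<Sum>z\<in>X. \<Sum>i\<in>I. \<Sum>w\<in>X. \<Sum>j\<in>I. cnj (c (z, i)) * (if i = j then A i z w else 0) * c (w, j))
     - (\<Sum>z\<in>X. \<Sum>i\<in>I. \<Sum>w\<in>X. \<Sum>j\<in>I. (\<phi> z i * cnj (c (z, i))) * (K z w * (cnj (\<phi> w j) * c (w, j))))"
  proof -
    have prod: "(\<Sum>p\<in>X \<times> I. f p) = (\<Sum>z\<in>X. \<Sum>i\<in>I. f (z, i))" for f :: "'a \<times> 'b \<Rightarrow> complex"
      by (simp add: sum.cartesian_product)
    show ?thesis
      unfolding qf_def prod sum_subtractf[symmetric]
      by (intro sum.cong refl) (auto simp: algebra_simps)
  qed
  also have "(\<Sum>z\<in>X. \<Sum>i\<in>I. \<Sum>w\<in>X. \<Sum>j\<in>I. cnj (c (z, i)) * (if i = j then A i z w else 0) * c (w, j))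
      = (\<Sum>i\<in>I. qf X (A i) (\<lambda>z. c (z, i)))"
  proof -
    have "(\<Sum>j\<in>I. cnj (c (z, i)) * (if i = j then A i z w else 0) * c (w, j))
        = cnj (c (z, i)) * A i z w * c (w, i)" if "i \<in> I" for z i w
    proof -
      have "(\<Sum>j\<in>I. cnj (c (z, i)) * (if i = j then A i z w else 0) * c (w, j))
        = (\<Sum>j\<in>I. if i = j then cnj (c (z, i)) * A i z w * c (w, j) else 0)"
        by (intro sum.cong) auto
      then show ?thesis using that assms by simp
    qed
    then show ?thesis by (subst sum.swap) (simp add: qf_def)
  qed
  also have "(\<Sum>z\<in>X. \<Sum>i\<in>I. \<Sum>w\<in>X. \<Sum>j\<in>I. (\<phi> z i * cnj (c (z, i))) * (K z w * (cnj (\<phi> w j) * c (w, j))))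
      = qf X K (\<lambda>z. \<Sum>i\<in>I. cnj (\<phi> z i) * c (z, i))"
  proof -
    have "(\<Sum>i\<in>I. \<Sum>w\<in>X. \<Sum>j\<in>I. (\<phi> z i * cnj (c (z, i))) * (K z w * (cnj (\<phi> w j) * c (w, j))))
      = (\<Sum>w\<in>X. cnj (\<Sum>i\<in>I. cnj (\<phi> z i) * c (z, i)) * K z w * (\<Sum>j\<in>I. cnj (\<phi> w j) * c (w, j)))" for z
      by (subst sum.swap, intro sum.cong refl)
        (simp add: cnj_sum sum_product sum_distrib_left sum_distrib_right mult.assoc, rule sum.swap)
    then show ?thesis by (simp add: qf_def)
  qed
  finally show ?thesis .
qed

lemma qf_column_kernel:
  assumes "finite X" "finite I"
  shows "qf (X \<times> I) (column_kernel K \<phi>) c =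
    (\<Sum>i\<in>I. qf X K (\<lambda>z. c (z, i))) - qf X K (\<lambda>z. \<Sum>i\<in>I. cnj (\<phi> z i) * c (z, i))"
proof -
  have "qf (X \<times> I) (column_kernel K \<phi>) c =
      qf (X \<times> I) (\<lambda>p q. (if snd p = snd q then K (fst p) (fst q) else 0)
        - K (fst p) (fst q) * (\<phi> (fst p) (snd p) * cnj (\<phi> (fst q) (snd q)))) c"
    by (rule qf_cong) (auto simp: column_kernel_def algebra_simps)
  then show ?thesis
    using qf_diagonal_minus_column[OF assms, of "\<lambda>_. K" K \<phi> c] by simp
qed

text \<open>When \<open>L\<close> inverts \<open>K\<close>, the right-hand side is the squared norm
  of \<open>g\<close> minus those of the products with the entries of \<phi>, that is, the form of I
  - M* M. The arguments of \<phi> appear in swapped order because \<open>qf\<close> conjugates its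
  first slot.\<close>

lemma inverse_form_column:
  "qf X (\<lambda>z w. L z w * (1 - (\<Sum>i\<in>I. \<phi> w i * cnj (\<phi> z i)))) g
     = qf X L g - (\<Sum>i\<in>I. qf X L (\<lambda>z. \<phi> z i * g z))"
proof -
  have "qf X (\<lambda>z w. \<Sum>i\<in>I. L z w * (\<phi> w i * cnj (\<phi> z i))) g = (\<Sum>i\<in>I. qf X L (\<lambda>z. \<phi> z i * g z))"
    unfolding qf_def sum_distrib_left sum_distrib_right
    by (subst sum.swap, subst (2) sum.swap) (simp add: mult_ac sum.swap[of _ I X])
  then show ?thesis
    by (simp add: right_diff_distrib sum_distrib_left qf_diff)
qed

text \<open>From I - M M* to I - M* M: an operator whose adjoint is contractive is contractive. The
  next lemma is the reverse passage.\<close>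

lemma column_kernel_imp_inverse_form:
  assumes "finite X" "finite I" "psd X K" "inverse_kernel X K L"
    and "psd (X \<times> I) (column_kernel K \<phi>)"
  shows "psd X (\<lambda>z w. L z w * (1 - (\<Sum>i\<in>I. \<phi> w i * cnj (\<phi> z i))))"
proof (rule psdI)
  fix z w assume "z \<in> X" "w \<in> X"
  then show "L w z * (1 - (\<Sum>i\<in>I. \<phi> z i * cnj (\<phi> w i))) = cnj (L z w * (1 - (\<Sum>i\<in>I. \<phi> w i * cnj (\<phi> z i))))"
    using psd_herm[OF inverse_kernel_psd[OF assms(4)], of z w] by (simp add: mult.commute)
next
  fix g
  \<comment> \<open>The equality case of Young's inequality: each component of \<open>c\<close>
    attains the dual norm of the corresponding product with \<open>g\<close>, so nothing is lost
    before contractivity of the adjoint is applied.\<close>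
  define c where "c p = ap X L (\<lambda>z. \<phi> z (snd p) * g z) (fst p)" for p :: "'a \<times> 'b"
  let ?d = "\<lambda>z. \<Sum>i\<in>I. cnj (\<phi> z i) * c (z, i)"
  have "(\<Sum>i\<in>I. Re (qf X L (\<lambda>z. \<phi> z i * g z))) = (\<Sum>i\<in>I. Re (ipr X (\<lambda>z. c (z, i)) (\<lambda>z. \<phi> z i * g z)))"
    by (simp add: c_def qf_inverse_kernel(2)[OF assms(1,3,4)])
  also have "\<dots> = Re (ipr X ?d g)"
  proof -
    have "(\<Sum>i\<in>I. ipr X (\<lambda>z. c (z, i)) (\<lambda>z. \<phi> z i * g z)) = ipr X ?d g"
      unfolding ipr_def by (subst sum.swap) (simp add: sum_distrib_left mult_ac)
    then show ?thesis by (simp only: Re_sum[symmetric])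
  qed
  finally have 1: "(\<Sum>i\<in>I. Re (qf X L (\<lambda>z. \<phi> z i * g z))) = Re (ipr X ?d g)" .
  have "(\<Sum>i\<in>I. Re (qf X L (\<lambda>z. \<phi> z i * g z))) = (\<Sum>i\<in>I. Re (qf X K (\<lambda>z. c (z, i))))"
    by (simp add: c_def qf_inverse_kernel(1)[OF assms(1,3,4)])
  also have "\<dots> \<ge> Re (qf X K ?d)"
    using psd_nonneg[OF assms(5), of c] unfolding qf_column_kernel[OF assms(1,2)] by simp
  finally have "Re (qf X K ?d) \<le> (\<Sum>i\<in>I. Re (qf X L (\<lambda>z. \<phi> z i * g z)))" .
  then have "(\<Sum>i\<in>I. Re (qf X L (\<lambda>z. \<phi> z i * g z))) \<le> Re (qf X L g)"
    using inverse_kernel_young[OF assms(1,3,4), of ?d g] 1 by simp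
  then show "0 \<le> Re (qf X (\<lambda>z w. L z w * (1 - (\<Sum>i\<in>I. \<phi> w i * cnj (\<phi> z i)))) g)"
    unfolding inverse_form_column by simp
qed

lemma inverse_form_imp_column_kernel:
  assumes "finite X" "finite I" "psd X K" "inverse_kernel X K L"
    and "psd X (\<lambda>z w. L z w * (1 - (\<Sum>i\<in>I. \<phi> w i * cnj (\<phi> z i))))"
  shows "psd (X \<times> I) (column_kernel K \<phi>)"
proof (rule psdI)
  fix s t assume "s \<in> X \<times> I" "t \<in> X \<times> I"
  then show "column_kernel K \<phi> t s = cnj (column_kernel K \<phi> s t)"
    using psd_herm[OF assms(3), of "fst s" "fst t"] by (auto simp: column_kernel_def mult.commute)
next
  fix c
  let ?d = "\<lambda>z. \<Sum>i\<in>I. cnj (\<phi> z i) * c (z, i)"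
  let ?g = "ap X K ?d"
  have "2 * Re (qf X K ?d) = 2 * Re (ipr X ?d ?g)"
    by (simp add: qf_eq_ipr)
  also have "ipr X ?d ?g = (\<Sum>i\<in>I. ipr X (\<lambda>z. c (z, i)) (\<lambda>z. \<phi> z i * ?g z))"
    unfolding ipr_def by (subst sum.swap) (simp add: sum_distrib_right mult_ac)
  also have "2 * Re \<dots> \<le> (\<Sum>i\<in>I. Re (qf X K (\<lambda>z. c (z, i))) + Re (qf X L (\<lambda>z. \<phi> z i * ?g z)))"
    unfolding Re_sum sum_distrib_left by (intro sum_mono inverse_kernel_young assms)
  also have "\<dots> \<le> (\<Sum>i\<in>I. Re (qf X K (\<lambda>z. c (z, i)))) + Re (qf X L ?g)"
    using psd_nonneg[OF assms(5), of ?g] unfolding inverse_form_column by (simp add: sum.distrib)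
  also have "Re (qf X L ?g) = Re (qf X K ?d)"
    by (rule qf_inverse_kernel(3)[OF assms(1,3,4)])
  finally show "0 \<le> Re (qf (X \<times> I) (column_kernel K \<phi>) c)"
    unfolding qf_column_kernel[OF assms(1,2)] by simp
qed

lemma row_imp_inverse_form:
  assumes "finite X" "finite J" "psd X K" "inverse_kernel X K L"
    and "psd X (\<lambda>z w. K z w * (1 - (\<Sum>j\<in>J. \<beta> z j * cnj (\<beta> w j))))"
  shows "Re (qf X L (\<lambda>z. \<Sum>j\<in>J. \<beta> z j * h j z)) \<le> (\<Sum>j\<in>J. Re (qf X L (h j)))"
proof -
  let ?g = "\<lambda>z. \<Sum>j\<in>J. \<beta> z j * h j z"
  let ?c = "ap X L ?g"
  have "2 * Re (qf X L ?g) = 2 * Re (ipr X ?c ?g)"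
    by (simp add: qf_inverse_kernel(2)[OF assms(1,3,4)])
  also have "ipr X ?c ?g = (\<Sum>j\<in>J. ipr X (\<lambda>z. cnj (\<beta> z j) * ?c z) (h j))"
    unfolding ipr_def sum_distrib_left by (subst sum.swap) (simp add: mult_ac)
  also have "2 * Re \<dots> \<le> (\<Sum>j\<in>J. Re (qf X K (\<lambda>z. cnj (\<beta> z j) * ?c z)) + Re (qf X L (h j)))"
    unfolding Re_sum sum_distrib_left by (intro sum_mono inverse_kernel_young assms)
  also have "\<dots> = (\<Sum>j\<in>J. Re (qf X K (\<lambda>z. cnj (\<beta> z j) * ?c z))) + (\<Sum>j\<in>J. Re (qf X L (h j)))"
    by (simp add: sum.distrib)
  also have "(\<Sum>j\<in>J. Re (qf X K (\<lambda>z. cnj (\<beta> z j) * ?c z))) \<le> Re (qf X K ?c)"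
  proof -
    have "qf X (\<lambda>z w. \<Sum>j\<in>J. K z w * (\<beta> z j * cnj (\<beta> w j))) ?c
        = (\<Sum>j\<in>J. qf X K (\<lambda>z. cnj (\<beta> z j) * ?c z))"
      unfolding qf_def sum_distrib_left sum_distrib_right
      by (subst sum.swap, subst (2) sum.swap) (simp add: mult_ac sum.swap[of _ J X])
    then show ?thesis
      using psd_nonneg[OF assms(5), of ?c]
      by (simp add: right_diff_distrib sum_distrib_left qf_diff)
  qed
  also have "Re (qf X K ?c) = Re (qf X L ?g)"
    by (rule qf_inverse_kernel(1)[OF assms(1,3,4)])
  finally show ?thesis by simp
qed

section \<open>Leech factorisation\<close>

text \<open>Orthogonal projection onto the span of the \<open>u a\<close> by Gram-Schmidt, expressed
  through coefficients since the \<open>u a\<close> may be linearly dependent.\<close>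

lemma projection_exists:
  fixes u :: "'a \<Rightarrow> 'p \<Rightarrow> complex"
  assumes "finite S"
  shows "\<exists>c. \<forall>b\<in>S. (\<Sum>p\<in>U. (x p - (\<Sum>a\<in>S. c a * u a p)) * cnj (u b p)) = 0"
  using assms
proof (induction S arbitrary: x rule: finite_induct)
  case empty
  then show ?case by simp
next
  case (insert s S)
  define ip where "ip f g = (\<Sum>p\<in>U. f p * cnj (g p))" for f g :: "'p \<Rightarrow> complex"
  have ip_diff: "ip (\<lambda>p. f p - k * g p) h = ip f h - k * ip g h" for f g h k
    by (simp add: ip_def algebra_simps sum_subtractf sum_distrib_left)
  obtain c where c: "\<And>b. b \<in> S \<Longrightarrow> ip (\<lambda>p. x p - (\<Sum>a\<in>S. c a * u a p)) (u b) = 0"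
    using insert.IH[of x] unfolding ip_def by blast
  obtain d where d: "\<And>b. b \<in> S \<Longrightarrow> ip (\<lambda>p. u s p - (\<Sum>a\<in>S. d a * u a p)) (u b) = 0"
    using insert.IH[of "u s"] unfolding ip_def by blast
  define x' where "x' p = x p - (\<Sum>a\<in>S. c a * u a p)" for p
  define u' where "u' p = u s p - (\<Sum>a\<in>S. d a * u a p)" for p
  have perp: "ip x' (u b) = 0" "ip u' (u b) = 0" if "b \<in> S" for b
    using c[OF that] d[OF that] by (simp_all add: x'_def[abs_def] u'_def[abs_def])
  have us: "ip f (u s) = ip f u'" if "\<And>b. b \<in> S \<Longrightarrow> ip f (u b) = 0" for f
  proof -
    have "ip f (u s) - ip f u' = (\<Sum>p\<in>U. \<Sum>a\<in>S. cnj (d a) * (f p * cnj (u a p)))"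
      by (simp add: ip_def u'_def sum_subtractf[symmetric] algebra_simps cnj_sum sum_distrib_left)
    also have "\<dots> = (\<Sum>a\<in>S. cnj (d a) * ip f (u a))"
      by (subst sum.swap) (simp add: ip_def sum_distrib_left)
    finally show ?thesis using that by simp
  qed
  \<comment> \<open>If \<open>u'\<close> has norm zero, division by zero gives \<open>k = 0\<close>,
    which is correct because the numerator vanishes too.\<close>
  define k where "k = ip x' u' / ip u' u'"
  have k: "ip x' u' = k * ip u' u'"
  proof (cases "ip u' u' = 0")
    case False
    then show ?thesis by (simp add: k_def)
  next
    case True
    have "ip u' u' = of_real (\<Sum>p\<in>U. (cmod (u' p))\<^sup>2)"
      unfolding ip_def of_real_sum by (intro sum.cong refl) (subst complex_norm_square, simp)
    then have 0: "(\<Sum>p\<in>U. (cmod (u' p))\<^sup>2) = 0" using True by (metis of_real_eq_0_iff)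
    have "ip x' u' = 0"
    proof (cases "finite U")
      case True
      then have "u' p = 0" if "p \<in> U" for p
        using 0 that by (subst (asm) sum_nonneg_eq_0_iff) auto
      then show ?thesis by (simp add: ip_def)
    qed (simp add: ip_def)
    then show ?thesis using \<open>ip u' u' = 0\<close> by simp
  qed
  define e where "e a = (if a = s then k else c a - k * d a)" for a
  have e: "x p - (\<Sum>a\<in>insert s S. e a * u a p) = x' p - k * u' p" for p
  proof -
    have "(\<Sum>a\<in>S. e a * u a p) = (\<Sum>a\<in>S. c a * u a p - k * (d a * u a p))"
      using insert.hyps by (intro sum.cong) (auto simp: e_def algebra_simps)
    then show ?thesis
      using insert.hyps by (simp add: e_def x'_def u'_def sum_subtractf sum_distrib_left algebra_simps)
  qed
  have "ip (\<lambda>p. x' p - k * u' p) (u b) = 0" if "b \<in> insert s S" for b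
  proof -
    have S: "ip (\<lambda>p. x' p - k * u' p) (u b) = 0" if "b \<in> S" for b
      using perp[OF that] by (simp add: ip_diff)
    then have "ip (\<lambda>p. x' p - k * u' p) (u s) = ip (\<lambda>p. x' p - k * u' p) u'"
      by (rule us)
    then show ?thesis using S that k by (auto simp: ip_diff)
  qed
  then show ?case unfolding ip_def e[symmetric] by blast
qed

lemma sum_cmod_square:
  "complex_of_real (\<Sum>p\<in>U. (cmod (f p))\<^sup>2) = (\<Sum>p\<in>U. f p * cnj (f p))"
  unfolding of_real_sum by (intro sum.cong refl) (rule complex_norm_square)

lemma gram_norm:
  "complex_of_real (\<Sum>r\<in>V. (cmod (\<Sum>a\<in>S. k a * v a r))\<^sup>2)
     = (\<Sum>a\<in>S. \<Sum>b\<in>S. k a * cnj (k b) * (\<Sum>r\<in>V. v a r * cnj (v b r)))"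
proof -
  have "complex_of_real (\<Sum>r\<in>V. (cmod (\<Sum>a\<in>S. k a * v a r))\<^sup>2)
      = (\<Sum>r\<in>V. \<Sum>a\<in>S. \<Sum>b\<in>S. k a * cnj (k b) * (v a r * cnj (v b r)))"
    unfolding sum_cmod_square
    by (intro sum.cong refl) (simp add: cnj_sum sum_product mult_ac)
  also have "\<dots> = (\<Sum>a\<in>S. \<Sum>b\<in>S. \<Sum>r\<in>V. k a * cnj (k b) * (v a r * cnj (v b r)))"
    by (subst sum.swap, intro sum.cong refl, rule sum.swap)
  finally show ?thesis by (simp add: sum_distrib_left)
qed

text \<open>Sending \<open>u a\<close> to \<open>v a\<close> preserves the norms of linear
  combinations, so it is a well-defined isometry on the span despite possible dependencies. Extended
  by zero on the orthogonal complement it becomes the contraction \<open>T\<close>, which acts on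
  row vectors from the right.\<close>

lemma equal_gram_contraction:
  fixes u :: "'a \<Rightarrow> 'p \<Rightarrow> complex" and v :: "'a \<Rightarrow> 'r \<Rightarrow> complex"
  assumes fin: "finite S" "finite U" "finite V"
    and gram: "\<And>a b. a \<in> S \<Longrightarrow> b \<in> S \<Longrightarrow>
      (\<Sum>p\<in>U. u a p * cnj (u b p)) = (\<Sum>r\<in>V. v a r * cnj (v b r))"
  obtains T where "\<And>a r. a \<in> S \<Longrightarrow> r \<in> V \<Longrightarrow> (\<Sum>p\<in>U. u a p * T p r) = v a r"
    and "\<And>x. (\<Sum>r\<in>V. (cmod (\<Sum>p\<in>U. x p * T p r))\<^sup>2) \<le> (\<Sum>p\<in>U. (cmod (x p))\<^sup>2)"
proof -
  have "\<forall>y. \<exists>c. \<forall>b\<in>S. (\<Sum>p\<in>U. ((if p = y then 1 else 0) - (\<Sum>a\<in>S. c a * u a p)) * cnj (u b p)) = 0"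
    by (intro allI projection_exists[OF fin(1)])
  from choice[OF this] obtain c where c: "\<And>y b. b \<in> S \<Longrightarrow>
      (\<Sum>p\<in>U. ((if p = y then 1 else 0) - (\<Sum>a\<in>S. c y a * u a p)) * cnj (u b p)) = 0"
    by blast
  \<comment> \<open>\<open>c y\<close> holds the coefficients of the projection of the unit vector
    at \<open>y\<close>; the same combination of the \<open>v a\<close> is row \<open>y\<close> of
    \<open>T\<close>.\<close>
  define T where "T y r = (\<Sum>a\<in>S. c y a * v a r)" for y r
  define C where "C x a = (\<Sum>y\<in>U. x y * c y a)" for x a
  have xT: "(\<Sum>p\<in>U. x p * T p r) = (\<Sum>a\<in>S. C x a * v a r)" for x r
    unfolding T_def C_def sum_distrib_left sum_distrib_right
    by (subst sum.swap) (simp add: mult.assoc)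
  define res where "res x p = x p - (\<Sum>a\<in>S. C x a * u a p)" for x p
  have perp: "(\<Sum>p\<in>U. res x p * cnj (u b p)) = 0" if "b \<in> S" for x b
  proof -
    have res: "res x p = (\<Sum>y\<in>U. x y * ((if p = y then 1 else 0) - (\<Sum>a\<in>S. c y a * u a p)))"
      if "p \<in> U" for p
    proof -
      have "(\<Sum>y\<in>U. x y * (if p = y then 1 else 0)) = (\<Sum>y\<in>U. if p = y then x y else 0)"
        by (intro sum.cong) auto
      also have "\<dots> = x p" using that fin(2) by simp
      finally show ?thesis
        unfolding res_def C_def right_diff_distrib sum_subtractf sum_distrib_left sum_distrib_right
        by (simp add: mult.assoc) (rule sum.swap)
    qed
    have "(\<Sum>p\<in>U. res x p * cnj (u b p)) =
       (\<Sum>p\<in>U. \<Sum>y\<in>U. x y * (((if p = y then 1 else 0) - (\<Sum>a\<in>S. c y a * u a p)) * cnj (u b p)))"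
      by (intro sum.cong refl) (simp add: res sum_distrib_right mult.assoc)
    also have "\<dots> = (\<Sum>y\<in>U. x y * (\<Sum>p\<in>U. ((if p = y then 1 else 0) - (\<Sum>a\<in>S. c y a * u a p)) * cnj (u b p)))"
      by (subst sum.swap) (simp only: sum_distrib_left)
    finally show ?thesis using c[OF that] by simp
  qed
  have perp': "(\<Sum>p\<in>U. res x p * cnj (\<Sum>a\<in>S. k a * u a p)) = 0" for x k
  proof -
    have "(\<Sum>p\<in>U. res x p * cnj (\<Sum>a\<in>S. k a * u a p)) = (\<Sum>a\<in>S. cnj (k a) * (\<Sum>p\<in>U. res x p * cnj (u a p)))"
      unfolding cnj_sum sum_distrib_left by (subst sum.swap) (simp add: mult_ac)
    then show ?thesis using perp by simp
  qed
  have gram': "(\<Sum>r\<in>V. (cmod (\<Sum>a\<in>S. k a * v a r))\<^sup>2) = (\<Sum>p\<in>U. (cmod (\<Sum>a\<in>S. k a * u a p))\<^sup>2)" for k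
  proof -
    have "complex_of_real (\<Sum>r\<in>V. (cmod (\<Sum>a\<in>S. k a * v a r))\<^sup>2)
        = complex_of_real (\<Sum>p\<in>U. (cmod (\<Sum>a\<in>S. k a * u a p))\<^sup>2)"
      unfolding gram_norm using gram by (intro sum.cong refl) auto
    then show ?thesis by (simp only: of_real_eq_iff)
  qed
  show thesis
  proof (rule that)
    fix x :: "'p \<Rightarrow> complex"
    let ?w = "\<lambda>p. \<Sum>a\<in>S. C x a * u a p"
    have "complex_of_real (\<Sum>p\<in>U. (cmod (x p))\<^sup>2)
        = (\<Sum>p\<in>U. (res x p + ?w p) * cnj (res x p + ?w p))"
      unfolding sum_cmod_square res_def by simp
    also have "\<dots> = (\<Sum>p\<in>U. res x p * cnj (res x p)) + (\<Sum>p\<in>U. res x p * cnj (?w p))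
        + cnj (\<Sum>p\<in>U. res x p * cnj (?w p)) + (\<Sum>p\<in>U. ?w p * cnj (?w p))"
      by (simp add: distrib_left distrib_right sum.distrib cnj_sum add_ac mult.commute)
    also have "\<dots> = complex_of_real ((\<Sum>p\<in>U. (cmod (res x p))\<^sup>2) + (\<Sum>p\<in>U. (cmod (?w p))\<^sup>2))"
      unfolding perp' of_real_add sum_cmod_square by simp
    finally have "(\<Sum>p\<in>U. (cmod (x p))\<^sup>2) = (\<Sum>p\<in>U. (cmod (res x p))\<^sup>2) + (\<Sum>p\<in>U. (cmod (?w p))\<^sup>2)"
      by (simp only: of_real_eq_iff)
    moreover have "0 \<le> (\<Sum>p\<in>U. (cmod (res x p))\<^sup>2)" by (simp add: sum_nonneg)
    ultimately show "(\<Sum>r\<in>V. (cmod (\<Sum>p\<in>U. x p * T p r))\<^sup>2) \<le> (\<Sum>p\<in>U. (cmod (x p))\<^sup>2)"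
      unfolding xT gram' by simp
  next
    fix b r assume b: "b \<in> S" and r: "r \<in> V"
    \<comment> \<open>The combination of the \<open>u a\<close> with coefficients \<open>k\<close>
      is the residual of \<open>u b\<close>. It lies in the span and is orthogonal to it, hence is
      zero, and the equal Gram matrices make the same combination of the \<open>v a\<close>
      zero.\<close>
    define k where "k a = (if a = b then 1 else 0) - C (u b) a" for a
    have delta: "(\<Sum>a\<in>S. (if a = b then 1 else 0) * f a) = f b" for f :: "'a \<Rightarrow> complex"
    proof -
      have "(\<Sum>a\<in>S. (if a = b then 1 else 0) * f a) = (\<Sum>a\<in>S. if a = b then f a else 0)"
        by (intro sum.cong) auto
      then show ?thesis using b fin(1) by simp
    qed
    have resk: "res (u b) p = (\<Sum>a\<in>S. k a * u a p)" for p
      unfolding k_def left_diff_distrib sum_subtractf delta res_def ..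
    have "complex_of_real (\<Sum>p\<in>U. (cmod (\<Sum>a\<in>S. k a * u a p))\<^sup>2) = 0"
      using perp'[of "u b" k] unfolding sum_cmod_square resk .
    then have "(\<Sum>r\<in>V. (cmod (\<Sum>a\<in>S. k a * v a r))\<^sup>2) = 0"
      unfolding gram' by (simp only: of_real_eq_0_iff)
    then have "(\<Sum>a\<in>S. k a * v a r) = 0"
      using r fin(3) by (subst (asm) sum_nonneg_eq_0_iff) auto
    then show "(\<Sum>p\<in>U. u b p * T p r) = v b r"
      unfolding k_def left_diff_distrib sum_subtractf delta xT by simp
  qed
qed

lemma contraction_psd:
  assumes "finite S" "\<And>x. (\<Sum>r\<in>V. (cmod (\<Sum>p\<in>U. x p * T p r))\<^sup>2) \<le> (\<Sum>p\<in>U. (cmod (x p))\<^sup>2)"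
  shows "psd S (\<lambda>s t. (\<Sum>p\<in>U. x s p * cnj (x t p))
      - (\<Sum>r\<in>V. (\<Sum>p\<in>U. x s p * T p r) * cnj (\<Sum>p\<in>U. x t p * T p r)))"
    (is "psd S (\<lambda>s t. ?A s t - ?B s t)")
proof (rule psdI)
  show "?A t s - ?B t s = cnj (?A s t - ?B s t)" for s t
    by (simp add: cnj_sum mult.commute)
  fix c
  have form: "qf S (\<lambda>s t. \<Sum>r\<in>W. f s r * cnj (f t r)) c
      = complex_of_real (\<Sum>r\<in>W. (cmod (\<Sum>s\<in>S. cnj (c s) * f s r))\<^sup>2)" for W :: "'w set" and f
    unfolding gram_norm qf_def by (simp add: mult_ac)
  have "(\<Sum>s\<in>S. cnj (c s) * (\<Sum>p\<in>U. x s p * T p r)) = (\<Sum>p\<in>U. (\<Sum>s\<in>S. cnj (c s) * x s p) * T p r)" for r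
    unfolding sum_distrib_left sum_distrib_right by (subst sum.swap) (simp add: mult.assoc)
  then show "0 \<le> Re (qf S (\<lambda>s t. ?A s t - ?B s t) c)"
    unfolding qf_diff form using assms(2)[of "\<lambda>p. \<Sum>s\<in>S. cnj (c s) * x s p"] by simp
qed

text \<open>Solves g (I - D) = b for row vectors through the normal equations. Their matrix is
  definite: a null vector \<open>c\<close> satisfies c = cnj D c, so its squared norm is its pairing
  with \<open>c\<close> times \<open>D\<close>, at most \<open>(1 + \<theta>) / 2\<close> times the
  squared norm.\<close>

lemma strict_contraction_resolvent:
  fixes D :: "'m \<Rightarrow> 'm \<Rightarrow> complex"
  assumes fin: "finite M" and \<theta>: "\<theta> < 1"
    and contr: "\<And>x. (\<Sum>n\<in>M. (cmod (\<Sum>m\<in>M. x m * D m n))\<^sup>2) \<le> \<theta> * (\<Sum>m\<in>M. (cmod (x m))\<^sup>2)"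
  shows "\<exists>g. \<forall>n\<in>M. g n = b n + (\<Sum>m\<in>M. g m * D m n)"
proof -
  define A where "A m n = (if m = n then 1 else 0) - D m n" for m n
  define Q where "Q n n' = (\<Sum>m\<in>M. A m n * cnj (A m n'))" for n n'
  have "pd M Q"
    unfolding pd_def
  proof (intro conjI allI impI ballI)
    show "psd M Q" unfolding Q_def by (rule psd_gram[OF fin])
    fix c s assume c: "Re (qf M Q c) = 0" and s: "s \<in> M"
    have "qf M Q c = (\<Sum>m\<in>M. qf M (\<lambda>n n'. A m n * cnj (A m n')) c)"
      unfolding qf_def Q_def sum_distrib_left sum_distrib_right
      by (subst (3) sum.swap, subst (2) sum.swap) (rule refl)
    then have "(\<Sum>m\<in>M. (cmod (\<Sum>n\<in>M. cnj (A m n) * c n))\<^sup>2) = 0"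
      using c by (simp add: qf_rank_one)
    then have "(\<Sum>n\<in>M. cnj (A m n) * c n) = 0" if "m \<in> M" for m
      using that fin by (subst (asm) sum_nonneg_eq_0_iff) auto
    moreover have "(\<Sum>n\<in>M. cnj (A m n) * c n) = c m - (\<Sum>n\<in>M. cnj (D m n) * c n)" if "m \<in> M" for m
    proof -
      have "(\<Sum>n\<in>M. (if m = n then 1 else 0) * c n) = (\<Sum>n\<in>M. if m = n then c n else 0)"
        by (intro sum.cong) auto
      also have "\<dots> = c m" using that fin by simp
      finally show ?thesis
        unfolding A_def complex_cnj_diff if_distrib[of cnj] complex_cnj_one complex_cnj_zero
          left_diff_distrib sum_subtractf by simp
    qed
    ultimately have cD: "c m = (\<Sum>n\<in>M. cnj (D m n) * c n)" if "m \<in> M" for m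
      using that by fastforce
    let ?S = "\<Sum>m\<in>M. (cmod (c m))\<^sup>2"
    let ?d = "\<lambda>n. \<Sum>m\<in>M. c m * D m n"
    have "complex_of_real ?S = (\<Sum>m\<in>M. (\<Sum>n\<in>M. cnj (D m n) * c n) * cnj (c m))"
      unfolding sum_cmod_square by (intro sum.cong refl arg_cong2[where f = "(*)"] cD)
    also have "\<dots> = (\<Sum>n\<in>M. c n * cnj (?d n))"
      unfolding cnj_sum sum_distrib_left sum_distrib_right
      by (subst sum.swap) (simp add: mult_ac)
    finally have "Re (complex_of_real ?S) = Re (\<Sum>n\<in>M. c n * cnj (?d n))"
      by (rule arg_cong)
    then have "?S = Re (\<Sum>n\<in>M. c n * cnj (?d n))"
      by (simp only: Re_complex_of_real)
    also have "\<dots> \<le> (\<Sum>n\<in>M. ((cmod (c n))\<^sup>2 + (cmod (?d n))\<^sup>2) / 2)"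
      unfolding Re_sum
    proof (intro sum_mono)
      fix n
      have "Re (c n * cnj (?d n)) \<le> cmod (c n) * cmod (?d n)"
        by (metis complex_Re_le_cmod complex_mod_cnj norm_mult)
      also have "\<dots> \<le> ((cmod (c n))\<^sup>2 + (cmod (?d n))\<^sup>2) / 2"
        using sum_squares_bound[of "cmod (c n)" "cmod (?d n)"] by simp
      finally show "Re (c n * cnj (?d n)) \<le> ((cmod (c n))\<^sup>2 + (cmod (?d n))\<^sup>2) / 2" .
    qed
    also have "\<dots> = (?S + (\<Sum>n\<in>M. (cmod (?d n))\<^sup>2)) / 2"
      by (simp add: sum_divide_distrib[symmetric] sum.distrib)
    also have "\<dots> \<le> (?S + \<theta> * ?S) / 2" using contr[of c] by simp
    finally have "(1 - \<theta>) * ?S \<le> 0" by (simp add: algebra_simps)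
    moreover have "0 \<le> ?S" by (simp add: sum_nonneg)
    ultimately have "?S = 0" using \<theta> by (simp add: mult_le_0_iff)
    then show "c s = 0"
      using s fin by (subst (asm) sum_nonneg_eq_0_iff) auto
  qed
  then obtain c where c: "\<And>n. n \<in> M \<Longrightarrow> ap M Q c n = b n"
    using pd_solve[OF fin] by blast
  define g where "g m = (\<Sum>n\<in>M. c n * cnj (A m n))" for m
  have "g n = b n + (\<Sum>m\<in>M. g m * D m n)" if n: "n \<in> M" for n
  proof -
    have "b n = (\<Sum>m\<in>M. g m * A m n)"
      unfolding c[OF n, symmetric] ap_def Q_def g_def sum_distrib_left sum_distrib_right
      by (subst sum.swap) (simp add: mult_ac)
    also have "\<dots> = g n - (\<Sum>m\<in>M. g m * D m n)"
    proof -
      have "(\<Sum>m\<in>M. g m * (if m = n then 1 else 0)) = (\<Sum>m\<in>M. if m = n then g m else 0)"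
        by (intro sum.cong) auto
      also have "\<dots> = g n" using n fin by simp
      finally show ?thesis unfolding A_def by (simp add: right_diff_distrib sum_subtractf)
    qed
    finally show ?thesis by simp
  qed
  then show ?thesis by blast
qed

text \<open>A lurking isometry. As \<open>K\<close> is \<open>s z * cnj (s w)\<close> divided by 1 -
  F, the hypothesis says that the vectors (B, \<beta> R) and (\<phi>, R) have the same Gram matrix.
  A contraction \<open>T\<close> maps the first to the second, and \<Gamma> is the transfer function
  of its four blocks.\<close>

lemma leech:
  fixes K :: "'x \<Rightarrow> 'x \<Rightarrow> complex" and B :: "'x \<Rightarrow> 's \<Rightarrow> 'y \<Rightarrow> complex" and \<beta> :: "'x \<Rightarrow> 'e \<Rightarrow> complex"
  assumes fin: "finite X" "finite E" "finite S" "finite Y"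
    and K: "psd X K"
    and pick: "\<And>z w. z \<in> X \<Longrightarrow> w \<in> X \<Longrightarrow> K z w * (1 - (\<Sum>j\<in>E. \<beta> z j * cnj (\<beta> w j))) = s z * cnj (s w)"
    and s0: "\<And>z. z \<in> X \<Longrightarrow> s z \<noteq> 0"
    and ball: "\<And>z. z \<in> X \<Longrightarrow> (\<Sum>j\<in>E. (cmod (\<beta> z j))\<^sup>2) < 1"
    and hyp: "psd (X \<times> S) (\<lambda>p q. K (fst p) (fst q) *
        ((\<Sum>y\<in>Y. B (fst p) (snd p) y * cnj (B (fst q) (snd q) y)) - \<phi> (fst p) (snd p) * cnj (\<phi> (fst q) (snd q))))"
  obtains \<Gamma> where "\<And>z a. z \<in> X \<Longrightarrow> a \<in> S \<Longrightarrow> \<phi> z a = (\<Sum>y\<in>Y. B z a y * \<Gamma> z y)"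
    and "psd (X \<times> Y) (column_kernel K \<Gamma>)"
proof -
  define F where "F z w = (\<Sum>j\<in>E. \<beta> z j * cnj (\<beta> w j))" for z w
  define M where "M = X \<times> S"
  have finM: "finite M" using fin by (simp add: M_def)
  obtain P where P: "\<And>p q. p \<in> M \<Longrightarrow> q \<in> M \<Longrightarrow>
      K (fst p) (fst q) * ((\<Sum>y\<in>Y. B (fst p) (snd p) y * cnj (B (fst q) (snd q) y))
        - \<phi> (fst p) (snd p) * cnj (\<phi> (fst q) (snd q))) = (\<Sum>m\<in>M. P p m * cnj (P q m))"
    using psd_imp_gram[OF _ hyp] fin unfolding M_def by blast
  define R where "R p m = P p m / s (fst p)" for p m
  have R: "(\<Sum>y\<in>Y. B (fst p) (snd p) y * cnj (B (fst q) (snd q) y)) - \<phi> (fst p) (snd p) * cnj (\<phi> (fst q) (snd q))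
      = (1 - F (fst p) (fst q)) * (\<Sum>m\<in>M. R p m * cnj (R q m))" if pq: "p \<in> M" "q \<in> M" for p q
  proof -
    let ?k = "K (fst p) (fst q)"
    let ?d = "(\<Sum>y\<in>Y. B (fst p) (snd p) y * cnj (B (fst q) (snd q) y)) - \<phi> (fst p) (snd p) * cnj (\<phi> (fst q) (snd q))"
    have X: "fst p \<in> X" "fst q \<in> X" using pq by (auto simp: M_def)
    have k: "?k * (1 - F (fst p) (fst q)) = s (fst p) * cnj (s (fst q))"
      using pick[OF X] by (simp add: F_def)
    have "(\<Sum>m\<in>M. P p m * cnj (P q m)) = s (fst p) * cnj (s (fst q)) * (\<Sum>m\<in>M. R p m * cnj (R q m))"
      unfolding sum_distrib_left R_def using s0[OF X(1)] s0[OF X(2)] by (intro sum.cong refl) simp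
    then have "?k * ?d = ?k * ((1 - F (fst p) (fst q)) * (\<Sum>m\<in>M. R p m * cnj (R q m)))"
      unfolding P[OF pq] k[symmetric] by (simp add: mult.assoc)
    moreover have "?k \<noteq> 0" using k s0[OF X(1)] s0[OF X(2)] by auto
    ultimately show ?thesis by simp
  qed
  define U where "U = Y <+> (E \<times> M)"
  define V where "V = {()} <+> M"
  define u where "u p = case_sum (B (fst p) (snd p)) (\<lambda>jm. \<beta> (fst p) (fst jm) * R p (snd jm))" for p
  define v where "v p = case_sum (\<lambda>_::unit. \<phi> (fst p) (snd p)) (R p)" for p
  have finU: "finite U" "finite V" using fin finM by (simp_all add: U_def V_def)
  have sumU: "(\<Sum>p\<in>U. f p) = (\<Sum>y\<in>Y. f (Inl y)) + (\<Sum>j\<in>E. \<Sum>m\<in>M. f (Inr (j, m)))"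
    for f :: "_ \<Rightarrow> complex"
    using fin finM by (simp add: U_def sum.Plus sum.cartesian_product)
  have sumV: "(\<Sum>r\<in>V. f r) = f (Inl ()) + (\<Sum>m\<in>M. f (Inr m))" for f :: "_ \<Rightarrow> 'w :: comm_monoid_add"
    using finM by (simp add: V_def sum.Plus)
  have gram: "(\<Sum>r\<in>U. u p r * cnj (u q r)) = (\<Sum>r\<in>V. v p r * cnj (v q r))" if "p \<in> M" "q \<in> M" for p q
  proof -
    have "(\<Sum>j\<in>E. \<Sum>m\<in>M. \<beta> (fst p) j * R p m * cnj (\<beta> (fst q) j * R q m))
        = F (fst p) (fst q) * (\<Sum>m\<in>M. R p m * cnj (R q m))"
      unfolding F_def sum_product by (simp add: mult_ac)
    then show ?thesis
      using R[OF that] by (simp add: sumU sumV u_def v_def algebra_simps)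
  qed
  obtain T where T: "\<And>p r. p \<in> M \<Longrightarrow> r \<in> V \<Longrightarrow> (\<Sum>i\<in>U. u p i * T i r) = v p r"
    and contr: "\<And>x. (\<Sum>r\<in>V. (cmod (\<Sum>p\<in>U. x p * T p r))\<^sup>2) \<le> (\<Sum>p\<in>U. (cmod (x p))\<^sup>2)"
    using equal_gram_contraction[where u = u and v = v, OF finM finU gram] by blast
  \<comment> \<open>The block of \<open>T\<close> from \<beta> R to R, combined with \<beta> z. It
    is a strict contraction because \<beta> z has norm below one, so the feedback equation defining
    \<open>G\<close> below has a solution.\<close>
  define D where "D z m n = (\<Sum>j\<in>E. \<beta> z j * T (Inr (j, m)) (Inr n))" for z m n
  have Dx: "(\<Sum>j\<in>E. \<Sum>m\<in>M. \<beta> z j * x m * T (Inr (j, m)) (Inr n)) = (\<Sum>m\<in>M. x m * D z m n)" for z x n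
    unfolding D_def sum_distrib_left by (subst sum.swap) (simp add: mult_ac)
  have Dcontr: "(\<Sum>n\<in>M. (cmod (\<Sum>m\<in>M. x m * D z m n))\<^sup>2)
      \<le> (\<Sum>j\<in>E. (cmod (\<beta> z j))\<^sup>2) * (\<Sum>m\<in>M. (cmod (x m))\<^sup>2)" for z x
  proof -
    let ?x = "case_sum (\<lambda>_. 0) (\<lambda>jm. \<beta> z (fst jm) * x (snd jm)) :: 'y + 'e \<times> 'x \<times> 's \<Rightarrow> complex"
    have xT: "(\<Sum>p\<in>U. ?x p * T p (Inr n)) = (\<Sum>m\<in>M. x m * D z m n)" for n
      by (simp add: sumU Dx)
    have "(\<Sum>n\<in>M. (cmod (\<Sum>m\<in>M. x m * D z m n))\<^sup>2) \<le> (\<Sum>r\<in>V. (cmod (\<Sum>p\<in>U. ?x p * T p r))\<^sup>2)"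
      unfolding sumV xT by simp
    also have "\<dots> \<le> (\<Sum>p\<in>U. (cmod (?x p))\<^sup>2)" by (rule contr)
    also have "\<dots> = (\<Sum>j\<in>E. \<Sum>m\<in>M. (cmod (\<beta> z j))\<^sup>2 * (cmod (x m))\<^sup>2)"
      using fin finM by (simp add: U_def sum.Plus sum.cartesian_product norm_mult power_mult_distrib split_def)
    finally show ?thesis by (simp add: sum_product)
  qed
  have Dzero: "h m = 0" if z: "z \<in> X" and h: "\<And>n. n \<in> M \<Longrightarrow> h n = (\<Sum>m\<in>M. h m * D z m n)" and m: "m \<in> M" for z h m
  proof -
    let ?H = "\<Sum>m\<in>M. (cmod (h m))\<^sup>2"
    have "?H = (\<Sum>n\<in>M. (cmod (\<Sum>m\<in>M. h m * D z m n))\<^sup>2)"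
      by (intro sum.cong refl) (simp only: h[symmetric])
    also have "\<dots> \<le> (\<Sum>j\<in>E. (cmod (\<beta> z j))\<^sup>2) * ?H" by (rule Dcontr)
    finally have "(1 - (\<Sum>j\<in>E. (cmod (\<beta> z j))\<^sup>2)) * ?H \<le> 0" by (simp add: algebra_simps)
    moreover have "0 \<le> ?H" by (simp add: sum_nonneg)
    ultimately have "?H = 0" using ball[OF z] by (simp add: mult_le_0_iff)
    then show ?thesis using m finM by (subst (asm) sum_nonneg_eq_0_iff) auto
  qed
  define G where "G z y = (SOME g. \<forall>n\<in>M. g n = T (Inl y) (Inr n) + (\<Sum>m\<in>M. g m * D z m n))" for z y
  have G: "G z y n = T (Inl y) (Inr n) + (\<Sum>m\<in>M. G z y m * D z m n)" if "z \<in> X" "n \<in> M" for z y n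
    using someI_ex[OF strict_contraction_resolvent[OF finM ball[OF that(1)] Dcontr,
        of "\<lambda>n. T (Inl y) (Inr n)"]] that(2)
    unfolding G_def by blast
  define \<Gamma> where "\<Gamma> z y = T (Inl y) (Inl ()) + (\<Sum>j\<in>E. \<Sum>m\<in>M. \<beta> z j * G z y m * T (Inr (j, m)) (Inl ()))" for z y
  \<comment> \<open>Both sides solve the same feedback equation, and by \<open>Dzero\<close> its
    homogeneous version has only the zero solution.\<close>
  have RG: "R (z, a) n = (\<Sum>y\<in>Y. B z a y * G z y n)" if z: "z \<in> X" and a: "a \<in> S" and n: "n \<in> M" for z a n
  proof -
    have za: "(z, a) \<in> M" using z a by (simp add: M_def)
    define h where "h n = R (z, a) n - (\<Sum>y\<in>Y. B z a y * G z y n)" for n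
    have "h n = (\<Sum>m\<in>M. h m * D z m n)" if n: "n \<in> M" for n
    proof -
      have "R (z, a) n = (\<Sum>y\<in>Y. B z a y * T (Inl y) (Inr n)) + (\<Sum>m\<in>M. R (z, a) m * D z m n)"
        using T[OF za, of "Inr n"] n by (simp add: sumU u_def v_def V_def Dx InrI)
      moreover have "(\<Sum>y\<in>Y. B z a y * G z y n) = (\<Sum>y\<in>Y. B z a y * T (Inl y) (Inr n))
          + (\<Sum>m\<in>M. (\<Sum>y\<in>Y. B z a y * G z y m) * D z m n)"
      proof -
        have "(\<Sum>y\<in>Y. B z a y * G z y n) = (\<Sum>y\<in>Y. B z a y * (T (Inl y) (Inr n) + (\<Sum>m\<in>M. G z y m * D z m n)))"
          by (intro sum.cong refl) (simp only: G[OF z n, symmetric])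
        also have "\<dots> = (\<Sum>y\<in>Y. B z a y * T (Inl y) (Inr n)) + (\<Sum>y\<in>Y. \<Sum>m\<in>M. B z a y * G z y m * D z m n)"
          by (simp add: distrib_left sum.distrib sum_distrib_left mult.assoc)
        also have "(\<Sum>y\<in>Y. \<Sum>m\<in>M. B z a y * G z y m * D z m n)
            = (\<Sum>m\<in>M. (\<Sum>y\<in>Y. B z a y * G z y m) * D z m n)"
          by (subst sum.swap) (simp add: sum_distrib_right)
        finally show ?thesis .
      qed
      ultimately show ?thesis by (simp add: h_def left_diff_distrib sum_subtractf)
    qed
    from Dzero[OF z this n] show ?thesis by (simp add: h_def)
  qed
  show thesis
  proof (rule that)
    fix z a assume z: "z \<in> X" and a: "a \<in> S"
    then have za: "(z, a) \<in> M" by (simp add: M_def)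
    have "\<phi> z a = (\<Sum>y\<in>Y. B z a y * T (Inl y) (Inl ()))
        + (\<Sum>j\<in>E. \<Sum>m\<in>M. \<beta> z j * R (z, a) m * T (Inr (j, m)) (Inl ()))"
      using T[OF za, of "Inl ()"] by (simp add: sumU u_def v_def V_def InlI)
    also have "(\<Sum>j\<in>E. \<Sum>m\<in>M. \<beta> z j * R (z, a) m * T (Inr (j, m)) (Inl ()))
        = (\<Sum>j\<in>E. \<Sum>m\<in>M. \<Sum>y\<in>Y. B z a y * (\<beta> z j * G z y m * T (Inr (j, m)) (Inl ())))"
      by (intro sum.cong refl) (simp add: RG[OF z a] sum_distrib_left sum_distrib_right mult_ac)
    also have "\<dots> = (\<Sum>y\<in>Y. B z a y * (\<Sum>j\<in>E. \<Sum>m\<in>M. \<beta> z j * G z y m * T (Inr (j, m)) (Inl ())))"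
      unfolding sum_distrib_left
      by (subst (2) sum.swap, subst sum.swap) (rule refl)
    finally show "\<phi> z a = (\<Sum>y\<in>Y. B z a y * \<Gamma> z y)"
      by (simp add: \<Gamma>_def distrib_left sum.distrib)
  next
    \<comment> \<open>\<open>T\<close> maps the row \<open>x p\<close> to (\<Gamma>, G), so
      contractivity of \<open>T\<close> makes \<open>N\<close> positive. Adding K (1 - F) G G*,
      which is positive since K (1 - F) has rank one, turns K N into the column kernel of
      \<Gamma>.\<close>
    define x where "x p = case_sum (\<lambda>y. if y = snd p then 1 else 0) (\<lambda>jm. \<beta> (fst p) (fst jm) * G (fst p) (snd p) (snd jm))"
      for p :: "'x \<times> 'y"
    have finXY: "finite (X \<times> Y)" using fin by simp
    have xx: "(\<Sum>i\<in>U. x p i * cnj (x q i)) = (if snd p = snd q then 1 else 0)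
        + F (fst p) (fst q) * (\<Sum>m\<in>M. G (fst p) (snd p) m * cnj (G (fst q) (snd q) m))"
      if "p \<in> X \<times> Y" "q \<in> X \<times> Y" for p q
    proof -
      have "(\<Sum>y\<in>Y. (if y = snd p then 1 else 0) * cnj (if y = snd q then 1 else 0)) = (if snd p = snd q then 1 else (0::complex))"
      proof -
        have "(\<Sum>y\<in>Y. (if y = snd p then 1 else 0) * cnj (if y = snd q then 1 else 0))
           = (\<Sum>y\<in>Y. if y = snd p then (if snd p = snd q then 1 else 0) else (0::complex))"
          by (intro sum.cong) auto
        then show ?thesis using that fin by auto
      qed
      moreover have "(\<Sum>j\<in>E. \<Sum>m\<in>M. \<beta> (fst p) j * G (fst p) (snd p) m * cnj (\<beta> (fst q) j * G (fst q) (snd q) m))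
          = F (fst p) (fst q) * (\<Sum>m\<in>M. G (fst p) (snd p) m * cnj (G (fst q) (snd q) m))"
        unfolding F_def sum_product by (simp add: mult_ac)
      ultimately show ?thesis by (simp add: sumU x_def)
    qed
    have delta: "(\<Sum>y\<in>Y. (if y = b then 1 else 0) * f y) = f b" if "b \<in> Y" for b and f :: "'y \<Rightarrow> complex"
    proof -
      have "(\<Sum>y\<in>Y. (if y = b then 1 else 0) * f y) = (\<Sum>y\<in>Y. if y = b then f y else 0)"
        by (intro sum.cong) auto
      then show ?thesis using that fin by simp
    qed
    have xT: "(\<Sum>i\<in>U. x p i * T i (Inl ())) = \<Gamma> (fst p) (snd p)"
        "m \<in> M \<Longrightarrow> (\<Sum>i\<in>U. x p i * T i (Inr m)) = G (fst p) (snd p) m" if "p \<in> X \<times> Y" for p m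
    proof -
      have p: "fst p \<in> X" "snd p \<in> Y" using that by auto
      show "(\<Sum>i\<in>U. x p i * T i (Inl ())) = \<Gamma> (fst p) (snd p)"
        by (simp add: sumU x_def \<Gamma>_def delta[OF p(2)])
      show "(\<Sum>i\<in>U. x p i * T i (Inr m)) = G (fst p) (snd p) m" if "m \<in> M"
        using G[OF p(1) that, of "snd p"] by (simp add: sumU x_def delta[OF p(2)] Dx)
    qed
    define N where "N p q = (if snd p = snd q then 1 else 0)
        + F (fst p) (fst q) * (\<Sum>m\<in>M. G (fst p) (snd p) m * cnj (G (fst q) (snd q) m))
        - (\<Gamma> (fst p) (snd p) * cnj (\<Gamma> (fst q) (snd q))
           + (\<Sum>m\<in>M. G (fst p) (snd p) m * cnj (G (fst q) (snd q) m)))" for p q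
    have "psd (X \<times> Y) N"
    proof (rule psd_cong[OF contraction_psd[OF finXY contr, of x]])
      fix p q assume p: "p \<in> X \<times> Y" and q: "q \<in> X \<times> Y"
      have "(\<Sum>r\<in>V. (\<Sum>i\<in>U. x p i * T i r) * cnj (\<Sum>i\<in>U. x q i * T i r))
          = \<Gamma> (fst p) (snd p) * cnj (\<Gamma> (fst q) (snd q))
            + (\<Sum>m\<in>M. G (fst p) (snd p) m * cnj (G (fst q) (snd q) m))"
        unfolding sumV xT(1)[OF p] xT(1)[OF q]
        by (intro arg_cong2[where f = "(+)"] refl sum.cong) (simp only: xT(2)[OF p] xT(2)[OF q])
      then show "(\<Sum>i\<in>U. x p i * cnj (x q i))
          - (\<Sum>r\<in>V. (\<Sum>i\<in>U. x p i * T i r) * cnj (\<Sum>i\<in>U. x q i * T i r)) = N p q"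
        by (simp only: xx[OF p q] N_def)
    qed
    moreover have "psd (X \<times> Y) (\<lambda>p q. K (fst p) (fst q))"
      by (rule psd_pullback[OF fin(1) K]) auto
    ultimately have "psd (X \<times> Y) (\<lambda>p q. K (fst p) (fst q) * N p q)"
      by (rule psd_schur_product[OF finXY, rotated])
    moreover have "psd (X \<times> Y) (\<lambda>p q. \<Sum>m\<in>M. s (fst p) * G (fst p) (snd p) m * cnj (s (fst q) * G (fst q) (snd q) m))"
      by (rule psd_gram[OF finM])
    ultimately have "psd (X \<times> Y) (\<lambda>p q. K (fst p) (fst q) * N p q
        + (\<Sum>m\<in>M. s (fst p) * G (fst p) (snd p) m * cnj (s (fst q) * G (fst q) (snd q) m)))"
      by (rule psd_add)
    then show "psd (X \<times> Y) (column_kernel K \<Gamma>)"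
    proof (rule psd_cong)
      fix p q assume "p \<in> X \<times> Y" "q \<in> X \<times> Y"
      then have "fst p \<in> X" "fst q \<in> X" by auto
      note k = pick[OF this, folded F_def]
      let ?g = "\<Sum>m\<in>M. G (fst p) (snd p) m * cnj (G (fst q) (snd q) m)"
      have "(\<Sum>m\<in>M. s (fst p) * G (fst p) (snd p) m * cnj (s (fst q) * G (fst q) (snd q) m))
          = s (fst p) * cnj (s (fst q)) * ?g"
        by (simp add: sum_distrib_left mult_ac)
      also have "\<dots> = K (fst p) (fst q) * (1 - F (fst p) (fst q)) * ?g" using k by simp
      finally show "K (fst p) (fst q) * N p q
        + (\<Sum>m\<in>M. s (fst p) * G (fst p) (snd p) m * cnj (s (fst q) * G (fst q) (snd q) m))
        = column_kernel K \<Gamma> p q"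
        by (simp add: N_def column_kernel_def algebra_simps)
    qed
  qed
qed

section \<open>Outer factors in complete Pick kernels\<close>

lemma psd_norm_le:
  assumes "psd S A" "finite S" "s \<in> S" "t \<in> S"
  shows "cmod (A s t) \<le> (Re (A s s) + Re (A t t)) / 2"
proof -
  \<comment> \<open>Rotates \<open>A s t\<close> onto the negative real axis. A zero entry gives
    \<open>k = 0\<close>, which is harmless.\<close>
  define k where "k = - cnj (sgn (A s t))"
  have k: "k * A s t = - of_real (cmod (A s t))"
  proof (cases "A s t = 0")
    case False
    have "k * A s t = - (A s t * cnj (A s t)) / of_real (cmod (A s t))"
      by (simp add: k_def sgn_eq)
    also have "\<dots> = - of_real (cmod (A s t))"
      using False by (subst complex_norm_square[symmetric]) (simp add: power2_eq_square)
    finally show ?thesis .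
  qed simp
  have "(cmod k)\<^sup>2 \<le> 1" by (simp add: k_def norm_sgn)
  let ?c = "\<lambda>u. if u = t then k else 0"
  have "(\<Sum>u\<in>S. A s u * ?c u) = A s t * k"
  proof -
    have "(\<Sum>u\<in>S. A s u * ?c u) = (\<Sum>u\<in>S. if u = t then A s t * k else 0)"
      by (intro sum.cong) auto
    then show ?thesis using assms by simp
  qed
  then have "Re (qf S A (\<lambda>u. ?c u + (if u = s then 1 else 0)))
      = Re (qf S A ?c) + 2 * Re (A s t * k) + Re (A s s)"
    using qf_shift[OF assms(1-3), of ?c 1] by simp
  moreover have "qf S A ?c = of_real ((cmod k)\<^sup>2) * A t t"
    unfolding qf_single[OF assms(2,4)] by (subst complex_norm_square) (simp add: mult_ac)
  moreover have "(cmod k)\<^sup>2 * Re (A t t) \<le> Re (A t t)"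
    using \<open>(cmod k)\<^sup>2 \<le> 1\<close> psd_diag(2)[OF assms(1,2,4)] by (simp add: mult_left_le_one_le)
  moreover have "Re (A s t * k) = - cmod (A s t)" using k by (simp add: mult.commute)
  ultimately show ?thesis
    using psd_nonneg[OF assms(1), of "\<lambda>u. ?c u + (if u = s then 1 else 0)"] by simp
qed

text \<open>If the form of \<open>L\<close> vanishes at \<open>g\<close>, Young's inequality for r c
  bounds a multiple of r by a multiple of r^2, so the pairing of \<open>c\<close> with
  \<open>g\<close> cannot be positive. With \<open>c\<close> equal to \<open>g s\<close> at
  \<open>s\<close> and zero elsewhere, that pairing is the squared modulus of
  \<open>g s\<close>.\<close>

lemma inverse_kernel_pd:
  assumes "finite S" "psd S A" "inverse_kernel S A L"
  shows "pd S L" "pd S A"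
proof -
  show "pd S L"
    unfolding pd_def
  proof (intro conjI allI impI ballI)
    show "psd S L" by (rule inverse_kernel_psd[OF assms(3)])
    fix g s assume g: "Re (qf S L g) = 0" and s: "s \<in> S"
    have "2 * r * Re (ipr S c g) \<le> r\<^sup>2 * Re (qf S A c)" for c and r :: real
    proof -
      have "2 * Re (ipr S (\<lambda>s. of_real r * c s) g) \<le> Re (qf S A (\<lambda>s. of_real r * c s)) + 0"
        using inverse_kernel_young[OF assms, of "\<lambda>s. of_real r * c s" g] g by simp
      moreover have "ipr S (\<lambda>s. of_real r * c s) g = of_real r * ipr S c g"
        by (simp add: ipr_def sum_distrib_left mult_ac)
      moreover have "qf S A (\<lambda>s. of_real r * c s) = of_real (r\<^sup>2) * qf S A c"
        by (simp add: qf_def sum_distrib_left mult_ac power2_eq_square)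
      ultimately show ?thesis by simp
    qed
    note * = this
    let ?c = "\<lambda>t. if t = s then g s else 0"
    have "ipr S ?c g = (\<Sum>t\<in>S. if t = s then cnj (g s) * g s else 0)"
      unfolding ipr_def by (intro sum.cong) auto
    also have "\<dots> = of_real ((cmod (g s))\<^sup>2)"
      using s assms(1) by (subst complex_norm_square) (simp add: mult.commute)
    finally have c: "Re (ipr S ?c g) = (cmod (g s))\<^sup>2" by simp
    define Q where "Q = Re (qf S A ?c)"
    have Q: "0 \<le> Q" unfolding Q_def by (rule psd_nonneg[OF assms(2)])
    have "2 * r * (cmod (g s))\<^sup>2 \<le> r\<^sup>2 * Q" for r
      using *[of r ?c] c by (simp add: Q_def)
    then have le: "2 * r * (cmod (g s))\<^sup>2 \<le> r * r * Q" for r by (simp add: power2_eq_square)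
    show "g s = 0"
    proof (rule ccontr)
      assume "g s \<noteq> 0"
      then have pos: "0 < (cmod (g s))\<^sup>2" by simp
      define r where "r = (cmod (g s))\<^sup>2 / (Q + 1)"
      have r: "0 < r" using pos Q by (simp add: r_def)
      then have "2 * (cmod (g s))\<^sup>2 \<le> r * Q" using le[of r] by (simp add: mult.assoc)
      also have "\<dots> \<le> (cmod (g s))\<^sup>2"
        using Q pos by (simp add: r_def field_simps)
      finally show False using pos by simp
    qed
  qed
  show "pd S A"
    unfolding pd_def
  proof (intro conjI allI impI ballI)
    show "psd S A" by fact
    fix c s assume c: "Re (qf S A c) = 0" and s: "s \<in> S"
    then have "Re (qf S L (ap S A c)) = 0"
      using qf_inverse_kernel(3)[OF assms] by simp
    then have "ap S A c t = 0" if "t \<in> S" for t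
      using pd_zero[OF \<open>pd S L\<close> _ that] by blast
    then have "ap S L (ap S A c) s = 0" by (simp add: ap_def)
    then show "c s = 0" using inverse_kernel_ap'[OF assms s] by simp
  qed
qed

text \<open>Entries vanishing at \<open>x\<close> can be divided by the row \<beta> while the
  column, including the untouched entries behind \<open>R\<close>, stays contractive. The reason is
  that K F is the Schur complement of \<open>K\<close> at \<open>x\<close>, the kernel for functions
  vanishing there, so Leech's theorem applies with \<open>B\<close> the identity on the entries of
  \<open>R\<close> and \<beta> on each entry of \<open>P\<close>. The last conclusion is in kernel
  form because that form restricts to fewer points.\<close>

lemma factor_through_pick_row:
  fixes K :: "'x \<Rightarrow> 'x \<Rightarrow> complex" and \<beta> :: "'x \<Rightarrow> 'e \<Rightarrow> complex"
  assumes fin: "finite X" "finite E" and x: "x \<in> X"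
    and K: "psd X K" and L: "inverse_kernel X K L"
    and pick: "\<And>z w. z \<in> X \<Longrightarrow> w \<in> X \<Longrightarrow> K z w * (1 - (\<Sum>j\<in>E. \<beta> z j * cnj (\<beta> w j))) = s z * cnj (s w)"
    and s0: "\<And>z. z \<in> X \<Longrightarrow> s z \<noteq> 0"
    and ball: "\<And>z. z \<in> X \<Longrightarrow> (\<Sum>j\<in>E. (cmod (\<beta> z j))\<^sup>2) < 1"
    and sx: "\<And>z w. z \<in> X \<Longrightarrow> w \<in> X \<Longrightarrow> K z x * K x w / K x x = s z * cnj (s w)"
    and Kxx: "0 < Re (K x x)"
    and R: "psd X R" and P: "psd X P" and Px: "P x x = 0"
    and col: "psd X (\<lambda>z w. L z w * (1 - (R w z + P w z)))"
  obtains q :: "'x \<Rightarrow> 'e \<Rightarrow> 'x \<Rightarrow> complex" where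
    "\<And>z w. z \<in> X \<Longrightarrow> w \<in> X \<Longrightarrow>
      P z w = (\<Sum>i\<in>X. (\<Sum>j\<in>E. \<beta> z j * q z j i) * cnj (\<Sum>j\<in>E. \<beta> w j * q w j i))"
    "psd X (\<lambda>z w. L z w * (1 - (R w z + (\<Sum>j\<in>E. \<Sum>i\<in>X. q w j i * cnj (q z j i)))))"
    "psd (X \<times> (E \<times> X)) (column_kernel K (\<lambda>z ji. q z (fst ji) (snd ji)))"
proof -
  define F where "F z w = (\<Sum>j\<in>E. \<beta> z j * cnj (\<beta> w j))" for z w
  obtain \<rho> where \<rho>: "\<And>z w. z \<in> X \<Longrightarrow> w \<in> X \<Longrightarrow> R z w = (\<Sum>m\<in>X. \<rho> z m * cnj (\<rho> w m))"
    using psd_imp_gram[OF fin(1) R] by blast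
  obtain p where p: "\<And>z w. z \<in> X \<Longrightarrow> w \<in> X \<Longrightarrow> P z w = (\<Sum>m\<in>X. p z m * cnj (p w m))"
    using psd_imp_gram[OF fin(1) P] by blast
  have px: "p x i = 0" if "i \<in> X" for i
  proof -
    have "complex_of_real (\<Sum>m\<in>X. (cmod (p x m))\<^sup>2) = 0"
      unfolding sum_cmod_square using p[OF x x] Px by simp
    then have "(\<Sum>m\<in>X. (cmod (p x m))\<^sup>2) = 0" by (simp only: of_real_eq_0_iff)
    then show ?thesis using that fin(1) by (subst (asm) sum_nonneg_eq_0_iff) auto
  qed
  define S :: "('x + 'x) set" where "S = X <+> X"
  define Y :: "('x + 'e \<times> 'x) set" where "Y = X <+> (E \<times> X)"
  define \<phi> where "\<phi> z = case_sum (\<rho> z) (p z)" for z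
  define B where "B z a y = (case a of
      Inl l \<Rightarrow> (case y of Inl l' \<Rightarrow> if l' = l then 1 else 0 | Inr ji \<Rightarrow> 0)
    | Inr i \<Rightarrow> (case y of Inl l' \<Rightarrow> 0 | Inr ji \<Rightarrow> if snd ji = i then \<beta> z (fst ji) else 0))"
    for z and a :: "'x + 'x" and y :: "'x + 'e \<times> 'x"
  have finS: "finite S" "finite Y" using fin by (simp_all add: S_def Y_def)
  have sumS: "(\<Sum>a\<in>S. f a) = (\<Sum>l\<in>X. f (Inl l)) + (\<Sum>i\<in>X. f (Inr i))" for f :: "_ \<Rightarrow> 'w :: comm_monoid_add"
    using fin by (simp add: S_def sum.Plus)
  have sumY: "(\<Sum>a\<in>Y. f a) = (\<Sum>l\<in>X. f (Inl l)) + (\<Sum>j\<in>E. \<Sum>i\<in>X. f (Inr (j, i)))" for f :: "_ \<Rightarrow> complex"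
    using fin by (simp add: Y_def sum.Plus sum.cartesian_product)
  have delta: "(\<Sum>l\<in>X. (if l = a then f l else 0)) = f a" if "a \<in> X" for a and f :: "'x \<Rightarrow> complex"
    using that fin by simp
  have colS: "psd (X \<times> S) (column_kernel K \<phi>)"
  proof (rule inverse_form_imp_column_kernel[OF fin(1) finS(1) K L])
    show "psd X (\<lambda>z w. L z w * (1 - (\<Sum>i\<in>S. \<phi> w i * cnj (\<phi> z i))))"
      by (rule psd_cong[OF col]) (simp add: sumS \<phi>_def \<rho> p)
  qed
  define A where "A a z w = (case a of Inl _ \<Rightarrow> K z w | Inr _ \<Rightarrow> K z w * F z w)" for a :: "'x + 'x" and z w
  have BB: "K z w * (\<Sum>y\<in>Y. B z a y * cnj (B w b y)) = (if a = b then A a z w else 0)"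
    if "a \<in> S" "b \<in> S" for z w a b
  proof (cases a; cases b)
    fix l l' assume ab: "a = Inl l" "b = Inl l'"
    then have "l \<in> X" using that by (auto simp: S_def)
    have "(\<Sum>k\<in>X. B z a (Inl k) * cnj (B w b (Inl k))) = (\<Sum>k\<in>X. if k = l then (if l = l' then 1 else 0) else 0)"
      by (intro sum.cong refl) (auto simp: ab B_def)
    then have "(\<Sum>y\<in>Y. B z a y * cnj (B w b y)) = (\<Sum>k\<in>X. if k = l then (if l = l' then 1 else 0) else 0)"
      unfolding sumY by (simp add: ab B_def)
    then show ?thesis using delta[OF \<open>l \<in> X\<close>, of "\<lambda>_. if l = l' then 1 else 0"] by (simp add: ab A_def)
  next
    fix i i' assume ab: "a = Inr i" "b = Inr i'"
    then have "i \<in> X" using that by (auto simp: S_def)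
    have "(\<Sum>j\<in>E. \<Sum>k\<in>X. B z a (Inr (j, k)) * cnj (B w b (Inr (j, k))))
        = (\<Sum>j\<in>E. \<Sum>k\<in>X. if k = i then (if i = i' then \<beta> z j * cnj (\<beta> w j) else 0) else 0)"
      by (intro sum.cong refl) (auto simp: ab B_def)
    moreover have "(\<Sum>k\<in>X. B z a (Inl k) * cnj (B w b (Inl k))) = 0"
      by (simp add: ab B_def)
    ultimately have "(\<Sum>y\<in>Y. B z a y * cnj (B w b y))
        = (\<Sum>j\<in>E. \<Sum>k\<in>X. if k = i then (if i = i' then \<beta> z j * cnj (\<beta> w j) else 0) else 0)"
      unfolding sumY by simp
    then show ?thesis
      unfolding delta[OF \<open>i \<in> X\<close>] by (auto simp: ab A_def F_def)
  qed (simp_all add: sumY B_def)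
  have "psd (X \<times> S) (\<lambda>p q. (if snd p = snd q then A (snd p) (fst p) (fst q) else 0)
        - K (fst p) (fst q) * (\<phi> (fst p) (snd p) * cnj (\<phi> (fst q) (snd q))))"
    (is "psd _ ?H")
  proof (rule psdI)
    fix p q assume "p \<in> X \<times> S" "q \<in> X \<times> S"
    then have k: "K (fst q) (fst p) = cnj (K (fst p) (fst q))" using psd_herm[OF K, of "fst p" "fst q"] by auto
    have f: "F (fst q) (fst p) = cnj (F (fst p) (fst q))" by (simp add: F_def cnj_sum mult.commute)
    have "A a (fst q) (fst p) = cnj (A a (fst p) (fst q))" for a
      using k f by (cases a) (simp_all add: A_def)
    from this[of "snd p"] show "?H q p = cnj (?H p q)" using k by (simp add: mult_ac)
  next
    fix c :: "'x \<times> ('x + 'x) \<Rightarrow> complex"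
    \<comment> \<open>The shift at \<open>x\<close> that minimises the form of \<open>K\<close>,
      taken from \<open>qf_schur\<close>. It does not affect the column part, because every
      \<open>p x i\<close> is zero.\<close>
    define \<mu> where "\<mu> i = - (\<Sum>t\<in>X. K x t * c (t, Inr i)) / K x x" for i
    define c' where "c' u = (case snd u of Inl _ \<Rightarrow> c u | Inr i \<Rightarrow> c u + (if fst u = x then \<mu> i else 0))"
      for u :: "'x \<times> ('x + 'x)"
    have same: "(\<Sum>i\<in>S. cnj (\<phi> z i) * c' (z, i)) = (\<Sum>i\<in>S. cnj (\<phi> z i) * c (z, i))" for z
      unfolding sumS by (auto simp: c'_def \<phi>_def px distrib_left intro!: sum.cong arg_cong2[where f = "(+)"])
    have "Re (qf X (A i) (\<lambda>z. c (z, i))) = Re (qf X K (\<lambda>z. c' (z, i)))" for i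
    proof (cases i)
      case (Inl l)
      then have "A i = K" by (simp add: A_def fun_eq_iff)
      then show ?thesis using Inl by (simp add: c'_def)
    next
      case (Inr l)
      have "qf X (A i) (\<lambda>z. c (z, i)) = qf X (\<lambda>z w. K z w - K z x * K x w / K x x) (\<lambda>z. c (z, i))"
      proof (rule qf_cong[OF _ refl])
        fix z w assume zw: "z \<in> X" "w \<in> X"
        have "K z w * (1 - F z w) = K z x * K x w / K x x"
          using pick[OF zw] sx[OF zw] by (simp add: F_def)
        then show "A i z w = K z w - K z x * K x w / K x x"
          by (simp add: Inr A_def algebra_simps)
      qed
      also have "Re \<dots> = Re (qf X K (\<lambda>z. c' (z, i)))"
        unfolding qf_schur[OF K fin(1) x Kxx] c'_def Inr \<mu>_def by simp
      finally show ?thesis .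
    qed
    then have "Re (qf (X \<times> S) ?H c) = Re (qf (X \<times> S) (column_kernel K \<phi>) c')"
      unfolding qf_diagonal_minus_column[OF fin(1) finS(1)] qf_column_kernel[OF fin(1) finS(1)] same
      by simp
    then show "0 \<le> Re (qf (X \<times> S) ?H c)" using psd_nonneg[OF colS] by simp
  qed
  then have hyp: "psd (X \<times> S) (\<lambda>p q. K (fst p) (fst q) *
        ((\<Sum>y\<in>Y. B (fst p) (snd p) y * cnj (B (fst q) (snd q) y)) - \<phi> (fst p) (snd p) * cnj (\<phi> (fst q) (snd q))))"
  proof (rule psd_cong)
    fix p q assume "p \<in> X \<times> S" "q \<in> X \<times> S"
    then have "snd p \<in> S" "snd q \<in> S" by auto
    from BB[OF this] show "?H p q = K (fst p) (fst q) *
        ((\<Sum>y\<in>Y. B (fst p) (snd p) y * cnj (B (fst q) (snd q) y)) - \<phi> (fst p) (snd p) * cnj (\<phi> (fst q) (snd q)))"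
      by (simp only: right_diff_distrib)
  qed
  obtain \<Gamma> where \<Gamma>: "\<And>z a. z \<in> X \<Longrightarrow> a \<in> S \<Longrightarrow> \<phi> z a = (\<Sum>y\<in>Y. B z a y * \<Gamma> z y)"
    and col\<Gamma>: "psd (X \<times> Y) (column_kernel K \<Gamma>)"
    using leech[OF fin finS K pick s0 ball hyp] by blast
  define q where "q z j i = \<Gamma> z (Inr (j, i))" for z j i
  show thesis
  proof (rule that[of q])
    have p_eq: "p z i = (\<Sum>j\<in>E. \<beta> z j * q z j i)" if "z \<in> X" "i \<in> X" for z i
    proof -
      have "p z i = \<phi> z (Inr i)" by (simp add: \<phi>_def)
      also have "\<dots> = (\<Sum>y\<in>Y. B z (Inr i) y * \<Gamma> z y)"
        using that by (intro \<Gamma>) (auto simp: S_def)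
      also have "\<dots> = (\<Sum>j\<in>E. \<Sum>k\<in>X. B z (Inr i) (Inr (j, k)) * \<Gamma> z (Inr (j, k)))"
        unfolding sumY by (simp add: B_def)
      also have "\<dots> = (\<Sum>j\<in>E. \<Sum>k\<in>X. if k = i then \<beta> z j * q z j i else 0)"
        by (intro sum.cong refl) (auto simp: B_def q_def)
      finally show ?thesis unfolding delta[OF that(2)] .
    qed
    show "P z w = (\<Sum>i\<in>X. (\<Sum>j\<in>E. \<beta> z j * q z j i) * cnj (\<Sum>j\<in>E. \<beta> w j * q w j i))"
      if "z \<in> X" "w \<in> X" for z w
      unfolding p[OF that] using p_eq that by (intro sum.cong refl) simp
    have \<rho>_eq: "\<rho> z l = \<Gamma> z (Inl l)" if "z \<in> X" "l \<in> X" for z l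
    proof -
      have "\<rho> z l = \<phi> z (Inl l)" by (simp add: \<phi>_def)
      also have "\<dots> = (\<Sum>y\<in>Y. B z (Inl l) y * \<Gamma> z y)"
        using that by (intro \<Gamma>) (auto simp: S_def)
      also have "\<dots> = (\<Sum>k\<in>X. B z (Inl l) (Inl k) * \<Gamma> z (Inl k))"
        unfolding sumY by (simp add: B_def)
      also have "\<dots> = (\<Sum>k\<in>X. if k = l then \<Gamma> z (Inl l) else 0)"
        by (intro sum.cong refl) (auto simp: B_def)
      finally show ?thesis unfolding delta[OF that(2)] .
    qed
    show "psd X (\<lambda>z w. L z w * (1 - (R w z + (\<Sum>j\<in>E. \<Sum>i\<in>X. q w j i * cnj (q z j i)))))"
      by (rule psd_cong[OF column_kernel_imp_inverse_form[OF fin(1) finS(2) K L col\<Gamma>]])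
        (simp add: sumY \<rho> \<rho>_eq q_def)
    have "psd (X \<times> (E \<times> X)) (\<lambda>u v. column_kernel K \<Gamma> (fst u, Inr (snd u)) (fst v, Inr (snd v)))"
      by (rule psd_pullback[OF _ col\<Gamma>]) (use fin finS in \<open>auto simp: Y_def\<close>)
    then show "psd (X \<times> (E \<times> X)) (column_kernel K (\<lambda>z ji. q z (fst ji) (snd ji)))"
      by (rule psd_cong) (simp add: column_kernel_def q_def)
  qed
qed

text \<open>The McCullough-Quiggin form of the Pick property. It is required at every base point,
  since the induction removes points and must be free to choose \<open>x\<close> among those
  left.\<close>

definition complete_pick :: "'x set \<Rightarrow> ('x \<Rightarrow> 'x \<Rightarrow> complex) \<Rightarrow> bool"
  where "complete_pick X K \<longleftrightarrow> (\<forall>z\<in>X. \<forall>w\<in>X. K z w \<noteq> 0) \<and>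
    (\<forall>x\<in>X. psd X (\<lambda>z w. 1 - K z x * K x w / (K x x * K z w)))"

lemma complete_pick_subset:
  assumes "complete_pick T K" "S \<subseteq> T" "finite T"
  shows "complete_pick S K"
  unfolding complete_pick_def
proof (intro conjI ballI)
  show "K z w \<noteq> 0" if "z \<in> S" "w \<in> S" for z w
    using assms(1,2) that unfolding complete_pick_def by blast
  show "psd S (\<lambda>z w. 1 - K z x * K x w / (K x x * K z w))" if "x \<in> S" for x
    by (rule psd_subset[OF _ assms(2,3)]) (use assms(1,2) that in \<open>auto simp: complete_pick_def\<close>)
qed

text \<open>Gram vectors of the matrix in \<open>complete_pick\<close> place the points in a ball
  with \<open>x\<close> at the origin; \<open>s\<close> is the column of \<open>K\<close> at
  \<open>x\<close>, normalised.\<close>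

lemma complete_pick_embedding:
  assumes fin: "finite X" and x: "x \<in> X" and K: "pd X K" and cp: "complete_pick X K"
  obtains s and \<beta> :: "'x \<Rightarrow> 'x \<Rightarrow> complex" where
    "\<And>z w. z \<in> X \<Longrightarrow> w \<in> X \<Longrightarrow> K z w * (1 - (\<Sum>j\<in>X. \<beta> z j * cnj (\<beta> w j))) = s z * cnj (s w)"
    "\<And>z. z \<in> X \<Longrightarrow> s z \<noteq> 0"
    "\<And>z. z \<in> X \<Longrightarrow> (\<Sum>j\<in>X. (cmod (\<beta> z j))\<^sup>2) < 1"
    "\<And>z w. z \<in> X \<Longrightarrow> w \<in> X \<Longrightarrow> K z x * K x w / K x x = s z * cnj (s w)"
    "\<And>j. j \<in> X \<Longrightarrow> \<beta> x j = 0"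
proof -
  have psdK: "psd X K" using K by (rule pd_psd)
  have nz: "K z w \<noteq> 0" if "z \<in> X" "w \<in> X" for z w
    using cp that by (auto simp: complete_pick_def)
  obtain \<beta> where \<beta>: "\<And>z w. z \<in> X \<Longrightarrow> w \<in> X \<Longrightarrow>
      1 - K z x * K x w / (K x x * K z w) = (\<Sum>j\<in>X. \<beta> z j * cnj (\<beta> w j))"
    using psd_imp_gram[OF fin] cp x unfolding complete_pick_def by blast
  define r where "r = Re (K x x)"
  have r: "K x x = of_real r" "0 < r"
    using psd_diag(1)[OF psdK fin x] pd_diag[OF K fin x] by (simp_all add: r_def)
  define s where "s z = K z x / of_real (sqrt r)" for z
  have ss: "K z x * K x w / K x x = s z * cnj (s w)" if "w \<in> X" for z w
  proof -
    have "complex_of_real r = of_real (sqrt r) * of_real (sqrt r)"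
      using r(2) by (metis of_real_mult real_sqrt_mult_self abs_of_pos)
    then show ?thesis using psd_herm[OF psdK x that] psd_herm[OF psdK that x] r
      by (simp add: s_def)
  qed
  have pick: "K z w * (1 - (\<Sum>j\<in>X. \<beta> z j * cnj (\<beta> w j))) = s z * cnj (s w)" if "z \<in> X" "w \<in> X" for z w
    using ss[OF that(2), of z] \<beta>[OF that, symmetric] nz[OF that] nz[OF x x] by simp
  have s0: "s z \<noteq> 0" if "z \<in> X" for z
    using nz[OF that x] r by (simp add: s_def)
  have ball: "(\<Sum>j\<in>X. (cmod (\<beta> z j))\<^sup>2) < 1" if z: "z \<in> X" for z
  proof -
    let ?b = "\<Sum>j\<in>X. (cmod (\<beta> z j))\<^sup>2"
    have "K z z * (1 - of_real ?b) = of_real ((cmod (s z))\<^sup>2)"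
      unfolding sum_cmod_square pick[OF z z] by (subst complex_norm_square) simp
    then have "complex_of_real (Re (K z z) * (1 - ?b)) = complex_of_real ((cmod (s z))\<^sup>2)"
      unfolding of_real_mult of_real_diff of_real_1 psd_diag(1)[OF psdK fin z, symmetric] .
    then have "Re (K z z) * (1 - ?b) = (cmod (s z))\<^sup>2" by (simp only: of_real_eq_iff)
    moreover have "0 < (cmod (s z))\<^sup>2" using s0[OF z] by simp
    ultimately have "0 < Re (K z z) * (1 - ?b)" by simp
    then show ?thesis using pd_diag[OF K fin z] by (simp add: zero_less_mult_iff)
  qed
  have bx: "\<beta> x j = 0" if "j \<in> X" for j
  proof -
    have "complex_of_real (\<Sum>j\<in>X. (cmod (\<beta> x j))\<^sup>2) = 0"
      unfolding sum_cmod_square \<beta>[OF x x, symmetric] using nz[OF x x] by simp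
    then have "(\<Sum>j\<in>X. (cmod (\<beta> x j))\<^sup>2) = 0" by (simp only: of_real_eq_0_iff)
    then show ?thesis using that fin by (subst (asm) sum_nonneg_eq_0_iff) auto
  qed
  show thesis by (rule that[of \<beta> s, OF pick s0 ball ss bx])
qed

text \<open>The second matrix is the Gram matrix of the vectors behind \<open>Q\<close> after the
  automorphism of the ball that sends the vector of \<open>x\<close> to the origin. It serves both
  to change the base point of a Pick kernel and to make a column vanish at \<open>x\<close>.\<close>

lemma psd_mobius:
  assumes fin: "finite X" and Q: "psd X Q" and ball: "\<And>z. z \<in> X \<Longrightarrow> Re (Q z z) < 1" and x: "x \<in> X"
  shows "\<And>z w. z \<in> X \<Longrightarrow> w \<in> X \<Longrightarrow> Q z w \<noteq> 1"
    and "psd X (\<lambda>z w. 1 - (1 - Q z w) * (1 - Q x x) / ((1 - Q z x) * (1 - Q x w)))"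
proof -
  show ne: "Q z w \<noteq> 1" if "z \<in> X" "w \<in> X" for z w
    using psd_norm_le[OF Q fin that] ball[OF that(1)] ball[OF that(2)] by auto
  obtain P where P: "\<And>s t. s \<in> X \<Longrightarrow> t \<in> X \<Longrightarrow> Q s t = (\<Sum>m\<in>X. P s m * cnj (P t m))"
    using psd_imp_gram[OF fin Q] by blast
  \<comment> \<open>\<open>Y\<close> is the Gram matrix of the differences of \<open>P z\<close> and
    \<open>P x\<close>, and \<open>y z\<close> is the pairing of such a difference with
    \<open>P x\<close>. Clearing denominators leaves (1 - Q z x) (1 - Q x w) - (1 - Q z w) (1 - Q x
    x), which equals (1 - Q x x) Y z w + y z cnj (y w).\<close>
  define Y where "Y z w = Q z w - Q z x - Q x w + Q x x" for z w
  define y where "y z = Q z x - Q x x" for z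
  have "psd X (\<lambda>z w. \<Sum>m\<in>X. (P z m - P x m) * cnj (P w m - P x m))"
    by (rule psd_gram[OF fin])
  then have "psd X Y"
    by (rule psd_cong) (simp add: Y_def P x algebra_simps sum.distrib sum_subtractf)
  then have "psd X (\<lambda>z w. of_real (1 - Re (Q x x)) * Y z w)"
    by (rule psd_scale) (use ball[OF x] in simp)
  then have N: "psd X (\<lambda>z w. of_real (1 - Re (Q x x)) * Y z w + y z * cnj (y w))"
    by (rule psd_add[OF _ psd_rank_one])
  have "psd X (\<lambda>z w. 1 / (1 - Q z x) * (of_real (1 - Re (Q x x)) * Y z w + y z * cnj (y w)) * cnj (1 / (1 - Q w x)))"
    by (rule psd_congruence[OF N])
  then show "psd X (\<lambda>z w. 1 - (1 - Q z w) * (1 - Q x x) / ((1 - Q z x) * (1 - Q x w)))"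
  proof (rule psd_cong)
    fix z w assume zw: "z \<in> X" "w \<in> X"
    have h: "cnj (Q w x) = Q x w" "cnj (Q x x) = Q x x"
      using psd_herm[OF Q zw(2) x] psd_herm[OF Q x x] by simp_all
    have q: "complex_of_real (Re (Q x x)) = Q x x" using psd_diag(1)[OF Q fin x] by simp
    have "of_real (1 - Re (Q x x)) * Y z w + y z * cnj (y w)
        = (1 - Q z x) * (1 - Q x w) - (1 - Q z w) * (1 - Q x x)"
      by (simp add: q h Y_def y_def algebra_simps)
    moreover have "cnj (1 / (1 - Q w x)) = 1 / (1 - Q x w)" by (simp add: h)
    moreover have "1 / a * (a * b - c) * (1 / b) = 1 - c / (a * b)" if "a \<noteq> 0" "b \<noteq> 0" for a b c :: complex
      using that by (simp add: field_simps)
    ultimately show "1 / (1 - Q z x) * (of_real (1 - Re (Q x x)) * Y z w + y z * cnj (y w)) * cnj (1 / (1 - Q w x))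
        = 1 - (1 - Q z w) * (1 - Q x x) / ((1 - Q z x) * (1 - Q x w))"
      using ne[OF zw(1) x] ne[OF x zw(2)] by simp
  qed
qed

section \<open>Compactness and outer factors of maximal trace\<close>

lemma closed_psd:
  fixes M :: "'p::topological_space \<Rightarrow> 'a \<Rightarrow> 'a \<Rightarrow> complex"
  assumes "\<And>s t. continuous_on UNIV (\<lambda>P. M P s t)"
  shows "closed {P. psd X (M P)}"
proof -
  have "closed {P. M P t s = cnj (M P s t)}" for s t
    by (intro closed_Collect_eq continuous_intros assms)
  moreover have "closed {P. 0 \<le> Re (qf X (M P) c)}" for c
    unfolding qf_def by (intro closed_Collect_le continuous_intros assms)
  ultimately have "closed ({P. \<forall>s. \<forall>t. s \<in> X \<longrightarrow> t \<in> X \<longrightarrow> M P t s = cnj (M P s t)} \<inter> {P. \<forall>c. 0 \<le> Re (qf X (M P) c)})"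
    by (intro closed_Int closed_Collect_all closed_Collect_imp) auto
  moreover have "{P. psd X (M P)} = {P. \<forall>s. \<forall>t. s \<in> X \<longrightarrow> t \<in> X \<longrightarrow> M P t s = cnj (M P s t)} \<inter> {P. \<forall>c. 0 \<le> Re (qf X (M P) c)}"
    unfolding psd_def by blast
  ultimately show ?thesis by simp
qed

lemma compact_functions:
  fixes B :: "'b::topological_space set"
  assumes "compact B"
  shows "compact {f :: 'a \<Rightarrow> 'b. \<forall>x. f x \<in> B}"
proof -
  have "compactin (product_topology (\<lambda>_::'a. euclidean) UNIV) (PiE UNIV (\<lambda>_. B))"
    using assms by (simp add: compactin_PiE)
  moreover have "PiE UNIV (\<lambda>_::'a. B) = {f. \<forall>x. f x \<in> B}" by auto
  ultimately show ?thesis by (simp add: euclidean_product_topology)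
qed

text \<open>The second conclusion says that multiplication by \<tau> dominates the column behind
  \<open>C\<close> in norm, so that this column is \<tau> times a contractive one wherever \<tau> is
  nonzero. A feasible \<open>P\<close> of maximal trace must have rank one: a summand vanishing at
  \<open>x\<close> could be divided by \<beta>, which respects both constraints and increases the
  trace because \<beta> has norm below one.\<close>

lemma outer_factor:
  fixes K :: "'x \<Rightarrow> 'x \<Rightarrow> complex"
  assumes fin: "finite X" and cp: "complete_pick X K" and K: "psd X K" and L: "inverse_kernel X K L"
    and R: "psd X R" and C: "psd X C"
    and col: "psd X (\<lambda>z w. L z w * (1 - (R w z + C w z)))"
  obtains \<tau> where "psd X (\<lambda>z w. L z w * (1 - (R w z + \<tau> w * cnj (\<tau> z))))"
    and "psd X (\<lambda>z w. L z w * (\<tau> w * cnj (\<tau> z) - C w z))"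
proof (cases "X = {}")
  case True
  have "psd X A" for A by (rule psdI) (simp_all add: True qf_def)
  then show ?thesis using that by blast
next
  case False
  note pdL = inverse_kernel_pd(1)[OF fin K L]
  note pdK = inverse_kernel_pd(2)[OF fin K L]
  \<comment> \<open>On \<open>X\<close> the bound 1 follows from the column constraint. Tychonoff's
    theorem needs it at all arguments, where \<open>psd X\<close> says nothing outside
    \<open>X\<close>; this is what \<open>trunc\<close> is for.\<close>
  define U where "U = {P :: 'x \<Rightarrow> 'x \<Rightarrow> complex. \<forall>z. P z \<in> {f. \<forall>w. f w \<in> cball 0 1}}"
  define \<P> where "\<P> = {P. psd X P} \<inter> {P. psd X (\<lambda>z w. L z w * (1 - (R w z + P w z)))}
      \<inter> {P. psd X (\<lambda>z w. L z w * (P w z - C w z))}"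
  have cont: "continuous_on UNIV (\<lambda>P :: 'x \<Rightarrow> 'x \<Rightarrow> complex. P z w)" for z w
    by (rule continuous_on_product_then_coordinatewise[OF continuous_on_product_coordinates])
  have "compact U" unfolding U_def by (intro compact_functions compact_cball)
  moreover have "closed \<P>" unfolding \<P>_def
    by (intro closed_Int closed_psd continuous_intros cont)
  ultimately have compact: "compact (U \<inter> \<P>)" by (rule compact_Int_closed)
  define trunc :: "('x \<Rightarrow> 'x \<Rightarrow> complex) \<Rightarrow> 'x \<Rightarrow> 'x \<Rightarrow> complex"
    where "trunc P z w = (if z \<in> X \<and> w \<in> X then P z w else 0)" for P z w
  have trunc: "trunc P \<in> U \<inter> \<P>" if P: "psd X P" "psd X (\<lambda>z w. L z w * (1 - (R w z + P w z)))"
      "psd X (\<lambda>z w. L z w * (P w z - C w z))" for P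
  proof
    have diag: "Re (P z z) \<le> 1" if z: "z \<in> X" for z
    proof -
      have "0 \<le> Re (L z z * (1 - (R z z + P z z)))" using psd_diag(2)[OF P(2) fin z] .
      moreover have "L z z = of_real (Re (L z z))"
        using psd_diag(1)[OF pd_psd[OF pdL] fin z] .
      then have "Im (L z z) = 0" by (metis Im_complex_of_real)
      ultimately have "0 \<le> Re (L z z) * (1 - (Re (R z z) + Re (P z z)))"
        by simp
      then show ?thesis
        using pd_diag[OF pdL fin z] psd_diag(2)[OF R fin z] by (simp add: zero_le_mult_iff)
    qed
    have "cmod (trunc P z w) \<le> 1" for z w
    proof (cases "z \<in> X \<and> w \<in> X")
      case True
      then show ?thesis using psd_norm_le[OF P(1) fin, of z w] diag[of z] diag[of w] by (simp add: trunc_def)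
    qed (auto simp: trunc_def)
    then show "trunc P \<in> U" by (simp add: U_def)
    show "trunc P \<in> \<P>" unfolding \<P>_def
      using psd_cong[OF P(1), of "trunc P"]
        psd_cong[OF P(2), of "\<lambda>z w. L z w * (1 - (R w z + trunc P w z))"]
        psd_cong[OF P(3), of "\<lambda>z w. L z w * (trunc P w z - C w z)"] by (simp add: trunc_def)
  qed
  define tr where "tr P = (\<Sum>z\<in>X. Re (P z z))" for P :: "'x \<Rightarrow> 'x \<Rightarrow> complex"
  have "trunc C \<in> U \<inter> \<P>"
    by (rule trunc[OF C col]) (simp add: psd_zero)
  moreover have "continuous_on (U \<inter> \<P>) tr"
    unfolding tr_def by (intro continuous_intros continuous_on_subset[OF cont]) auto
  ultimately obtain P where P\<P>: "P \<in> U \<inter> \<P>" and max: "\<And>P'. P' \<in> U \<inter> \<P> \<Longrightarrow> tr P' \<le> tr P"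
    using continuous_attains_sup[OF compact] by blast
  have P: "psd X P" "psd X (\<lambda>z w. L z w * (1 - (R w z + P w z)))"
      "psd X (\<lambda>z w. L z w * (P w z - C w z))"
    using P\<P> by (auto simp: \<P>_def)
  obtain x where x: "x \<in> X" using False by blast
  obtain p where P1: "psd X (\<lambda>z w. P z w - p z * cnj (p w))" and px: "\<And>z. z \<in> X \<Longrightarrow> P z x = p z * cnj (p x)"
    by (rule psd_split[OF P(1) fin x]) (rule that)
  define P1 where "P1 z w = P z w - p z * cnj (p w)" for z w
  obtain s and \<beta> :: "'x \<Rightarrow> 'x \<Rightarrow> complex" where
    pick: "\<And>z w. z \<in> X \<Longrightarrow> w \<in> X \<Longrightarrow> K z w * (1 - (\<Sum>j\<in>X. \<beta> z j * cnj (\<beta> w j))) = s z * cnj (s w)"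
    and s0: "\<And>z. z \<in> X \<Longrightarrow> s z \<noteq> 0"
    and ball: "\<And>z. z \<in> X \<Longrightarrow> (\<Sum>j\<in>X. (cmod (\<beta> z j))\<^sup>2) < 1"
    and sx: "\<And>z w. z \<in> X \<Longrightarrow> w \<in> X \<Longrightarrow> K z x * K x w / K x x = s z * cnj (s w)"
    and "\<And>j. j \<in> X \<Longrightarrow> \<beta> x j = 0"
    by (rule complete_pick_embedding[OF fin x pdK cp]) (rule that)
  have psdP1: "psd X P1" using P1 by (simp add: P1_def[abs_def])
  have colP1: "psd X (\<lambda>z w. L z w * (1 - ((R w z + p w * cnj (p z)) + P1 w z)))"
    by (rule psd_cong[OF P(2)]) (simp add: P1_def)
  have P1x: "P1 x x = 0" using px[OF x] by (simp add: P1_def)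
  obtain q :: "'x \<Rightarrow> 'x \<Rightarrow> 'x \<Rightarrow> complex" where
    q: "\<And>z w. z \<in> X \<Longrightarrow> w \<in> X \<Longrightarrow>
      P1 z w = (\<Sum>i\<in>X. (\<Sum>j\<in>X. \<beta> z j * q z j i) * cnj (\<Sum>j\<in>X. \<beta> w j * q w j i))"
    and colq: "psd X (\<lambda>z w. L z w * (1 - ((R w z + p w * cnj (p z)) + (\<Sum>j\<in>X. \<Sum>i\<in>X. q w j i * cnj (q z j i)))))"
    and "psd (X \<times> (X \<times> X)) (column_kernel K (\<lambda>z ji. q z (fst ji) (snd ji)))"
    by (rule factor_through_pick_row[OF fin fin x K L pick s0 ball sx pd_diag[OF pdK fin x] psd_add[OF R psd_rank_one[of X p]] psdP1 P1x colP1],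
        assumption+, rule that)
  define Q where "Q z w = (\<Sum>j\<in>X. \<Sum>i\<in>X. q z j i * cnj (q w j i))" for z w
  define P' where "P' z w = p z * cnj (p w) + Q z w" for z w
  have "psd X P'"
    unfolding P'_def Q_def by (intro psd_add psd_rank_one psd_sum fin)
  moreover have "psd X (\<lambda>z w. L z w * (1 - (R w z + P' w z)))"
    by (rule psd_cong[OF colq]) (simp add: P'_def Q_def add.assoc)
  \<comment> \<open>\<beta> is a contractive row, so replacing \<beta> q by q can only enlarge the
    norms, and domination of \<open>C\<close> is kept.\<close>
  moreover have "psd X (\<lambda>z w. L z w * (P' w z - C w z))"
  proof -
    have "psd X (\<lambda>z w. L z w * (Q w z - P1 w z))"
    proof (rule psdI)
      fix z w assume zw: "z \<in> X" "w \<in> X"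
      have "Q z w = cnj (Q w z)" by (simp add: Q_def cnj_sum mult.commute)
      then show "L w z * (Q z w - P1 z w) = cnj (L z w * (Q w z - P1 w z))"
        using psd_herm[OF inverse_kernel_psd[OF L] zw] psd_herm[OF psdP1 zw(2,1)] by simp
    next
      fix g
      define h where "h i j z = q z j i * g z" for i j z
      have 1: "qf X (\<lambda>z w. L z w * Q w z) g = (\<Sum>i\<in>X. \<Sum>j\<in>X. qf X L (h i j))"
      proof -
        have "qf X (\<lambda>z w. L z w * Q w z) g = (\<Sum>z\<in>X. \<Sum>w\<in>X. \<Sum>j\<in>X. \<Sum>i\<in>X. cnj (h i j z) * L z w * h i j w)"
          unfolding qf_def Q_def h_def sum_distrib_left sum_distrib_right
          by (intro sum.cong refl) (simp add: mult_ac)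
        also have "\<dots> = (\<Sum>z\<in>X. \<Sum>j\<in>X. \<Sum>i\<in>X. \<Sum>w\<in>X. cnj (h i j z) * L z w * h i j w)"
          by (rule sum.cong[OF refl], subst sum.swap, rule sum.cong[OF refl], rule sum.swap)
        also have "\<dots> = (\<Sum>j\<in>X. \<Sum>i\<in>X. qf X L (h i j))"
          unfolding qf_def by (subst sum.swap, rule sum.cong[OF refl], rule sum.swap)
        also have "\<dots> = (\<Sum>i\<in>X. \<Sum>j\<in>X. qf X L (h i j))" by (rule sum.swap)
        finally show ?thesis .
      qed
      have 2: "qf X (\<lambda>z w. L z w * P1 w z) g = (\<Sum>i\<in>X. qf X L (\<lambda>z. \<Sum>j\<in>X. \<beta> z j * h i j z))"
      proof -
        have "qf X (\<lambda>z w. L z w * P1 w z) g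
            = qf X (\<lambda>z w. L z w * (\<Sum>i\<in>X. (\<Sum>j\<in>X. \<beta> w j * q w j i) * cnj (\<Sum>j\<in>X. \<beta> z j * q z j i))) g"
          by (rule qf_cong) (simp_all add: q)
        also have "\<dots> = (\<Sum>i\<in>X. qf X L (\<lambda>z. (\<Sum>j\<in>X. \<beta> z j * q z j i) * g z))"
          using inverse_form_column[where X = X and I = X and L = L and g = g
              and \<phi> = "\<lambda>z i. \<Sum>j\<in>X. \<beta> z j * q z j i"]
          by (simp add: right_diff_distrib qf_diff)
        finally show ?thesis by (simp add: h_def sum_distrib_right mult.assoc)
      qed
      have row: "psd X (\<lambda>z w. K z w * (1 - (\<Sum>j\<in>X. \<beta> z j * cnj (\<beta> w j))))"
        by (rule psd_cong[OF psd_rank_one[of X s]]) (simp add: pick)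
      have "(\<Sum>i\<in>X. Re (qf X L (\<lambda>z. \<Sum>j\<in>X. \<beta> z j * h i j z))) \<le> (\<Sum>i\<in>X. \<Sum>j\<in>X. Re (qf X L (h i j)))"
        by (intro sum_mono row_imp_inverse_form[OF fin fin K L row])
      then show "0 \<le> Re (qf X (\<lambda>z w. L z w * (Q w z - P1 w z)) g)"
        by (simp add: right_diff_distrib qf_diff 1 2)
    qed
    from psd_add[OF this P(3)] show ?thesis
      by (rule psd_cong) (simp add: P'_def P1_def algebra_simps)
  qed
  ultimately have "tr (trunc P') \<le> tr P" by (intro max trunc)
  then have le: "(\<Sum>z\<in>X. Re (Q z z) - Re (P1 z z)) \<le> 0"
    by (simp add: tr_def trunc_def P'_def P1_def sum.distrib sum_subtractf)
  \<comment> \<open>Cauchy-Schwarz bounds the diagonal of \<open>P1\<close> by that of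
    \<open>Q\<close> times the squared norm of \<beta> z, which is below one. As maximality excludes
    any gain in trace, both diagonals must be zero.\<close>
  have QP: "(1 - (\<Sum>j\<in>X. (cmod (\<beta> z j))\<^sup>2)) * Re (Q z z) \<le> Re (Q z z) - Re (P1 z z)"
    and Q0: "0 \<le> Re (Q z z)" if z: "z \<in> X" for z
  proof -
    have Q: "Re (Q z z) = (\<Sum>i\<in>X. \<Sum>j\<in>X. (cmod (q z j i))\<^sup>2)"
    proof -
      have "Q z z = (\<Sum>j\<in>X. of_real (\<Sum>i\<in>X. (cmod (q z j i))\<^sup>2))"
        unfolding sum_cmod_square Q_def ..
      then show ?thesis by (subst sum.swap) simp
    qed
    then show "0 \<le> Re (Q z z)" by (simp add: sum_nonneg)
    have "Re (P1 z z) = (\<Sum>i\<in>X. (cmod (\<Sum>j\<in>X. \<beta> z j * q z j i))\<^sup>2)"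
      unfolding q[OF z z] sum_cmod_square[symmetric] by simp
    also have "\<dots> \<le> (\<Sum>i\<in>X. (\<Sum>j\<in>X. (cmod (\<beta> z j))\<^sup>2) * (\<Sum>j\<in>X. (cmod (q z j i))\<^sup>2))"
    proof (rule sum_mono)
      fix i
      have "cmod (\<Sum>j\<in>X. \<beta> z j * q z j i) \<le> (\<Sum>j\<in>X. cmod (\<beta> z j) * cmod (q z j i))"
        by (rule order_trans[OF norm_sum]) (simp add: norm_mult)
      then have "(cmod (\<Sum>j\<in>X. \<beta> z j * q z j i))\<^sup>2 \<le> (\<Sum>j\<in>X. cmod (\<beta> z j) * cmod (q z j i))\<^sup>2"
        by (rule power_mono) simp
      also have "\<dots> \<le> (\<Sum>j\<in>X. (cmod (\<beta> z j))\<^sup>2) * (\<Sum>j\<in>X. (cmod (q z j i))\<^sup>2)"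
        by (rule Cauchy_Schwarz_ineq_sum)
      finally show "(cmod (\<Sum>j\<in>X. \<beta> z j * q z j i))\<^sup>2
          \<le> (\<Sum>j\<in>X. (cmod (\<beta> z j))\<^sup>2) * (\<Sum>j\<in>X. (cmod (q z j i))\<^sup>2)" .
    qed
    finally show "(1 - (\<Sum>j\<in>X. (cmod (\<beta> z j))\<^sup>2)) * Re (Q z z) \<le> Re (Q z z) - Re (P1 z z)"
      by (simp add: Q sum_distrib_left[symmetric] algebra_simps)
  qed
  have P1z: "Re (P1 z z) = 0" if z: "z \<in> X" for z
  proof -
    have nn: "0 \<le> Re (Q z z) - Re (P1 z z)" if "z \<in> X" for z
      using QP[OF that] Q0[OF that] ball[OF that]
      by (meson diff_ge_0_iff_ge less_imp_le mult_nonneg_nonneg order_trans)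
    then have "(\<Sum>z\<in>X. Re (Q z z) - Re (P1 z z)) = 0"
      using le sum_nonneg[of X "\<lambda>z. Re (Q z z) - Re (P1 z z)"] by fastforce
    then have 0: "Re (Q z z) - Re (P1 z z) = 0"
      using sum_nonneg_eq_0_iff[OF fin, of "\<lambda>z. Re (Q z z) - Re (P1 z z)"] nn z by auto
    then have "(1 - (\<Sum>j\<in>X. (cmod (\<beta> z j))\<^sup>2)) * Re (Q z z) \<le> 0" using QP[OF z] by simp
    then have "Re (Q z z) \<le> 0" using ball[OF z] by (simp add: mult_le_0_iff)
    then show ?thesis using 0 Q0[OF z] by simp
  qed
  have Pp: "P z w = p z * cnj (p w)" if "z \<in> X" "w \<in> X" for z w
    using psd_zero_row[OF psdP1 fin that P1z[OF that(1)]] by (simp add: P1_def)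
  show thesis
  proof (rule that)
    show "psd X (\<lambda>z w. L z w * (1 - (R w z + p w * cnj (p z))))"
      by (rule psd_cong[OF P(2)]) (simp add: Pp)
    show "psd X (\<lambda>z w. L z w * (p w * cnj (p z) - C w z))"
      by (rule psd_cong[OF P(3)]) (simp add: Pp)
  qed
qed

text \<open>An outer factor already found is absorbed into \<open>R\<close>, so the induction has to
  range over all \<open>R\<close>.\<close>

lemma outer_factors:
  assumes fin: "finite X" and cp: "complete_pick X K" and K: "psd X K" and L: "inverse_kernel X K L"
    and J: "finite J" and R: "psd X R" and C: "\<And>j. j \<in> J \<Longrightarrow> psd X (C j)"
    and col: "psd X (\<lambda>z w. L z w * (1 - (R w z + (\<Sum>j\<in>J. C j w z))))"
  shows "\<exists>\<tau>. psd X (\<lambda>z w. L z w * (1 - (R w z + (\<Sum>j\<in>J. \<tau> j w * cnj (\<tau> j z)))))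
    \<and> (\<forall>j\<in>J. psd X (\<lambda>z w. L z w * (\<tau> j w * cnj (\<tau> j z) - C j w z)))"
  using J R C col
proof (induction J arbitrary: R rule: finite_induct)
  case empty
  then show ?case by auto
next
  case (insert i J)
  have RJ: "psd X (\<lambda>z w. R z w + (\<Sum>j\<in>J. C j z w))"
    using insert.hyps insert.prems by (intro psd_add psd_sum) auto
  have "psd X (\<lambda>z w. L z w * (1 - ((R w z + (\<Sum>j\<in>J. C j w z)) + C i w z)))"
    by (rule psd_cong[OF insert.prems(3)]) (use insert.hyps in \<open>simp add: add_ac\<close>)
  then obtain t where t: "psd X (\<lambda>z w. L z w * (1 - ((R w z + (\<Sum>j\<in>J. C j w z)) + t w * cnj (t z))))"
    and ti: "psd X (\<lambda>z w. L z w * (t w * cnj (t z) - C i w z))"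
    using outer_factor[OF fin cp K L RJ insert.prems(2)[of i]] by blast
  have "psd X (\<lambda>z w. R z w + t z * cnj (t w))"
    by (intro psd_add psd_rank_one insert.prems)
  moreover have "psd X (\<lambda>z w. L z w * (1 - ((R w z + t w * cnj (t z)) + (\<Sum>j\<in>J. C j w z))))"
    by (rule psd_cong[OF t]) (simp add: add_ac)
  ultimately obtain \<tau> where \<tau>: "psd X (\<lambda>z w. L z w * (1 - ((R w z + t w * cnj (t z)) + (\<Sum>j\<in>J. \<tau> j w * cnj (\<tau> j z)))))"
     "\<forall>j\<in>J. psd X (\<lambda>z w. L z w * (\<tau> j w * cnj (\<tau> j z) - C j w z))"
    using insert.IH[of "\<lambda>z w. R z w + t z * cnj (t w)"] insert.prems(2) by blast
  define \<tau>' where "\<tau>' j = (if j = i then t else \<tau> j)" for j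
  have "(\<Sum>j\<in>insert i J. \<tau>' j w * cnj (\<tau>' j z)) = t w * cnj (t z) + (\<Sum>j\<in>J. \<tau> j w * cnj (\<tau> j z))" for z w
  proof -
    have "(\<Sum>j\<in>J. \<tau>' j w * cnj (\<tau>' j z)) = (\<Sum>j\<in>J. \<tau> j w * cnj (\<tau> j z))"
      using insert.hyps by (intro sum.cong) (auto simp: \<tau>'_def)
    then show ?thesis using insert.hyps by (simp add: \<tau>'_def)
  qed
  then have "psd X (\<lambda>z w. L z w * (1 - (R w z + (\<Sum>j\<in>insert i J. \<tau>' j w * cnj (\<tau>' j z)))))"
    using \<tau>(1) by (simp only: add.assoc)
  moreover have "\<forall>j\<in>insert i J. psd X (\<lambda>z w. L z w * (\<tau>' j w * cnj (\<tau>' j z) - C j w z))"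
    using ti \<tau>(2) by (auto simp: \<tau>'_def)
  ultimately show ?case by blast
qed

section \<open>Columns and rows\<close>

lemma psd_limit:
  assumes K: "psd X K" and Q: "psd X Q"
    and r: "\<And>r. 0 < r \<Longrightarrow> r < 1 \<Longrightarrow> psd X (\<lambda>z w. K z w * (1 - of_real r * Q z w))"
  shows "psd X (\<lambda>z w. K z w * (1 - Q z w))"
proof (rule psdI)
  fix z w assume zw: "z \<in> X" "w \<in> X"
  show "K w z * (1 - Q w z) = cnj (K z w * (1 - Q z w))"
    using psd_herm[OF K zw] psd_herm[OF Q zw] by simp
next
  fix c
  define a where "a = Re (qf X K c)"
  define b where "b = Re (qf X (\<lambda>z w. K z w * Q z w) c)"
  have form: "qf X (\<lambda>z w. K z w * (1 - of_real r * Q z w)) c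
      = qf X K c - of_real r * qf X (\<lambda>z w. K z w * Q z w) c" for r
    unfolding qf_scale[symmetric] qf_diff[symmetric] by (rule qf_cong) (simp_all add: algebra_simps)
  have le: "r * b \<le> a" if "0 < r" "r < 1" for r
    using psd_nonneg[OF r[OF that], of c] unfolding form by (simp add: a_def b_def)
  have "0 \<le> a" unfolding a_def by (rule psd_nonneg[OF K])
  have "b \<le> a"
  proof (rule ccontr)
    assume "\<not> b \<le> a"
    \<comment> \<open>At this value of \<open>r\<close> the bound \<open>le\<close> reads (a + b) /
      2 \<le> a.\<close>
    then have "0 < (a + b) / (2 * b)" "(a + b) / (2 * b) < 1" "0 < b" using \<open>0 \<le> a\<close> by auto
    with le[of "(a + b) / (2 * b)"] \<open>\<not> b \<le> a\<close> show False by simp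
  qed
  then show "0 \<le> Re (qf X (\<lambda>z w. K z w * (1 - Q z w)) c)"
    using form[of 1] by (simp add: a_def b_def)
qed

lemma psd_block_congruence:
  assumes "finite X" "finite J" "psd (X \<times> J) H"
  shows "psd X (\<lambda>z w. \<Sum>j\<in>J. \<Sum>l\<in>J. W z j * H (z, j) (w, l) * cnj (W w l))"
proof -
  obtain P where P: "\<And>p q. p \<in> X \<times> J \<Longrightarrow> q \<in> X \<times> J \<Longrightarrow> H p q = (\<Sum>m\<in>X \<times> J. P p m * cnj (P q m))"
    using psd_imp_gram[OF _ assms(3)] assms(1,2) by blast
  have "psd X (\<lambda>z w. \<Sum>m\<in>X \<times> J. (\<Sum>j\<in>J. W z j * P (z, j) m) * cnj (\<Sum>j\<in>J. W w j * P (w, j) m))"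
    using assms by (intro psd_gram) auto
  then show ?thesis
  proof (rule psd_cong)
    fix z w assume zw: "z \<in> X" "w \<in> X"
    have "(\<Sum>m\<in>X \<times> J. (\<Sum>j\<in>J. W z j * P (z, j) m) * cnj (\<Sum>j\<in>J. W w j * P (w, j) m))
        = (\<Sum>m\<in>X \<times> J. \<Sum>j\<in>J. \<Sum>l\<in>J. W z j * (P (z, j) m * cnj (P (w, l) m)) * cnj (W w l))"
      by (intro sum.cong refl) (simp add: cnj_sum sum_product mult_ac)
    also have "\<dots> = (\<Sum>j\<in>J. \<Sum>l\<in>J. \<Sum>m\<in>X \<times> J. W z j * (P (z, j) m * cnj (P (w, l) m)) * cnj (W w l))"
      by (subst sum.swap, rule sum.cong[OF refl], rule sum.swap)
    also have "\<dots> = (\<Sum>j\<in>J. \<Sum>l\<in>J. W z j * H (z, j) (w, l) * cnj (W w l))"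
      using P zw by (intro sum.cong refl) (simp add: sum_distrib_left sum_distrib_right)
    finally show "(\<Sum>m\<in>X \<times> J. (\<Sum>j\<in>J. W z j * P (z, j) m) * cnj (\<Sum>j\<in>J. W w j * P (w, j) m))
      = (\<Sum>j\<in>J. \<Sum>l\<in>J. W z j * H (z, j) (w, l) * cnj (W w l))" .
  qed
qed

lemma psd_extend_by_zero:
  assumes "finite X" "psd (X - {x}) A" "\<And>z. z \<in> X \<Longrightarrow> A z x = 0" "\<And>z. z \<in> X \<Longrightarrow> A x z = 0"
  shows "psd X A"
proof (rule psdI)
  fix z w assume zw: "z \<in> X" "w \<in> X"
  show "A w z = cnj (A z w)"
  proof (cases "z = x \<or> w = x")
    case True
    then show ?thesis using assms(3,4) zw by auto
  next
    case False
    then show ?thesis using psd_herm[OF assms(2), of z w] zw by blast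
  qed
next
  fix c
  have "qf X A c = (\<Sum>s\<in>X - {x}. \<Sum>t\<in>X. cnj (c s) * A s t * c t)"
    unfolding qf_def using assms by (intro sum.mono_neutral_right) auto
  also have "\<dots> = qf (X - {x}) A c"
    unfolding qf_def using assms by (intro sum.cong refl sum.mono_neutral_right) auto
  finally show "0 \<le> Re (qf X A c)" using psd_nonneg[OF assms(2)] by simp
qed

lemma column_imp_row_step:
  fixes K :: "'x \<Rightarrow> 'x \<Rightarrow> complex"
  assumes fin: "finite X" and x: "x \<in> X" and cp: "complete_pick X K"
    and K: "psd X K" and L: "inverse_kernel X K L"
    and Q: "psd X Q" and Qx: "Q x x = 0" and col: "psd X (\<lambda>z w. L z w * (1 - Q w z))"
    and r: "0 < r" "r < 1"
    and IH: "\<And>L Q. inverse_kernel (X - {x}) K L \<Longrightarrow> psd (X - {x}) Q \<Longrightarrow>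
       psd (X - {x}) (\<lambda>z w. L z w * (1 - Q w z)) \<Longrightarrow> psd (X - {x}) (\<lambda>z w. K z w * (1 - Q z w))"
  shows "psd X (\<lambda>z w. K z w * (1 - of_real r * Q z w))"
proof -
  note pdK = inverse_kernel_pd(2)[OF fin K L]
  define X' where "X' = X - {x}"
  have X': "finite X'" "X' \<subseteq> X" using fin by (auto simp: X'_def)
  obtain s and \<beta> :: "'x \<Rightarrow> 'x \<Rightarrow> complex" where
    pick: "\<And>z w. z \<in> X \<Longrightarrow> w \<in> X \<Longrightarrow> K z w * (1 - (\<Sum>j\<in>X. \<beta> z j * cnj (\<beta> w j))) = s z * cnj (s w)"
    and s0: "\<And>z. z \<in> X \<Longrightarrow> s z \<noteq> 0"
    and ball: "\<And>z. z \<in> X \<Longrightarrow> (\<Sum>j\<in>X. (cmod (\<beta> z j))\<^sup>2) < 1"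
    and sx: "\<And>z w. z \<in> X \<Longrightarrow> w \<in> X \<Longrightarrow> K z x * K x w / K x x = s z * cnj (s w)"
    and bx: "\<And>j. j \<in> X \<Longrightarrow> \<beta> x j = 0"
    by (rule complete_pick_embedding[OF fin x pdK cp]) (rule that)
  define F where "F z w = (\<Sum>j\<in>X. \<beta> z j * cnj (\<beta> w j))" for z w
  have col0: "psd X (\<lambda>z w. L z w * (1 - (0 + Q w z)))" using col by simp
  obtain q :: "'x \<Rightarrow> 'x \<Rightarrow> 'x \<Rightarrow> complex" where
    q: "\<And>z w. z \<in> X \<Longrightarrow> w \<in> X \<Longrightarrow>
      Q z w = (\<Sum>i\<in>X. (\<Sum>j\<in>X. \<beta> z j * q z j i) * cnj (\<Sum>j\<in>X. \<beta> w j * q w j i))"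
    and "psd X (\<lambda>z w. L z w * (1 - (0 + (\<Sum>j\<in>X. \<Sum>i\<in>X. q w j i * cnj (q z j i)))))"
    and colq: "psd (X \<times> (X \<times> X)) (column_kernel K (\<lambda>z ji. q z (fst ji) (snd ji)))"
    by (rule factor_through_pick_row[OF fin fin x K L pick s0 ball sx pd_diag[OF pdK fin x] psd_zero Q Qx col0],
        assumption+, rule that)
  have K': "psd X' K" using psd_subset[OF K X'(2) fin] .
  obtain L' where L': "inverse_kernel X' K L'"
    using inverse_kernel_exists[OF X'(1) pd_subset[OF pdK X'(2) fin]] by blast
  note pdL' = inverse_kernel_pd(1)[OF X'(1) K' L']
  have cp': "complete_pick X' K" by (rule complete_pick_subset[OF cp X'(2) fin])
  \<comment> \<open>The inverse of the restricted kernel is not the restriction of \<open>L\<close>,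
    so the bound passes to \<open>X'\<close> through \<open>column_kernel\<close>.\<close>
  have colq': "psd X' (\<lambda>z w. L' z w * (1 - (\<Sum>ji\<in>X \<times> X. q w (fst ji) (snd ji) * cnj (q z (fst ji) (snd ji)))))"
  proof (rule column_kernel_imp_inverse_form[OF X'(1) _ K' L'])
    show "psd (X' \<times> (X \<times> X)) (column_kernel K (\<lambda>z ji. q z (fst ji) (snd ji)))"
      by (rule psd_subset[OF colq]) (use fin X' in auto)
  qed (use fin in simp)
  define C where "C j z w = (\<Sum>i\<in>X. q z j i * cnj (q w j i))" for j z w
  define N where "N = real (card X)"
  have N: "0 < N" using fin x by (auto simp: N_def card_gt_0_iff)
  define \<epsilon> where "\<epsilon> = (1 - r) / N"
  have \<epsilon>: "0 < \<epsilon>" using r N by (simp add: \<epsilon>_def)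
  text \<open>The constant \<open>\<epsilon>\<close> keeps the outer factors below away from zero.\<close>
  define D where "D j z w = of_real r * C j z w + of_real \<epsilon> * (1 * cnj 1)" for j z w
  have psdC: "psd X' (C j)" for j unfolding C_def by (rule psd_gram[OF fin])
  have psdD: "psd X' (D j)" for j
    unfolding D_def using r \<epsilon> by (intro psd_add psd_scale psdC psd_rank_one) simp_all
  \<comment> \<open>Summed over the \<open>card X\<close> indices, the shifts by \<epsilon> add up
    to \<open>1 - r\<close>, exactly the room gained from the factor \<open>r\<close>.\<close>
  have colD: "psd X' (\<lambda>z w. L' z w * (1 - (0 + (\<Sum>j\<in>X. D j w z))))"
  proof -
    have "psd X' (\<lambda>z w. of_real r * (L' z w * (1 - (\<Sum>ji\<in>X \<times> X. q w (fst ji) (snd ji) * cnj (q z (fst ji) (snd ji))))))"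
      using r by (intro psd_scale colq') simp
    then show ?thesis
    proof (rule psd_cong)
      fix z w
      have "(\<Sum>ji\<in>X \<times> X. q w (fst ji) (snd ji) * cnj (q z (fst ji) (snd ji))) = (\<Sum>j\<in>X. C j w z)"
        by (simp add: C_def sum.cartesian_product split_def)
      moreover have "(\<Sum>j\<in>X. D j w z) = of_real r * (\<Sum>j\<in>X. C j w z) + of_real (1 - r)"
      proof -
        have "(\<Sum>j\<in>X. D j w z) = of_real r * (\<Sum>j\<in>X. C j w z) + of_real (N * \<epsilon>)"
          by (simp add: D_def sum.distrib sum_distrib_left N_def)
        then show ?thesis using N by (simp add: \<epsilon>_def)
      qed
      ultimately show "of_real r * (L' z w * (1 - (\<Sum>ji\<in>X \<times> X. q w (fst ji) (snd ji) * cnj (q z (fst ji) (snd ji)))))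
          = L' z w * (1 - (0 + (\<Sum>j\<in>X. D j w z)))"
        by (simp only:) (simp add: algebra_simps)
    qed
  qed
  obtain \<tau> where \<tau>: "psd X' (\<lambda>z w. L' z w * (1 - (0 + (\<Sum>j\<in>X. \<tau> j w * cnj (\<tau> j z)))))"
    and dom: "\<forall>j\<in>X. psd X' (\<lambda>z w. L' z w * (\<tau> j w * cnj (\<tau> j z) - D j w z))"
    using outer_factors[OF X'(1) cp' K' L' fin psd_zero psdD colD] by blast
  have \<tau>0: "\<tau> j z \<noteq> 0" if j: "j \<in> X" and z: "z \<in> X'" for j z
  proof
    assume "\<tau> j z = 0"
    then have "0 \<le> Re (L' z z * (- D j z z))"
      using psd_diag(2)[OF bspec[OF dom j] X'(1) z] by simp
    moreover have "Im (L' z z) = 0"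
      using psd_diag(1)[OF pd_psd[OF pdL'] X'(1) z] by (metis Im_complex_of_real)
    ultimately have "Re (L' z z) * Re (D j z z) \<le> 0" by simp
    moreover have "0 < Re (D j z z)"
      using psd_diag(2)[OF psdC X'(1) z, of j] r \<epsilon> by (simp add: D_def add_nonneg_pos)
    ultimately show False using pd_diag[OF pdL' X'(1) z] by (simp add: mult_le_0_iff)
  qed
  \<comment> \<open>The Gram kernel of the entries behind \<open>D j\<close> divided by their outer
    factor. Domination by \<tau> j makes it the kernel of a contractive column, which the induction
    hypothesis turns into a contractive row.\<close>
  define \<eta> where "\<eta> j z w = D j z w / (\<tau> j z * cnj (\<tau> j w))" for j z w
  have row\<eta>: "psd X' (\<lambda>z w. K z w * (1 - \<eta> j z w))" if j: "j \<in> X" for j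
  proof (rule IH[folded X'_def, OF L'])
    show "psd X' (\<eta> j)"
      by (rule psd_cong[OF psd_congruence[OF psdD[of j], of "\<lambda>z. 1 / \<tau> j z"]]) (simp add: \<eta>_def)
    show "psd X' (\<lambda>z w. L' z w * (1 - \<eta> j w z))"
    proof (rule psd_cong[OF psd_congruence[OF bspec[OF dom j], of "\<lambda>z. 1 / cnj (\<tau> j z)"]])
      fix z w assume "z \<in> X'" "w \<in> X'"
      then show "1 / cnj (\<tau> j z) * (L' z w * (\<tau> j w * cnj (\<tau> j z) - D j w z)) * cnj (1 / cnj (\<tau> j w))
          = L' z w * (1 - \<eta> j w z)"
        using \<tau>0[OF j] by (simp add: \<eta>_def field_simps)
    qed
  qed
  have col\<tau>: "psd (X' \<times> X) (column_kernel K (\<lambda>z j. \<tau> j z))"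
    by (rule inverse_form_imp_column_kernel[OF X'(1) fin K' L']) (use \<tau> in simp)
  define W where "W i z j = of_real (sqrt r) * \<beta> z j * q z j i / \<tau> j z" for i z j
  \<comment> \<open>\<open>T1\<close> equals K F minus K times the sum of the terms \<beta> j \<eta>
    j \<beta> j*. The diagonal part of \<open>T2\<close> restores the share of \<open>r C j\<close>
    in that sum, and \<open>T3\<close> restores the share of \<epsilon>. The remaining part of
    \<open>T2\<close> is - r K Q, since summing \<open>W i\<close> against \<tau> gives back sqrt r
    times the entries of the column behind \<open>Q\<close>.\<close>
  define T1 where "T1 z w = (\<Sum>j\<in>X. \<beta> z j * (K z w * (1 - \<eta> j z w)) * cnj (\<beta> w j))" for z w
  define T2 where "T2 z w = (\<Sum>i\<in>X. \<Sum>j\<in>X. \<Sum>l\<in>X. W i z j * column_kernel K (\<lambda>z j. \<tau> j z) (z, j) (w, l) * cnj (W i w l))" for z w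
  define T3 where "T3 z w = (\<Sum>j\<in>X. of_real \<epsilon> * (\<beta> z j / \<tau> j z * K z w * cnj (\<beta> w j / \<tau> j w)))" for z w
  have "psd X' (\<lambda>z w. T1 z w + T2 z w + T3 z w)"
    unfolding T1_def T2_def T3_def
    by (intro psd_add psd_sum fin psd_congruence psd_block_congruence psd_scale row\<eta> col\<tau> X' K')
      (use \<epsilon> in auto)
  moreover have "T1 z w + T2 z w + T3 z w = K z w * (F z w - of_real r * Q z w)"
    if zw: "z \<in> X'" "w \<in> X'" for z w
  proof -
    define k where "k = K z w"
    define b where "b j = \<beta> z j * cnj (\<beta> w j)" for j
    define t where "t j = \<tau> j z * cnj (\<tau> j w)" for j
    have t0: "t j \<noteq> 0" if "j \<in> X" for j using \<tau>0[OF that] zw by (simp add: t_def)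
    have rr: "complex_of_real (sqrt r) * complex_of_real (sqrt r) = of_real r"
      using r by (metis of_real_mult real_sqrt_mult_self abs_of_pos)
    have T1: "T1 z w = (\<Sum>j\<in>X. k * b j) - (\<Sum>j\<in>X. k * b j * D j z w / t j)"
      unfolding T1_def sum_subtractf[symmetric]
      by (intro sum.cong refl) (simp add: \<eta>_def k_def b_def t_def algebra_simps)
    have T3: "T3 z w = (\<Sum>j\<in>X. k * b j * of_real \<epsilon> / t j)"
      unfolding T3_def by (intro sum.cong refl) (simp add: k_def b_def t_def field_simps)
    have "T2 z w = (\<Sum>i\<in>X. (\<Sum>j\<in>X. W i z j * k * cnj (W i w j))
        - k * ((\<Sum>j\<in>X. W i z j * \<tau> j z) * cnj (\<Sum>l\<in>X. W i w l * \<tau> l w)))"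
      unfolding T2_def
    proof (rule sum.cong[OF refl])
      fix i
      have "(\<Sum>l\<in>X. W i z j * column_kernel K (\<lambda>z j. \<tau> j z) (z, j) (w, l) * cnj (W i w l))
          = W i z j * k * cnj (W i w j) - (\<Sum>l\<in>X. k * ((W i z j * \<tau> j z) * cnj (W i w l * \<tau> l w)))"
        if "j \<in> X" for j
      proof -
        have "(\<Sum>l\<in>X. W i z j * column_kernel K (\<lambda>z j. \<tau> j z) (z, j) (w, l) * cnj (W i w l))
          = (\<Sum>l\<in>X. (if l = j then W i z j * k * cnj (W i w j) else 0)
              - k * ((W i z j * \<tau> j z) * cnj (W i w l * \<tau> l w)))"
          by (intro sum.cong refl) (auto simp: column_kernel_def k_def algebra_simps)
        then show ?thesis using that fin by (simp add: sum_subtractf)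
      qed
      then have "(\<Sum>j\<in>X. \<Sum>l\<in>X. W i z j * column_kernel K (\<lambda>z j. \<tau> j z) (z, j) (w, l) * cnj (W i w l))
        = (\<Sum>j\<in>X. W i z j * k * cnj (W i w j)) - (\<Sum>j\<in>X. \<Sum>l\<in>X. k * ((W i z j * \<tau> j z) * cnj (W i w l * \<tau> l w)))"
        by (simp add: sum_subtractf)
      then show "(\<Sum>j\<in>X. \<Sum>l\<in>X. W i z j * column_kernel K (\<lambda>z j. \<tau> j z) (z, j) (w, l) * cnj (W i w l))
        = (\<Sum>j\<in>X. W i z j * k * cnj (W i w j)) - k * ((\<Sum>j\<in>X. W i z j * \<tau> j z) * cnj (\<Sum>l\<in>X. W i w l * \<tau> l w))"
        by (simp only: cnj_sum sum_product sum_distrib_left[symmetric])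
    qed
    also have "\<dots> = (\<Sum>i\<in>X. \<Sum>j\<in>X. W i z j * k * cnj (W i w j))
        - k * (\<Sum>i\<in>X. (\<Sum>j\<in>X. W i z j * \<tau> j z) * cnj (\<Sum>l\<in>X. W i w l * \<tau> l w))"
      by (simp add: sum_subtractf sum_distrib_left)
    also have "(\<Sum>i\<in>X. \<Sum>j\<in>X. W i z j * k * cnj (W i w j)) = (\<Sum>j\<in>X. k * b j * (of_real r * C j z w) / t j)"
    proof -
      have "W i z j * k * cnj (W i w j) = k * b j / t j * of_real r * (q z j i * cnj (q w j i))" for i j
        by (simp add: W_def b_def t_def rr[symmetric])
      then show ?thesis
        by (subst sum.swap) (simp add: C_def sum_distrib_left sum_divide_distrib mult.assoc)
    qed
    also have "(\<Sum>i\<in>X. (\<Sum>j\<in>X. W i z j * \<tau> j z) * cnj (\<Sum>l\<in>X. W i w l * \<tau> l w)) = of_real r * Q z w"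
    proof -
      have "(\<Sum>j\<in>X. W i u j * \<tau> j u) = of_real (sqrt r) * (\<Sum>j\<in>X. \<beta> u j * q u j i)" if "u \<in> X'" for i u
        unfolding sum_distrib_left using \<tau>0 that by (intro sum.cong refl) (simp add: W_def)
      moreover have "z \<in> X" "w \<in> X" using zw X' by auto
      ultimately show ?thesis
        using zw by (simp add: q sum_distrib_left rr[symmetric] mult_ac)
    qed
    finally have T2: "T2 z w = (\<Sum>j\<in>X. k * b j * (of_real r * C j z w) / t j) - k * (of_real r * Q z w)" .
    have "(\<Sum>j\<in>X. k * b j * D j z w / t j)
        = (\<Sum>j\<in>X. k * b j * (of_real r * C j z w) / t j) + (\<Sum>j\<in>X. k * b j * of_real \<epsilon> / t j)"
      unfolding sum.distrib[symmetric]
      by (intro sum.cong refl) (simp add: D_def distrib_left add_divide_distrib)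
    moreover have "(\<Sum>j\<in>X. k * b j) = k * F z w" by (simp add: F_def b_def sum_distrib_left)
    ultimately show ?thesis
      by (simp add: T1 T2 T3 k_def algebra_simps)
  qed
  ultimately have "psd X' (\<lambda>z w. K z w * (F z w - of_real r * Q z w))"
    by (rule psd_cong)
  \<comment> \<open>\<open>F\<close> vanishes in the row and column of \<open>x\<close> because
    \<beta> x is zero there, and \<open>Q\<close> does because \<open>Q x x = 0\<close>.\<close>
  then have "psd X (\<lambda>z w. K z w * (F z w - of_real r * Q z w))"
    unfolding X'_def
  proof (rule psd_extend_by_zero[OF fin])
    have Q0: "Q x z = 0" if "z \<in> X" for z
      using psd_zero_row[OF Q fin x that] Qx by simp
    then have "Q z x = 0" if "z \<in> X" for z using psd_herm[OF Q x that] that by simp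
    then show "K z x * (F z x - of_real r * Q z x) = 0" "K x z * (F x z - of_real r * Q x z) = 0"
      if "z \<in> X" for z using that Q0 bx by (simp_all add: F_def)
  qed
  from psd_add[OF psd_rank_one[of X s] this] show ?thesis
  proof (rule psd_cong)
    fix z w assume "z \<in> X" "w \<in> X"
    from pick[OF this, symmetric] show "s z * cnj (s w) + K z w * (F z w - of_real r * Q z w)
        = K z w * (1 - of_real r * Q z w)"
      by (simp add: F_def algebra_simps)
  qed
qed

lemma column_imp_row:
  fixes K :: "'x \<Rightarrow> 'x \<Rightarrow> complex"
  assumes "finite X" "complete_pick X K" "psd X K" "inverse_kernel X K L" "psd X Q"
    and "psd X (\<lambda>z w. L z w * (1 - Q w z))"
  shows "psd X (\<lambda>z w. K z w * (1 - Q z w))"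
  using assms
proof (induction X arbitrary: L Q rule: finite_psubset_induct)
  case (psubset X)
  note fin = psubset.hyps and cp = psubset.prems(1) and K = psubset.prems(2) and L = psubset.prems(3)
    and Q = psubset.prems(4) and col = psubset.prems(5)
  show ?case
  proof (cases "X = {}")
    case True
    show ?thesis by (rule psdI) (simp_all add: True qf_def)
  next
    case False
    then obtain x where x: "x \<in> X" by blast
    note pdL = inverse_kernel_pd(1)[OF fin K L]
    have sub: "X - {x} \<subset> X" using x by auto
    have IH: "psd (X - {x}) (\<lambda>z w. K z w * (1 - Q z w))"
      if "inverse_kernel (X - {x}) K L" "psd (X - {x}) Q" "psd (X - {x}) (\<lambda>z w. L z w * (1 - Q w z))" for L Q
      using psubset.IH[OF sub complete_pick_subset[OF cp _ fin] psd_subset[OF K _ fin] that] by blast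
    have diag: "Re (Q z z) \<le> 1" if z: "z \<in> X" for z
    proof -
      have "0 \<le> Re (L z z * (1 - Q z z))" using psd_diag(2)[OF col fin z] .
      moreover have "Im (L z z) = 0"
        using psd_diag(1)[OF pd_psd[OF pdL] fin z] by (metis Im_complex_of_real)
      ultimately have "0 \<le> Re (L z z) * (1 - Re (Q z z))" by simp
      then show ?thesis using pd_diag[OF pdL fin z] by (simp add: zero_le_mult_iff)
    qed
    show ?thesis
    proof (rule psd_limit[OF K Q])
      fix r :: real assume r: "0 < r" "r < 1"
      \<comment> \<open>The factor \<open>r\<close> pushes the diagonal strictly below one, as the
        Moebius map requires.\<close>
      define Q1 where "Q1 z w = of_real r * Q z w" for z w
      have psdQ1: "psd X Q1" unfolding Q1_def using r by (intro psd_scale Q) simp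
      have ball: "Re (Q1 z z) < 1" if "z \<in> X" for z
      proof -
        have "r * Re (Q z z) \<le> r * 1" using r diag[OF that] by (intro mult_left_mono) auto
        then have "r * Re (Q z z) < 1" using r by linarith
        then show ?thesis by (simp add: Q1_def)
      qed
      define Q2 where "Q2 z w = 1 - (1 - Q1 z w) * (1 - Q1 x x) / ((1 - Q1 z x) * (1 - Q1 x w))" for z w
      have ne: "Q1 z w \<noteq> 1" if "z \<in> X" "w \<in> X" for z w
        using psd_mobius(1)[OF fin psdQ1 ball x that] .
      have psdQ2: "psd X Q2"
        using psd_mobius(2)[OF fin psdQ1 ball x] unfolding Q2_def .
      have "Q2 x x = 0" using ne[OF x x] by (simp add: Q2_def)
      define d where "d = 1 - Re (Q1 x x)"
      have d: "0 < d" "1 - Q1 x x = of_real d"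
        using ball[OF x] psd_diag(1)[OF psdQ1 fin x] by (simp_all add: d_def)
      have sd: "complex_of_real (sqrt d) * of_real (sqrt d) = of_real d"
        using d(1) by (metis of_real_mult real_sqrt_mult_self abs_of_pos)
      have h: "cnj (Q1 x z) = Q1 z x" "cnj (Q1 z x) = Q1 x z" if "z \<in> X" for z
        using psd_herm[OF psdQ1 x that] by simp_all
      have "psd X (\<lambda>z w. of_real r * (L z w * (1 - Q w z)) + of_real (1 - r) * L z w)"
        using r by (intro psd_add psd_scale col inverse_kernel_psd[OF L]) simp_all
      then have col1: "psd X (\<lambda>z w. L z w * (1 - Q1 w z))"
        by (rule psd_cong) (simp add: Q1_def algebra_simps)
      \<comment> \<open>1 - Q2 arises from 1 - Q1 by a diagonal congruence, so the Moebius map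
        preserves contractivity of columns; the inverse congruence brings the row result back
        below.\<close>
      have col2: "psd X (\<lambda>z w. L z w * (1 - Q2 w z))"
      proof (rule psd_cong[OF psd_congruence[OF col1, of "\<lambda>z. of_real (sqrt d) / (1 - Q1 x z)"]])
        fix z w assume zw: "z \<in> X" "w \<in> X"
        have "cnj (of_real (sqrt d) / (1 - Q1 x w)) = of_real (sqrt d) / (1 - Q1 w x)"
          using h[OF zw(2)] by simp
        then have "of_real (sqrt d) / (1 - Q1 x z) * (L z w * (1 - Q1 w z)) * cnj (of_real (sqrt d) / (1 - Q1 x w))
          = (of_real (sqrt d) * of_real (sqrt d)) * (L z w * (1 - Q1 w z)) / ((1 - Q1 w x) * (1 - Q1 x z))"
          by (simp only:) (simp add: mult_ac)
        then show "of_real (sqrt d) / (1 - Q1 x z) * (L z w * (1 - Q1 w z)) * cnj (of_real (sqrt d) / (1 - Q1 x w))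
          = L z w * (1 - Q2 w z)"
          unfolding sd by (simp add: Q2_def d(2))
      qed
      have row2: "psd X (\<lambda>z w. K z w * (1 - Q2 z w))"
      proof (rule psd_limit[OF K psdQ2])
        fix r' :: real assume "0 < r'" "r' < 1"
        then show "psd X (\<lambda>z w. K z w * (1 - of_real r' * Q2 z w))"
          by (rule column_imp_row_step[OF fin x cp K L psdQ2 \<open>Q2 x x = 0\<close> col2 _ _ IH])
      qed
      show "psd X (\<lambda>z w. K z w * (1 - of_real r * Q z w))"
      proof (rule psd_cong[OF psd_congruence[OF row2, of "\<lambda>z. (1 - Q1 z x) / of_real (sqrt d)"]])
        fix z w assume zw: "z \<in> X" "w \<in> X"
        have "cnj ((1 - Q1 w x) / of_real (sqrt d)) = (1 - Q1 x w) / of_real (sqrt d)"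
          using h[OF zw(2)] by simp
        then have "(1 - Q1 z x) / of_real (sqrt d) * (K z w * (1 - Q2 z w)) * cnj ((1 - Q1 w x) / of_real (sqrt d))
          = (1 - Q1 z x) * (1 - Q1 x w) * (K z w * (1 - Q2 z w)) / (of_real (sqrt d) * of_real (sqrt d))"
          by (simp only:) (simp add: mult_ac)
        also have "\<dots> = K z w * (1 - Q1 z w)"
          unfolding sd using ne[OF zw(1) x] ne[OF x zw(2)] d by (simp add: Q2_def)
        finally show "(1 - Q1 z x) / of_real (sqrt d) * (K z w * (1 - Q2 z w)) * cnj ((1 - Q1 w x) / of_real (sqrt d))
          = K z w * (1 - of_real r * Q z w)"
          by (simp add: Q1_def)
      qed
    qed
  qed
qed

section \<open>Kernel sums and multipliers\<close>

context rkhs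
begin

definition nsq :: "('x \<Rightarrow> complex) \<Rightarrow> real"
  where "nsq f = Re (ip f f)"

definition kernel_sum :: "'x set \<Rightarrow> ('x \<Rightarrow> complex) \<Rightarrow> 'x \<Rightarrow> complex"
  where "kernel_sum Y c = (\<lambda>z. \<Sum>w\<in>Y. K z w * c w)"

lemma diff_mem:
  assumes "f \<in> H" "g \<in> H"
  shows "f - g \<in> H"
proof -
  have "f + (\<lambda>x. (-1) * g x) \<in> H" by (intro add_mem scale_mem assms)
  moreover have "f + (\<lambda>x. (-1) * g x) = f - g" by (simp add: fun_eq_iff)
  ultimately show ?thesis by simp
qed

lemma ip_diff:
  assumes "f \<in> H" "g \<in> H" "h \<in> H"
  shows "ip (f - g) h = ip f h - ip g h"
proof -
  have "ip (f + (\<lambda>x. (-1) * g x)) h = ip f h + (-1) * ip g h"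
    using assms by (simp only: ip_add ip_scale scale_mem)
  moreover have "f + (\<lambda>x. (-1) * g x) = f - g" by (simp add: fun_eq_iff)
  ultimately show ?thesis by simp
qed

lemma ip_add_right: "f \<in> H \<Longrightarrow> g \<in> H \<Longrightarrow> h \<in> H \<Longrightarrow> ip h (f + g) = ip h f + ip h g"
  using ip_cnj[of "f + g" h] ip_cnj[of f h] ip_cnj[of g h] by (simp add: ip_add add_mem)

lemma ip_diff_right: "f \<in> H \<Longrightarrow> g \<in> H \<Longrightarrow> h \<in> H \<Longrightarrow> ip h (f - g) = ip h f - ip h g"
  using ip_cnj[of "f - g" h] ip_cnj[of f h] ip_cnj[of g h] by (simp add: ip_diff diff_mem)

lemma ip_scale_right: "f \<in> H \<Longrightarrow> h \<in> H \<Longrightarrow> ip h (\<lambda>x. c * f x) = cnj c * ip h f"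
  using ip_cnj[of "\<lambda>x. c * f x" h] ip_cnj[of f h] by (simp add: ip_scale scale_mem)

lemma Re_ip_sym: "f \<in> H \<Longrightarrow> g \<in> H \<Longrightarrow> Re (ip g f) = Re (ip f g)"
  using ip_cnj[of f g] by simp

lemma ip_self:
  assumes "f \<in> H"
  shows "ip f f = of_real (nsq f)"
proof -
  have "Im (ip f f) = Im (cnj (ip f f))" using arg_cong[OF ip_cnj[OF assms assms], of Im] .
  then show ?thesis by (simp add: nsq_def complex_eq_iff)
qed

lemma nsq_nonneg: "f \<in> H \<Longrightarrow> 0 \<le> nsq f"
  unfolding nsq_def by (rule ip_nonneg)

lemma nsq_eq_0: "f \<in> H \<Longrightarrow> nsq f = 0 \<Longrightarrow> f = 0"
  using ip_definite ip_self by simp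

lemma nsq_add: "f \<in> H \<Longrightarrow> g \<in> H \<Longrightarrow> nsq (f + g) = nsq f + nsq g + 2 * Re (ip f g)"
  unfolding nsq_def by (simp add: ip_add ip_add_right add_mem Re_ip_sym)

lemma nsq_diff: "f \<in> H \<Longrightarrow> g \<in> H \<Longrightarrow> nsq (f - g) = nsq f + nsq g - 2 * Re (ip f g)"
  unfolding nsq_def by (simp add: ip_diff ip_diff_right diff_mem Re_ip_sym)

lemma nsq_scale:
  assumes "f \<in> H"
  shows "nsq (\<lambda>x. c * f x) = (cmod c)\<^sup>2 * nsq f"
proof -
  have "ip (\<lambda>x. c * f x) (\<lambda>x. c * f x) = (c * cnj c) * ip f f"
    using assms by (simp add: ip_scale ip_scale_right scale_mem)
  also have "\<dots> = of_real ((cmod c)\<^sup>2) * ip f f" by (subst complex_norm_square) simp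
  finally show ?thesis by (simp add: nsq_def)
qed

lemma ip_young: "f \<in> H \<Longrightarrow> g \<in> H \<Longrightarrow> 2 * Re (ip f g) \<le> nsq f + nsq g"
  using nsq_nonneg[OF diff_mem, of f g] nsq_diff[of f g] by simp

lemma ip_norm_eq: "ip_norm ip f = sqrt (nsq f)"
  by (simp add: ip_norm_def nsq_def)

section \<open>Kernel sums and their density\<close>

lemma kernel_sum_mem:
  assumes "finite Y"
  shows "kernel_sum Y c \<in> H"
  using assms
proof (induction rule: finite_induct)
  case empty
  have "kernel_sum {} c = 0" by (simp add: kernel_sum_def fun_eq_iff)
  then show ?case using zero_mem by (simp only:)
next
  case (insert w Y)
  have "(\<lambda>z. c w * K z w) + kernel_sum Y c \<in> H"
    by (intro add_mem scale_mem kernel_mem insert.IH)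
  moreover have "(\<lambda>z. c w * K z w) + kernel_sum Y c = kernel_sum (insert w Y) c"
    using insert.hyps by (simp add: kernel_sum_def fun_eq_iff mult.commute)
  ultimately show ?case by simp
qed

lemma ip_kernel_sum:
  assumes "finite Y" "f \<in> H"
  shows "ip f (kernel_sum Y c) = (\<Sum>w\<in>Y. cnj (c w) * f w)"
  using assms(1)
proof (induction rule: finite_induct)
  case empty
  have "kernel_sum {} c = (\<lambda>x. 0 * f x)" by (simp add: kernel_sum_def fun_eq_iff)
  then show ?case using ip_scale_right[OF assms(2) assms(2), of 0] by simp
next
  case (insert w Y)
  have "kernel_sum (insert w Y) c = (\<lambda>z. c w * K z w) + kernel_sum Y c"
    using insert.hyps by (simp add: kernel_sum_def fun_eq_iff mult.commute)
  then have "ip f (kernel_sum (insert w Y) c) = cnj (c w) * ip f (\<lambda>z. K z w) + ip f (kernel_sum Y c)"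
    using insert.hyps assms(2)
    by (simp add: ip_add_right ip_scale_right scale_mem kernel_mem kernel_sum_mem)
  then show ?case
    using insert reproducing[OF assms(2), of w] by simp
qed

lemma nsq_kernel_sum:
  assumes "finite Y"
  shows "nsq (kernel_sum Y c) = Re (qf Y K c)"
  unfolding nsq_def ip_kernel_sum[OF assms kernel_sum_mem[OF assms]]
  by (simp add: kernel_sum_def qf_def sum_distrib_left mult.assoc)

lemma kernel_herm: "K w z = cnj (K z w)"
  using reproducing[OF kernel_mem, of z w] reproducing[OF kernel_mem, of w z] ip_cnj[OF kernel_mem kernel_mem, of w z]
  by simp

lemma psd_kernel: "finite Y \<Longrightarrow> psd Y K"
  by (intro psdI kernel_herm) (simp add: nsq_kernel_sum[symmetric] nsq_nonneg kernel_sum_mem)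

text \<open>Kernel functions of different points may be linearly dependent, and \<open>K\<close>
  then has no inverse matrix on these points. A null vector of the matrix represents the zero
  function, so a point of its support can be eliminated from the sum.\<close>

lemma kernel_sum_independent:
  assumes "finite Y"
  shows "\<exists>Z d. finite Z \<and> pd Z K \<and> kernel_sum Z d = kernel_sum Y c"
  using assms
proof (induction Y arbitrary: c rule: finite_psubset_induct)
  case (psubset Y)
  show ?case
  proof (cases "pd Y K")
    case True
    then show ?thesis using psubset.hyps by blast
  next
    case False
    then obtain e x where e: "Re (qf Y K e) = 0" and x: "x \<in> Y" "e x \<noteq> 0"
      using psd_kernel[OF psubset.hyps] unfolding pd_def by blast
    have zero: "kernel_sum Y e = 0"
      using nsq_eq_0[OF kernel_sum_mem[OF psubset.hyps]] nsq_kernel_sum[OF psubset.hyps] e by simp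
    define d where "d w = c w - c x / e x * e w" for w
    have "kernel_sum Y c z = kernel_sum (Y - {x}) d z" for z
    proof -
      have "kernel_sum Y d z = kernel_sum Y c z - c x / e x * kernel_sum Y e z"
        by (simp add: kernel_sum_def d_def sum_subtractf sum_distrib_left algebra_simps)
      moreover have "kernel_sum Y d z = kernel_sum (Y - {x}) d z"
        unfolding kernel_sum_def using psubset.hyps x
        by (intro sum.mono_neutral_right) (auto simp: d_def)
      ultimately show ?thesis using zero by simp
    qed
    then have "kernel_sum Y c = kernel_sum (Y - {x}) d" by (rule ext)
    then show ?thesis using psubset.IH[of "Y - {x}" d] x by auto
  qed
qed

text \<open>Minimising over \<open>t\<close> gives the best bound, at the projection coefficient.
  For \<open>D = 0\<close> this is Cauchy-Schwarz; for \<open>D\<close> an infimum of squared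
  distances it says that a near-minimiser is almost orthogonal to \<open>k\<close>.\<close>

lemma ip_bound_of_lower_bound:
  assumes "u \<in> H" "k \<in> H" and D: "\<And>t. D \<le> nsq (u - (\<lambda>x. t * k x))"
  shows "(cmod (ip u k))\<^sup>2 \<le> (nsq u - D) * nsq k"
proof (cases "nsq k = 0")
  case True
  then have "k = (\<lambda>x. 0 * u x)" using nsq_eq_0[OF assms(2)] by (simp add: fun_eq_iff)
  then have "ip u k = 0" using ip_scale_right[OF assms(1,1), of 0] by simp
  then show ?thesis using True by simp
next
  case False
  define t where "t = ip u k / of_real (nsq k)"
  have pos: "0 < nsq k" using False nsq_nonneg[OF assms(2)] by simp
  have "Re (ip u (\<lambda>x. t * k x)) = (cmod (ip u k))\<^sup>2 / nsq k"
  proof -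
    have "ip u (\<lambda>x. t * k x) = (ip u k * cnj (ip u k)) / of_real (nsq k)"
      using ip_scale_right[OF assms(2,1), of t] by (simp add: t_def)
    also have "\<dots> = of_real ((cmod (ip u k))\<^sup>2 / nsq k)"
      unfolding of_real_divide by (subst complex_norm_square) simp
    finally show ?thesis by simp
  qed
  moreover have "(cmod t)\<^sup>2 * nsq k = (cmod (ip u k))\<^sup>2 / nsq k"
    using pos by (simp add: t_def norm_divide power_divide power2_eq_square)
  ultimately have "nsq (u - (\<lambda>x. t * k x)) = nsq u - (cmod (ip u k))\<^sup>2 / nsq k"
    using nsq_diff[OF assms(1) scale_mem[OF assms(2), of t]] nsq_scale[OF assms(2), of t] by simp
  then have "(cmod (ip u k))\<^sup>2 / nsq k \<le> nsq u - D" using D[of t] by simp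
  then show ?thesis using pos by (simp add: field_simps)
qed

lemma norm_eval_le:
  assumes "f \<in> H"
  shows "(cmod (f w))\<^sup>2 \<le> nsq f * nsq (\<lambda>z. K z w)"
  using ip_bound_of_lower_bound[OF assms kernel_mem[of w], of 0]
    nsq_nonneg[OF diff_mem[OF assms scale_mem[OF kernel_mem]]] reproducing[OF assms, of w]
  by simp

lemma kernel_sum_diff_scale:
  assumes "finite Y"
  shows "\<exists>Z d. finite Z \<and> kernel_sum Z d = kernel_sum Y c + (\<lambda>z. t * K z w)"
proof (intro exI conjI)
  let ?c = "\<lambda>v. (if v \<in> Y then c v else 0) + (if v = w then t else 0)"
  show "finite (insert w Y)" using assms by simp
  have "(\<Sum>v\<in>insert w Y. K z v * ?c v) = (\<Sum>v\<in>Y. K z v * c v) + t * K z w" for z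
  proof -
    have "(\<Sum>v\<in>insert w Y. K z v * ?c v) = (\<Sum>v\<in>insert w Y. if v \<in> Y then K z v * c v else 0)
        + (\<Sum>v\<in>insert w Y. if v = w then t * K z w else 0)"
      unfolding sum.distrib[symmetric] by (intro sum.cong) (auto simp: algebra_simps)
    also have "(\<Sum>v\<in>insert w Y. if v \<in> Y then K z v * c v else 0) = (\<Sum>v\<in>Y. K z v * c v)"
      using assms by (intro sum.mono_neutral_cong_right) auto
    finally show ?thesis using assms by simp
  qed
  then show "kernel_sum (insert w Y) ?c = kernel_sum Y c + (\<lambda>z. t * K z w)"
    by (simp add: kernel_sum_def fun_eq_iff)
qed

lemma kernel_sum_midpoint:
  assumes "finite Y" "finite Z"
  shows "\<exists>V e. finite V \<and> kernel_sum V e = (\<lambda>x. (1 / 2) * (kernel_sum Y c + kernel_sum Z d) x)"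
proof (intro exI conjI)
  let ?e = "\<lambda>v. ((if v \<in> Y then c v else 0) + (if v \<in> Z then d v else 0)) / 2"
  show "finite (Y \<union> Z)" using assms by simp
  have "(\<Sum>v\<in>Y \<union> Z. K z v * ?e v) = (1 / 2) * ((\<Sum>v\<in>Y. K z v * c v) + (\<Sum>v\<in>Z. K z v * d v))" for z
  proof -
    have "(\<Sum>v\<in>Y \<union> Z. K z v * ?e v) = (1 / 2) * ((\<Sum>v\<in>Y \<union> Z. if v \<in> Y then K z v * c v else 0)
        + (\<Sum>v\<in>Y \<union> Z. if v \<in> Z then K z v * d v else 0))"
      unfolding sum.distrib[symmetric] sum_distrib_left by (intro sum.cong) (auto simp: algebra_simps)
    also have "(\<Sum>v\<in>Y \<union> Z. if v \<in> Y then K z v * c v else 0) = (\<Sum>v\<in>Y. K z v * c v)"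
      using assms by (intro sum.mono_neutral_cong_right) auto
    also have "(\<Sum>v\<in>Y \<union> Z. if v \<in> Z then K z v * d v else 0) = (\<Sum>v\<in>Z. K z v * d v)"
      using assms by (intro sum.mono_neutral_cong_right) auto
    finally show ?thesis .
  qed
  then show "kernel_sum (Y \<union> Z) ?e = (\<lambda>x. (1 / 2) * (kernel_sum Y c + kernel_sum Z d) x)"
    by (simp add: kernel_sum_def fun_eq_iff)
qed

text \<open>A sequence of kernel sums minimising the distance to \<open>h\<close> is Cauchy by the parallelogram
  law, and its limit agrees with \<open>h\<close> at every point.\<close>

lemma kernel_sums_dense:
  assumes h: "h \<in> H" and e: "0 < e"
  shows "\<exists>Y c. finite Y \<and> nsq (h - kernel_sum Y c) < e"
proof -
  define S where "S = {kernel_sum Y c |Y c. finite Y}"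
  have SH: "S \<subseteq> H" using kernel_sum_mem by (auto simp: S_def)
  define D where "D = Inf ((\<lambda>g. nsq (h - g)) ` S)"
  have bdd: "bdd_below ((\<lambda>g. nsq (h - g)) ` S)"
    by (rule bdd_belowI[of _ 0]) (use nsq_nonneg[OF diff_mem[OF h]] SH in auto)
  have "kernel_sum {} (\<lambda>_. 0) \<in> S" unfolding S_def by blast
  then have ne: "S \<noteq> {}" by blast
  have D: "D \<le> nsq (h - g)" if "g \<in> S" for g
    unfolding D_def using that bdd by (intro cInf_lower) auto
  have "\<exists>g\<in>S. nsq (h - g) < D + \<delta>" if "0 < \<delta>" for \<delta>
    using cInf_lessD[of "(\<lambda>g. nsq (h - g)) ` S" "D + \<delta>"] ne that by (auto simp: D_def)
  then have "\<forall>n. \<exists>g. g \<in> S \<and> nsq (h - g) < D + 1 / real (Suc n)"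
    by (metis of_nat_0_less_iff zero_less_Suc zero_less_divide_1_iff)
  from choice[OF this] obtain g where gS: "\<And>n. g n \<in> S" and gD: "\<And>n. nsq (h - g n) < D + 1 / real (Suc n)"
    by blast
  have gH: "g n \<in> H" for n using gS SH by blast
  have cauchy: "nsq (g m - g n) \<le> 2 / real (Suc m) + 2 / real (Suc n)" for m n
  proof -
    let ?a = "h - g m" and ?b = "h - g n"
    have ab: "?a \<in> H" "?b \<in> H" by (intro diff_mem h gH)+
    have "g m - g n = ?b - ?a" by (simp add: fun_eq_iff)
    then have 1: "nsq (g m - g n) = 2 * nsq ?a + 2 * nsq ?b - nsq (?a + ?b)"
      using nsq_diff[OF ab(2,1)] nsq_add[OF ab] Re_ip_sym[OF ab] by simp
    obtain Y c Z d where Y: "finite Y" "g m = kernel_sum Y c" and Z: "finite Z" "g n = kernel_sum Z d"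
      using gS[of m] gS[of n] by (auto simp: S_def)
    \<comment> \<open>The midpoint is again a kernel sum, so its squared distance from
      \<open>h\<close> is at least \<open>D\<close>.\<close>
    obtain V k where V: "finite V" "kernel_sum V k = (\<lambda>x. (1 / 2) * (g m + g n) x)"
      using kernel_sum_midpoint[OF Y(1) Z(1)] Y(2) Z(2) by metis
    have "D \<le> nsq (h - kernel_sum V k)" using V(1) by (intro D) (auto simp: S_def)
    also have "h - kernel_sum V k = (\<lambda>x. (1 / 2) * (?a + ?b) x)"
      unfolding V(2) by (simp add: fun_eq_iff field_simps)
    also have "nsq \<dots> = nsq (?a + ?b) / 4"
      using nsq_scale[OF add_mem[OF ab], of "1 / 2"] by (simp add: norm_divide power_divide)
    finally show ?thesis using 1 gD[of m] gD[of n] by simp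
  qed
  have "\<exists>f\<in>H. (\<lambda>n. ip_norm ip (g n - f)) \<longlonglongrightarrow> 0"
  proof (rule complete)
    show "\<forall>n. g n \<in> H" using gH by blast
    show "\<forall>\<epsilon>>0. \<exists>N. \<forall>m\<ge>N. \<forall>n\<ge>N. ip_norm ip (g m - g n) < \<epsilon>"
    proof (intro allI impI)
      fix \<epsilon> :: real assume \<epsilon>: "0 < \<epsilon>"
      obtain N where N: "4 / \<epsilon>\<^sup>2 < real N" using reals_Archimedean2 by blast
      have "ip_norm ip (g m - g n) < \<epsilon>" if "N \<le> m" "N \<le> n" for m n
      proof -
        have Np: "0 < real N" using N \<epsilon> by (smt (verit, best) divide_pos_pos zero_less_power)
        have "2 / real (Suc k) < 2 / real N" if "N \<le> k" for k
          using that Np by (intro divide_strict_left_mono) auto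
        from this[of m] this[of n] that have "nsq (g m - g n) < 4 / real N"
          using cauchy[of m n] by simp
        also have "4 / real N < \<epsilon>\<^sup>2" using N Np \<epsilon> by (simp add: field_simps)
        finally show ?thesis
          unfolding ip_norm_eq using \<epsilon> by (simp add: real_less_lsqrt nsq_nonneg diff_mem gH)
      qed
      then show "\<exists>N. \<forall>m\<ge>N. \<forall>n\<ge>N. ip_norm ip (g m - g n) < \<epsilon>" by blast
    qed
  qed
  then obtain f where f: "f \<in> H" and lim: "(\<lambda>n. ip_norm ip (g n - f)) \<longlonglongrightarrow> 0" by blast
  have lim2: "(\<lambda>n. nsq (g n - f)) \<longlonglongrightarrow> 0"
  proof -
    have "(\<lambda>n. (ip_norm ip (g n - f))\<^sup>2) \<longlonglongrightarrow> 0\<^sup>2" by (intro tendsto_intros lim)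
    then show ?thesis by (simp add: ip_norm_eq nsq_nonneg diff_mem gH f)
  qed
  have "h w = f w" for w
  proof -
    let ?k = "nsq (\<lambda>z. K z w)"
    have "(cmod (h w - g n w))\<^sup>2 \<le> (1 / real (Suc n)) * ?k" for n
    proof -
      \<comment> \<open>Moving \<open>g n\<close> along the kernel function at \<open>w\<close>
        stays among kernel sums, so \<open>D\<close> remains a lower bound. Hence
        \<open>h - g n\<close> is almost orthogonal to that kernel function, that is, small at
        \<open>w\<close>.\<close>
      have "D \<le> nsq ((h - g n) - (\<lambda>x. t * K x w))" for t
      proof -
        obtain Y c where Y: "finite Y" "g n = kernel_sum Y c" using gS[of n] by (auto simp: S_def)
        obtain Z d where Z: "finite Z" "kernel_sum Z d = g n + (\<lambda>z. t * K z w)"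
          using kernel_sum_diff_scale[OF Y(1)] Y(2) by metis
        have "D \<le> nsq (h - kernel_sum Z d)" using Z(1) by (intro D) (auto simp: S_def)
        also have "h - kernel_sum Z d = (h - g n) - (\<lambda>x. t * K x w)"
          unfolding Z(2) by (simp add: fun_eq_iff)
        finally show ?thesis .
      qed
      from ip_bound_of_lower_bound[OF diff_mem[OF h gH] kernel_mem this]
      have "(cmod ((h - g n) w))\<^sup>2 \<le> (nsq (h - g n) - D) * ?k"
        using reproducing[OF diff_mem[OF h gH[of n]], of w] by simp
      also have "\<dots> \<le> (1 / real (Suc n)) * ?k"
        using gD[of n] nsq_nonneg[OF kernel_mem, of w] by (intro mult_right_mono) auto
      finally show ?thesis by simp
    qed
    moreover have "(cmod (g n w - f w))\<^sup>2 \<le> nsq (g n - f) * ?k" for n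
      using norm_eval_le[OF diff_mem[OF gH f], of n w] by simp
    moreover have "(cmod (h w - f w))\<^sup>2 \<le> 2 * (cmod (h w - g n w))\<^sup>2 + 2 * (cmod (g n w - f w))\<^sup>2" for n
    proof -
      have "cmod (h w - f w) \<le> cmod (h w - g n w) + cmod (g n w - f w)"
        using norm_triangle_ineq[of "h w - g n w" "g n w - f w"] by simp
      then have "(cmod (h w - f w))\<^sup>2 \<le> (cmod (h w - g n w) + cmod (g n w - f w))\<^sup>2"
        by (rule power_mono) simp
      also have "\<dots> \<le> 2 * (cmod (h w - g n w))\<^sup>2 + 2 * (cmod (g n w - f w))\<^sup>2"
        using sum_squares_bound[of "cmod (h w - g n w)" "cmod (g n w - f w)"] by (simp add: power2_sum)
      finally show ?thesis .
    qed
    ultimately have le: "(cmod (h w - f w))\<^sup>2 \<le> 2 * (1 / real (Suc n) * ?k) + 2 * (nsq (g n - f) * ?k)" for n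
      by (smt (verit, best))
    have "(\<lambda>n. 2 * (1 / real (Suc n) * ?k) + 2 * (nsq (g n - f) * ?k)) \<longlonglongrightarrow> 2 * (0 * ?k) + 2 * (0 * ?k)"
      by (intro tendsto_intros lim2 LIMSEQ_Suc[OF lim_1_over_n])
    then have "(cmod (h w - f w))\<^sup>2 \<le> 2 * (0 * ?k) + 2 * (0 * ?k)"
      by (rule LIMSEQ_le_const) (use le in blast)
    then show ?thesis by simp
  qed
  then have "h = f" by (rule ext)
  moreover have "\<forall>\<^sub>F n in sequentially. nsq (g n - f) < e"
    using lim2 e by (rule order_tendstoD(2))
  ultimately obtain n where "nsq (g n - h) < e"
    using eventually_happens'[OF sequentially_bot] by blast
  moreover have "nsq (g n - h) = nsq (h - g n)"
    using nsq_diff[OF gH h, of n] nsq_diff[OF h gH, of n] Re_ip_sym[OF h gH, of n] by simp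
  moreover obtain Y c where "finite Y" "g n = kernel_sum Y c" using gS[of n] by (auto simp: S_def)
  ultimately show ?thesis by auto
qed

text \<open>The assumption bounds \<open>nsq h\<close> by \<open>A\<close> plus the squared distance
  from \<open>h\<close> to an arbitrary kernel sum, and density makes that distance small. The
  quadratic form of the test matches Young's inequality.\<close>

lemma nsq_le_by_kernel_sums:
  assumes h: "h \<in> H"
    and le: "\<And>Y c. finite Y \<Longrightarrow> 2 * Re (ip h (kernel_sum Y c)) \<le> A + nsq (kernel_sum Y c)"
  shows "nsq h \<le> A"
proof (rule field_le_epsilon)
  fix e :: real assume "0 < e"
  then obtain Y c where Y: "finite Y" and e: "nsq (h - kernel_sum Y c) < e"
    using kernel_sums_dense[OF h] by blast
  then show "nsq h \<le> A + e"
    using le[OF Y, of c] nsq_diff[OF h kernel_sum_mem[OF Y], of c] by simp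
qed

section \<open>Norm bounds for multipliers and columns as inequalities between squared norms\<close>

lemma contraction_iff:
  assumes hom: "\<And>c f. f \<in> H \<Longrightarrow> q (\<lambda>x. c * f x) = (cmod c)\<^sup>2 * q f" and nonneg: "\<And>f. f \<in> H \<Longrightarrow> 0 \<le> q f"
  shows "(\<forall>f\<in>H. ip_norm ip f \<le> 1 \<longrightarrow> sqrt (q f) \<le> 1) \<longleftrightarrow> (\<forall>f\<in>H. q f \<le> nsq f)"
proof
  assume l: "\<forall>f\<in>H. ip_norm ip f \<le> 1 \<longrightarrow> sqrt (q f) \<le> 1"
  show "\<forall>f\<in>H. q f \<le> nsq f"
  proof
    fix f assume f: "f \<in> H"
    show "q f \<le> nsq f"
    proof (cases "nsq f = 0")
      case True
      then have "f = (\<lambda>x. 0 * f x)" using nsq_eq_0[OF f] by (simp add: fun_eq_iff)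
      then have "q f = 0" using hom[OF f, of 0] by simp
      then show ?thesis using True by simp
    next
      case False
      then have pos: "0 < nsq f" using nsq_nonneg[OF f] by simp
      define c where "c = complex_of_real (1 / sqrt (nsq f))"
      have c: "(cmod c)\<^sup>2 = 1 / nsq f" using pos by (simp add: c_def norm_divide power_divide)
      have "ip_norm ip (\<lambda>x. c * f x) \<le> 1"
        unfolding ip_norm_eq nsq_scale[OF f] c using pos by simp
      then have "q (\<lambda>x. c * f x) \<le> 1" using l scale_mem[OF f] by simp
      then show ?thesis using pos by (simp add: hom[OF f] c)
    qed
  qed
next
  assume "\<forall>f\<in>H. q f \<le> nsq f"
  then show "\<forall>f\<in>H. ip_norm ip f \<le> 1 \<longrightarrow> sqrt (q f) \<le> 1"
    unfolding ip_norm_eq by (metis order_trans real_sqrt_le_1_iff)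
qed

lemma mult_scale: "(\<phi> :: 'x \<Rightarrow> complex) * (\<lambda>x. c * f x) = (\<lambda>x. c * (\<phi> * f) x)"
  by (simp add: fun_eq_iff mult.left_commute)

lemma mult_ball_iff:
  "\<phi> \<in> mult_ball H ip \<longleftrightarrow> \<phi> \<in> Mult H \<and> (\<forall>f\<in>H. nsq (\<phi> * f) \<le> nsq f)"
proof (cases "\<phi> \<in> Mult H")
  case True
  then have \<phi>: "\<phi> * f \<in> H" if "f \<in> H" for f using that by (simp add: Mult_def)
  have "mult_norm H ip \<phi> \<le> 1 \<longleftrightarrow> (\<forall>f\<in>H. ip_norm ip f \<le> 1 \<longrightarrow> sqrt (nsq (\<phi> * f)) \<le> 1)"
    by (auto simp: mult_norm_def op_norm_def SUP_le_iff one_ereal_def ip_norm_eq)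
  also have "\<dots> \<longleftrightarrow> (\<forall>f\<in>H. nsq (\<phi> * f) \<le> nsq f)"
    by (rule contraction_iff) (simp_all only: mult_scale nsq_scale \<phi> nsq_nonneg)
  finally show ?thesis using True by (simp add: mult_ball_def)
qed (simp add: mult_ball_def)

lemma column_norm_iff:
  assumes "b \<in> Mult H" "a \<in> Mult H"
  shows "column_norm H ip b a \<le> 1 \<longleftrightarrow> (\<forall>f\<in>H. nsq (b * f) + nsq (a * f) \<le> nsq f)"
proof -
  have m: "b * f \<in> H" "a * f \<in> H" if "f \<in> H" for f using assms that by (simp_all add: Mult_def)
  have "sum_norm ip (b * f, a * f) = sqrt (nsq (b * f) + nsq (a * f))" if "f \<in> H" for f
    using m[OF that] by (simp add: sum_norm_def ip_norm_eq nsq_nonneg)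
  then have "column_norm H ip b a \<le> 1 \<longleftrightarrow>
      (\<forall>f\<in>H. ip_norm ip f \<le> 1 \<longrightarrow> sqrt (nsq (b * f) + nsq (a * f)) \<le> 1)"
    by (auto simp: column_norm_def op_norm_def SUP_le_iff one_ereal_def)
  also have "\<dots> \<longleftrightarrow> (\<forall>f\<in>H. nsq (b * f) + nsq (a * f) \<le> nsq f)"
    by (rule contraction_iff) (simp_all only: mult_scale nsq_scale m nsq_nonneg distrib_left add_nonneg_nonneg)
  finally show ?thesis .
qed

lemma column_kernel_psd:
  assumes "b \<in> Mult H" "a \<in> Mult H" and col: "\<And>f. f \<in> H \<Longrightarrow> nsq (b * f) + nsq (a * f) \<le> nsq f"
    and Y: "finite Y"
  shows "psd (Y \<times> UNIV) (column_kernel K (\<lambda>z i. if i then b z else a z))"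
proof (rule psdI)
  fix p q :: "'x \<times> bool"
  show "column_kernel K (\<lambda>z i. if i then b z else a z) q p = cnj (column_kernel K (\<lambda>z i. if i then b z else a z) p q)"
    using kernel_herm[of "fst q" "fst p"] by (auto simp: column_kernel_def mult.commute)
next
  fix c :: "'x \<times> bool \<Rightarrow> complex"
  \<comment> \<open>For the column operator M with entries \<open>b\<close> and \<open>a\<close>,
    the function \<open>kernel_sum Y d\<close> is M* applied to the pair \<open>?B\<close>,
    \<open>?A\<close>. The claim is thus contractivity of M*, derived from that of M.\<close>
  define d where "d z = cnj (b z) * c (z, True) + cnj (a z) * c (z, False)" for z
  define f where "f = kernel_sum Y d"
  let ?B = "kernel_sum Y (\<lambda>z. c (z, True))" and ?A = "kernel_sum Y (\<lambda>z. c (z, False))"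
  have f: "f \<in> H" unfolding f_def by (rule kernel_sum_mem[OF Y])
  have m: "b * f \<in> H" "a * f \<in> H" using assms f by (simp_all add: Mult_def)
  have "ip f f = ip (b * f) ?B + ip (a * f) ?A"
    unfolding ip_kernel_sum[OF Y m(1)] ip_kernel_sum[OF Y m(2)]
    unfolding f_def ip_kernel_sum[OF Y kernel_sum_mem[OF Y]] sum.distrib[symmetric]
    by (intro sum.cong refl) (simp add: d_def algebra_simps)
  then have "2 * nsq f = 2 * Re (ip (b * f) ?B) + 2 * Re (ip (a * f) ?A)" by (simp add: nsq_def)
  also have "\<dots> \<le> (nsq (b * f) + nsq (a * f)) + (nsq ?B + nsq ?A)"
    using ip_young[OF m(1) kernel_sum_mem[OF Y]] ip_young[OF m(2) kernel_sum_mem[OF Y]]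
    by (smt (verit, best))
  also have "\<dots> \<le> nsq f + (nsq ?B + nsq ?A)" using col[OF f] by simp
  finally have "Re (qf Y K d) \<le> nsq ?B + nsq ?A" by (simp add: f_def nsq_kernel_sum[OF Y])
  moreover have "(\<lambda>z. \<Sum>i\<in>UNIV. cnj (if i then b z else a z) * c (z, i)) = d"
    by (simp add: fun_eq_iff d_def UNIV_bool)
  ultimately show "0 \<le> Re (qf (Y \<times> UNIV) (column_kernel K (\<lambda>z i. if i then b z else a z)) c)"
    unfolding qf_column_kernel[OF Y finite] by (simp add: UNIV_bool nsq_kernel_sum[OF Y])
qed

end

section \<open>Extreme points\<close>

lemma ell2_inner_sums:
  assumes "v \<in> ell2_ball d" "w \<in> ell2_ball d'"
  shows "(\<lambda>i. v i * cnj (w i)) sums ell2_inner v w"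
proof -
  have "summable (\<lambda>i. (cmod (v i))\<^sup>2 + (cmod (w i))\<^sup>2)"
    using assms by (intro summable_add) (auto simp: ell2_ball_def)
  then have "summable (\<lambda>i. v i * cnj (w i))"
  proof (rule summable_comparison_test')
    fix i
    have "0 \<le> cmod (v i) * cmod (w i)" by simp
    then have "cmod (v i) * cmod (w i) \<le> (cmod (v i))\<^sup>2 + (cmod (w i))\<^sup>2"
      using sum_squares_bound[of "cmod (v i)" "cmod (w i)"] by linarith
    then show "norm (v i * cnj (w i)) \<le> (cmod (v i))\<^sup>2 + (cmod (w i))\<^sup>2" by (simp add: norm_mult)
  qed
  then show ?thesis by (simp add: ell2_inner_def summable_sums)
qed

lemma ell2_inner_self:
  assumes "v \<in> ell2_ball d"
  shows "ell2_inner v v = of_real (\<Sum>i. (cmod (v i))\<^sup>2)"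
proof -
  have "(\<lambda>i. of_real ((cmod (v i))\<^sup>2)) sums ell2_inner v v"
    using ell2_inner_sums[OF assms assms] by (simp only: complex_norm_square)
  moreover have "(\<lambda>i. complex_of_real ((cmod (v i))\<^sup>2)) sums of_real (\<Sum>i. (cmod (v i))\<^sup>2)"
    using assms by (intro sums_of_real summable_sums) (simp add: ell2_ball_def)
  ultimately show ?thesis by (rule sums_unique2)
qed

text \<open>Partial sums are Gram matrices, and positivity survives the limit.\<close>

lemma psd_ell2_inner:
  assumes "finite S" and \<beta>: "\<And>z. \<beta> z \<in> ell2_ball d"
  shows "psd S (\<lambda>z w. ell2_inner (\<beta> z) (\<beta> w))"
proof (rule psdI)
  fix z w
  have "(\<lambda>i. cnj (\<beta> z i * cnj (\<beta> w i))) sums cnj (ell2_inner (\<beta> z) (\<beta> w))"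
    using ell2_inner_sums[OF \<beta> \<beta>] by (simp only: sums_cnj)
  then have "(\<lambda>i. \<beta> w i * cnj (\<beta> z i)) sums cnj (ell2_inner (\<beta> z) (\<beta> w))"
    by (simp add: mult.commute)
  with ell2_inner_sums[OF \<beta> \<beta>] show "ell2_inner (\<beta> w) (\<beta> z) = cnj (ell2_inner (\<beta> z) (\<beta> w))"
    by (rule sums_unique2)
next
  note lim = ell2_inner_sums[OF \<beta> \<beta>, unfolded sums_def]
  fix c
  have "(\<lambda>n. Re (qf S (\<lambda>z w. \<Sum>i<n. \<beta> z i * cnj (\<beta> w i)) c))
      \<longlonglongrightarrow> Re (qf S (\<lambda>z w. ell2_inner (\<beta> z) (\<beta> w)) c)"
    unfolding qf_def by (intro tendsto_intros lim)
  moreover have "0 \<le> Re (qf S (\<lambda>z w. \<Sum>i<n. \<beta> z i * cnj (\<beta> w i)) c)" for n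
    by (rule psd_nonneg) (simp add: psd_gram)
  ultimately show "0 \<le> Re (qf S (\<lambda>z w. ell2_inner (\<beta> z) (\<beta> w)) c)"
    by (intro LIMSEQ_le_const) auto
qed

text \<open>As \<open>K\<close> is the reciprocal of 1 - F, the matrix required at \<open>x\<close>
  is the Moebius transform of \<open>F\<close>. An embedding with one origin therefore serves every
  base point.\<close>

lemma (in normalized_complete_pick) complete_pick_kernel:
  assumes "finite S"
  shows "complete_pick S K"
proof -
  obtain d \<beta> where \<beta>: "\<And>z. \<beta> z \<in> ell2_ball d"
    and K: "\<And>z w. K z w = 1 / (1 - ell2_inner (\<beta> z) (\<beta> w))"
    using normalized_pick by blast
  let ?F = "\<lambda>z w. ell2_inner (\<beta> z) (\<beta> w)"
  have F: "psd S ?F" using assms \<beta> by (rule psd_ell2_inner)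
  have ball: "Re (?F z z) < 1" for z
    using \<beta>[of z] by (simp add: ell2_inner_self[OF \<beta>] ell2_ball_def)
  have ne: "?F z w \<noteq> 1" if "z \<in> S" "w \<in> S" for z w
    using psd_mobius(1)[OF assms F ball that(1) that] .
  show ?thesis
    unfolding complete_pick_def
  proof (intro conjI ballI)
    fix z w assume "z \<in> S" "w \<in> S"
    then show "K z w \<noteq> 0" using ne by (simp add: K)
  next
    fix x assume x: "x \<in> S"
    show "psd S (\<lambda>z w. 1 - K z x * K x w / (K x x * K z w))"
    proof (rule psd_cong[OF psd_mobius(2)[OF assms F ball x]])
      fix z w assume "z \<in> S" "w \<in> S"
      then show "1 - (1 - ?F z w) * (1 - ?F x x) / ((1 - ?F z x) * (1 - ?F x w))
          = 1 - K z x * K x w / (K x x * K z w)"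
        unfolding K by (simp add: mult.commute)
    qed
  qed
qed

text \<open>The sums on the left are the adjoints of multiplication by \<open>b\<close> and
  \<open>a\<close> applied to \<open>kernel_sum Z c\<close>. Definiteness of \<open>K\<close> on
  \<open>Z\<close> provides the inverse matrix in which the column condition is expressed.\<close>

lemma (in normalized_complete_pick) row_contraction:
  assumes Mult: "b \<in> Mult H" "a \<in> Mult H"
    and col: "\<And>f. f \<in> H \<Longrightarrow> nsq (b * f) + nsq (a * f) \<le> nsq f"
    and Z: "finite Z" "pd Z K"
  shows "nsq (kernel_sum Z (\<lambda>z. cnj (b z) * c z)) + nsq (kernel_sum Z (\<lambda>z. cnj (a z) * c z))
    \<le> nsq (kernel_sum Z c)"
proof -
  obtain L where L: "inverse_kernel Z K L" using inverse_kernel_exists[OF Z] by blast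
  let ?Q = "\<lambda>z w. b z * cnj (b w) + a z * cnj (a w)"
  have "psd Z (\<lambda>z w. L z w * (1 - ?Q w z))"
    using column_kernel_imp_inverse_form[OF Z(1) finite psd_kernel[OF Z(1)] L
        column_kernel_psd[OF Mult col Z(1)]]
    by (simp add: UNIV_bool add.commute)
  then have "psd Z (\<lambda>z w. K z w * (1 - ?Q z w))"
    by (intro column_imp_row[OF Z(1) complete_pick_kernel psd_kernel L] psd_add psd_rank_one Z(1))
  then have "0 \<le> Re (qf Z (\<lambda>z w. K z w * (1 - ?Q z w)) c)" by (rule psd_nonneg)
  also have "qf Z (\<lambda>z w. K z w * (1 - ?Q z w)) c = qf Z (\<lambda>z w. K z w
      - (b z * K z w * cnj (b w) + a z * K z w * cnj (a w))) c"
    by (rule qf_cong) (simp_all add: algebra_simps)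
  also have "\<dots> = qf Z K c - (qf Z K (\<lambda>z. cnj (b z) * c z) + qf Z K (\<lambda>z. cnj (a z) * c z))"
    by (simp only: qf_diff qf_add qf_congruence)
  finally show ?thesis by (simp add: nsq_kernel_sum[OF Z(1)])
qed

text \<open>The pairing with a kernel sum g splits into <b f, g> + r <a f, a* g>. Twice the real
  part of the first term is at most the average of |b f|^2 + |g|^2 and |f|^2 + |b* g|^2. For the
  second it is at most half of |a f|^2 + |a* g|^2, and this is where the bound 1/2 on
  \<open>r\<close> comes from. Column contractivity at f and row contractivity at g make the total
  at most |f|^2 + |g|^2.\<close>

lemma (in normalized_complete_pick) mult_ball_perturbation:
  fixes r :: real
  assumes Mult: "b \<in> Mult H" "a \<in> Mult H"
    and col: "\<And>f. f \<in> H \<Longrightarrow> nsq (b * f) + nsq (a * f) \<le> nsq f"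
    and r: "\<bar>r\<bar> \<le> 1 / 2"
  shows "b + (\<lambda>x. of_real r * (a x * a x)) \<in> mult_ball H ip"
  unfolding mult_ball_iff
proof (intro conjI ballI)
  let ?p = "b + (\<lambda>x. of_real r * (a x * a x))"
  have bf: "b * f \<in> H" and af: "a * f \<in> H" if "f \<in> H" for f using Mult that by (simp_all add: Mult_def)
  have pf: "?p * f = b * f + (\<lambda>x. of_real r * (a * (a * f)) x)" for f
    by (simp add: fun_eq_iff algebra_simps)
  have p: "?p * f \<in> H" if "f \<in> H" for f
    unfolding pf by (intro add_mem scale_mem bf af that)
  then show "?p \<in> Mult H" by (simp add: Mult_def)
  fix f assume f: "f \<in> H"
  show "nsq (?p * f) \<le> nsq f"
  proof (rule nsq_le_by_kernel_sums[OF p[OF f]])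
    fix Y c assume "finite (Y :: 'a set)"
    then obtain Z d where Z: "finite Z" "pd Z K" and d: "kernel_sum Z d = kernel_sum Y c"
      using kernel_sum_independent by blast
    let ?g = "kernel_sum Z d"
    let ?B = "kernel_sum Z (\<lambda>z. cnj (b z) * d z)" and ?A = "kernel_sum Z (\<lambda>z. cnj (a z) * d z)"
    have mem: "?B \<in> H" "?A \<in> H" "?g \<in> H" by (intro kernel_sum_mem Z)+
    have mult: "ip (\<phi> * h) ?g = ip h (kernel_sum Z (\<lambda>z. cnj (\<phi> z) * d z))" if "h \<in> H" "\<phi> * h \<in> H" for \<phi> h
      unfolding ip_kernel_sum[OF Z(1) that(1)] ip_kernel_sum[OF Z(1) that(2)]
      by (simp add: mult_ac)
    have "2 * Re (ip (a * f) ?A) \<le> nsq (a * f) + nsq ?A"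
      by (intro ip_young af f mem)
    moreover have "- (2 * Re (ip (a * f) ?A)) \<le> nsq (a * f) + nsq ?A"
      using nsq_nonneg[OF add_mem[OF af[OF f] mem(2)]] nsq_add[OF af[OF f] mem(2)] by simp
    ultimately have "2 * \<bar>Re (ip (a * f) ?A)\<bar> \<le> nsq (a * f) + nsq ?A" by linarith
    moreover have "2 * (r * Re (ip (a * f) ?A)) \<le> \<bar>Re (ip (a * f) ?A)\<bar>"
    proof -
      have "r * Re (ip (a * f) ?A) \<le> \<bar>r\<bar> * \<bar>Re (ip (a * f) ?A)\<bar>" by (metis abs_ge_self abs_mult)
      also have "\<dots> \<le> 1 / 2 * \<bar>Re (ip (a * f) ?A)\<bar>" using r by (intro mult_right_mono) auto
      finally show ?thesis by simp
    qed
    moreover have "2 * Re (ip (b * f) ?g) \<le> nsq (b * f) + nsq ?g"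
      by (intro ip_young bf f mem)
    moreover have "2 * Re (ip (b * f) ?g) \<le> nsq f + nsq ?B"
      unfolding mult[OF f bf[OF f]] by (intro ip_young f mem)
    moreover have "nsq ?B + nsq ?A \<le> nsq ?g" by (rule row_contraction[OF Mult col Z])
    moreover have "ip (?p * f) ?g = ip (b * f) ?g + of_real r * ip (a * f) ?A"
      unfolding pf using mult[OF af[OF f] af[OF af[OF f]]]
      by (simp only: ip_add ip_scale scale_mem bf af f mem)
    ultimately have "2 * Re (ip (?p * f) ?g) \<le> nsq f + nsq ?g" using col[OF f] by simp
    then show "2 * Re (ip (?p * f) (kernel_sum Y c)) \<le> nsq f + nsq (kernel_sum Y c)"
      unfolding d .
  qed
qed

lemma (in normalized_complete_pick) extreme_imp_column_extreme:
  assumes "b extreme_point_of mult_ball H ip"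
  shows "column_extreme H ip b"
  unfolding column_extreme_def
proof (intro conjI notI)
  have b: "b \<in> mult_ball H ip" and ext: "\<And>u v. u \<in> mult_ball H ip \<Longrightarrow> v \<in> mult_ball H ip \<Longrightarrow> b \<notin> open_segment u v"
    using assms by (auto simp: extreme_point_of_def)
  show "b \<in> mult_ball H ip" by (rule b)
  assume "\<exists>a\<in>Mult H - {0}. column_norm H ip b a \<le> 1"
  then obtain a where a: "a \<in> Mult H" "a \<noteq> 0" and norm: "column_norm H ip b a \<le> 1" by blast
  have bM: "b \<in> Mult H" using b by (simp add: mult_ball_iff)
  have col: "nsq (b * f) + nsq (a * f) \<le> nsq f" if "f \<in> H" for f
    using norm that by (simp add: column_norm_iff[OF bM a(1)])
  let ?p = "\<lambda>r :: real. b + (\<lambda>x. of_real r * (a x * a x))"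
  obtain x where "a x \<noteq> 0" using a(2) by (auto simp: fun_eq_iff)
  then have "?p (- 1 / 2) x \<noteq> ?p (1 / 2) x" by simp
  then have "?p (- 1 / 2) \<noteq> ?p (1 / 2)" by metis
  moreover have "b = (1 - 1 / 2) *\<^sub>R ?p (- 1 / 2) + (1 / 2 :: real) *\<^sub>R ?p (1 / 2)"
    by (simp add: scaleR_fun_def fun_eq_iff scaleR_conv_of_real field_simps)
  ultimately have "b \<in> open_segment (?p (- 1 / 2)) (?p (1 / 2))"
    unfolding in_segment by (intro conjI exI[of _ "1 / 2"]) simp_all
  moreover have "?p (- 1 / 2) \<in> mult_ball H ip" "?p (1 / 2) \<in> mult_ball H ip"
    by (intro mult_ball_perturbation bM a(1) col; simp)+
  ultimately show False using ext by blast
qed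

section \<open>A contractive column from a proper convex combination\<close>

lemma (in rkhs) nsq_convex_combination:
  assumes "f \<in> H" "g \<in> H"
  shows "nsq (\<lambda>x. of_real (1 - t) * f x + of_real t * g x)
    = (1 - t) * nsq f + t * nsq g - t * (1 - t) * nsq (f - g)"
proof -
  have "(\<lambda>x. of_real (1 - t) * f x + of_real t * g x) = (\<lambda>x. of_real (1 - t) * f x) + (\<lambda>x. of_real t * g x)"
    by (simp add: fun_eq_iff)
  then have "nsq (\<lambda>x. of_real (1 - t) * f x + of_real t * g x)
      = (cmod (of_real (1 - t)))\<^sup>2 * nsq f + (cmod (of_real t))\<^sup>2 * nsq g + 2 * ((1 - t) * (t * Re (ip f g)))"
    using nsq_add[OF scale_mem[OF assms(1), of "of_real (1 - t)"] scale_mem[OF assms(2), of "of_real t"]]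
    by (simp add: nsq_scale assms ip_scale ip_scale_right scale_mem del: of_real_diff)
  then show ?thesis
    by (simp add: nsq_diff assms power2_eq_square algebra_simps del: of_real_diff)
qed

lemma (in rkhs) column_extreme_imp_extreme:
  assumes "column_extreme H ip b"
  shows "b extreme_point_of mult_ball H ip"
  unfolding extreme_point_of_def
proof (intro conjI ballI notI)
  show "b \<in> mult_ball H ip" using assms by (simp add: column_extreme_def)
  fix u v assume uv: "u \<in> mult_ball H ip" "v \<in> mult_ball H ip" and "b \<in> open_segment u v"
  then obtain t where "u \<noteq> v" and t: "0 < t" "t < 1" and b: "b = (1 - t) *\<^sub>R u + t *\<^sub>R v"
    by (auto simp: in_segment)
  have uf: "u * f \<in> H" "nsq (u * f) \<le> nsq f" and vf: "v * f \<in> H" "nsq (v * f) \<le> nsq f" if "f \<in> H" for f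
    using uv that by (auto simp: mult_ball_iff Mult_def)
  \<comment> \<open>With this weight \<open>nsq (a * f)\<close> is exactly the defect subtracted in
    \<open>nsq_convex_combination\<close>, so the two cancel.\<close>
  define s where "s = sqrt (t * (1 - t))"
  define a where "a = (\<lambda>x. of_real s * (u x - v x))"
  have s: "s\<^sup>2 = t * (1 - t)" "0 < s" using t by (simp_all add: s_def)
  have bf: "b * f = (\<lambda>x. of_real (1 - t) * (u * f) x + of_real t * (v * f) x)"
    and af: "a * f = (\<lambda>x. of_real s * (u * f - v * f) x)" for f
    unfolding b a_def by (simp_all add: fun_eq_iff scaleR_fun_def scaleR_conv_of_real algebra_simps)
  have "a \<in> Mult H"
    unfolding Mult_def using uf vf by (auto simp: af intro!: scale_mem diff_mem simp del: minus_apply)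
  moreover have "a \<noteq> 0" using s(2) \<open>u \<noteq> v\<close> by (auto simp: a_def fun_eq_iff)
  moreover have "column_norm H ip b a \<le> 1"
  proof -
    have "b \<in> Mult H" using assms by (simp add: column_extreme_def mult_ball_def)
    moreover have "nsq (b * f) + nsq (a * f) \<le> nsq f" if f: "f \<in> H" for f
    proof -
      have "nsq (a * f) = t * (1 - t) * nsq (u * f - v * f)"
        using s by (simp only: af nsq_scale diff_mem uf vf f norm_of_real power2_abs)
      moreover have "nsq (b * f) = (1 - t) * nsq (u * f) + t * nsq (v * f) - t * (1 - t) * nsq (u * f - v * f)"
        unfolding bf by (rule nsq_convex_combination[OF uf(1)[OF f] vf(1)[OF f]])
      moreover have "(1 - t) * nsq (u * f) + t * nsq (v * f) \<le> nsq f"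
        using convex_bound_le[OF uf(2)[OF f] vf(2)[OF f], of "1 - t" t] t by simp
      ultimately show ?thesis by simp
    qed
    ultimately show ?thesis using \<open>a \<in> Mult H\<close> by (simp add: column_norm_iff)
  qed
  ultimately show False using assms by (auto simp: column_extreme_def)
qed

theorem theorem1p6:
  fixes H :: "('x \<Rightarrow> complex) set"
    and ip :: "('x \<Rightarrow> complex) \<Rightarrow> ('x \<Rightarrow> complex) \<Rightarrow> complex"
    and K :: "'x \<Rightarrow> 'x \<Rightarrow> complex"
    and b :: "'x \<Rightarrow> complex"
  assumes "normalized_complete_pick H ip K"
    and "b \<in> mult_ball H ip"
  shows "b extreme_point_of mult_ball H ip \<longleftrightarrow> column_extreme H ip b"
proof -
  interpret normalized_complete_pick H ip K by (rule assms(1))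
  show ?thesis using extreme_imp_column_extreme column_extreme_imp_extreme by blast
qed

end
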